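(* Let $\mathcal{F}$ be a connected collection. Unless the Exponential Time Hypothesis fails, neither $\mathcal{F}$-TM-Deletion nor $\mathcal{F}$-M-Deletion can be solved in time $2^{o(\mathbf{tw})}\cdot n^{\mathcal{O}(1)}$, where $n$ is the number of vertices and $\mathbf{tw}$ the treewidth of the input graph.
   Context: A connected collection is a finite, non-empty collection of non-empty graphs all of which are connected. $\mathcal{F}$-TM-Deletion (resp. $\mathcal{F}$-M-Deletion): given a graph $G$ and integer $k$, decide whether there is $S\subseteq V(G)$, $|S|\le k$, such that $G\setminus S$ contains no graph of $\mathcal{F}$ as a topological minor (resp. as a minor). The Exponential Time Hypothesis (ETH) states that 3-SAT on $n$ variables cannot be solved in time $2^{o(n)}$. *)

theory Defs
  imports
    "Graph_Theory.Digraph_Component"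
    "Graph_Theory.Vertex_Walk"
    "HOL-Library.Landau_Symbols"
begin

section \<open>Graphs, minors and topological minors\<close>

text \<open>
  Finite simple undirected graphs are the symmetric loop-free digraphs without parallel arcs of
  the locale \<^locale>\<open>graph\<close>; an edge is a pair of opposite arcs. The qualified name
  \<^const>\<open>Digraph_Component.connected\<close> avoids the topological notion of connectedness; a
  connected graph in this sense has at least one vertex.
\<close>

definition minor_of :: "('a,'b) pre_digraph \<Rightarrow> ('c,'d) pre_digraph \<Rightarrow> bool" where
  "minor_of H G \<longleftrightarrow> (\<exists>\<phi> :: 'a \<Rightarrow> 'c set.
     (\<forall>x \<in> verts H. \<phi> x \<subseteq> verts G \<and> Digraph_Component.connected (G \<restriction> \<phi> x)) \<and>
     (\<forall>x \<in> verts H. \<forall>y \<in> verts H. x \<noteq> y \<longrightarrow> \<phi> x \<inter> \<phi> y = {}) \<and>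
     (\<forall>x y. x \<rightarrow>\<^bsub>H\<^esub> y \<longrightarrow> (\<exists>u \<in> \<phi> x. \<exists>v \<in> \<phi> y. u \<rightarrow>\<^bsub>G\<^esub> v)))"

text \<open>
  A topological minor model maps the vertices of \<open>H\<close> injectively to vertices of \<open>G\<close> and the edges
  of \<open>H\<close> to paths of \<open>G\<close>, given by their vertex sequences, between the images of their ends. Two
  of these paths meet at most in the image of a common end, and none of them passes through the
  image of a vertex of \<open>H\<close> other than its ends. The two arcs of an edge get the same path, in
  opposite directions.
\<close>

definition topological_minor_of :: "('a,'b) pre_digraph \<Rightarrow> ('c,'d) pre_digraph \<Rightarrow> bool" where
  "topological_minor_of H G \<longleftrightarrow> (\<exists>(\<phi> :: 'a \<Rightarrow> 'c) (\<sigma> :: 'a \<Rightarrow> 'a \<Rightarrow> 'c list).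
     inj_on \<phi> (verts H) \<and> \<phi> ` verts H \<subseteq> verts G \<and>
     (\<forall>x y. x \<rightarrow>\<^bsub>H\<^esub> y \<longrightarrow>
        vpath (\<sigma> x y) G \<and> hd (\<sigma> x y) = \<phi> x \<and> last (\<sigma> x y) = \<phi> y \<and>
        \<sigma> y x = rev (\<sigma> x y) \<and>
        set (\<sigma> x y) \<inter> \<phi> ` verts H = {\<phi> x, \<phi> y}) \<and>
     (\<forall>x y x' y'. x \<rightarrow>\<^bsub>H\<^esub> y \<and> x' \<rightarrow>\<^bsub>H\<^esub> y' \<and> {x, y} \<noteq> {x', y'} \<longrightarrow>
        set (\<sigma> x y) \<inter> set (\<sigma> x' y') \<subseteq> \<phi> ` ({x, y} \<inter> {x', y'})))"

text \<open>
  ``Non-empty'' means having at least one edge, the empty graphs being the edgeless ones. For the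
  one-vertex graph in \<open>F\<close> the deletion problems would just ask whether \<open>|V(G)| \<le> k\<close>.
\<close>

definition connected_collection :: "('a,'b) pre_digraph set \<Rightarrow> bool" where
  "connected_collection F \<longleftrightarrow> finite F \<and> F \<noteq> {} \<and>
     (\<forall>H \<in> F. graph H \<and> arcs H \<noteq> {} \<and> Digraph_Component.connected H)"

text \<open>The containment relation \<open>le\<close> is \<^const>\<open>minor_of\<close> or \<^const>\<open>topological_minor_of\<close>.\<close>

definition has_deletion_set ::
  "(('a,'b) pre_digraph \<Rightarrow> ('c,'d) pre_digraph \<Rightarrow> bool) \<Rightarrow>
   ('a,'b) pre_digraph set \<Rightarrow> ('c,'d) pre_digraph \<Rightarrow> nat \<Rightarrow> bool" where
  "has_deletion_set le F G k \<longleftrightarrow>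
     (\<exists>S \<subseteq> verts G. card S \<le> k \<and> (\<forall>H \<in> F. \<not> le H (G \<restriction> (verts G - S))))"


section \<open>Treewidth\<close>

text \<open>
  \<^const>\<open>Digraph_Component.tree\<close> excludes directed cycles only. In a symmetric digraph every edge
  is a directed cycle of length two, so it does not describe undirected trees.
\<close>

definition undirected_tree :: "('a,'b) pre_digraph \<Rightarrow> bool" where
  "undirected_tree T \<longleftrightarrow> graph T \<and> Digraph_Component.connected T \<and>
     \<not> (\<exists>p. vpath p T \<and> 3 \<le> length p \<and> last p \<rightarrow>\<^bsub>T\<^esub> hd p)"

definition tree_decomposition ::
  "('a,'b) pre_digraph \<Rightarrow> ('t,'e) pre_digraph \<Rightarrow> ('t \<Rightarrow> 'a set) \<Rightarrow> bool" where
  "tree_decomposition G T X \<longleftrightarrow> undirected_tree T \<and>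
     (\<forall>t \<in> verts T. X t \<subseteq> verts G) \<and>
     (\<forall>v \<in> verts G. \<exists>t \<in> verts T. v \<in> X t) \<and>
     (\<forall>u v. u \<rightarrow>\<^bsub>G\<^esub> v \<longrightarrow> (\<exists>t \<in> verts T. u \<in> X t \<and> v \<in> X t)) \<and>
     (\<forall>v \<in> verts G. Digraph_Component.connected (T \<restriction> {t \<in> verts T. v \<in> X t}))"

text \<open>
  The least width, where the width of a decomposition is the maximum size of a bag minus one. The
  graph without vertices gets treewidth \<open>0\<close>.
\<close>

definition treewidth :: "('a,'b) pre_digraph \<Rightarrow> nat" where
  "treewidth G = (LEAST w. \<exists>(T :: (nat, nat \<times> nat) pre_digraph) X.
     tree_decomposition G T X \<and> (\<forall>t \<in> verts T. card (X t) \<le> w + 1))"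


section \<open>Model of computation\<close>

text \<open>
  Running times are measured in the \<open>WHILE\<close> language of Jones (\<^emph>\<open>Computability and Complexity from
  a Programming Perspective\<close>, MIT Press 1997): while programs over binary trees, where each
  elementary operation (access to a variable, constant, pairing, projection, assignment, test) has
  unit cost. Sharing subtrees, a multitape Turing machine simulates such programs with polynomial
  overhead, and conversely. Time bounds of the forms \<open>2^o(n)\<close> and \<open>2^o(tw) * n^O(1)\<close> thus have
  the same meaning in both models.
\<close>

datatype sexp = NIL | CONS sexp sexp

primrec car :: "sexp \<Rightarrow> sexp" where
  "car NIL = NIL"
| "car (CONS a b) = a"

primrec cdr :: "sexp \<Rightarrow> sexp" where
  "cdr NIL = NIL"
| "cdr (CONS a b) = b"

type_synonym store = "nat \<Rightarrow> sexp"

datatype expr = EVar nat | ENil | ECons expr expr | ECar expr | ECdr expr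

primrec expr_val :: "expr \<Rightarrow> store \<Rightarrow> sexp" where
  "expr_val (EVar x) s = s x"
| "expr_val ENil s = NIL"
| "expr_val (ECons a b) s = CONS (expr_val a s) (expr_val b s)"
| "expr_val (ECar a) s = car (expr_val a s)"
| "expr_val (ECdr a) s = cdr (expr_val a s)"

primrec expr_cost :: "expr \<Rightarrow> nat" where
  "expr_cost (EVar x) = 1"
| "expr_cost ENil = 1"
| "expr_cost (ECons a b) = 1 + expr_cost a + expr_cost b"
| "expr_cost (ECar a) = 1 + expr_cost a"
| "expr_cost (ECdr a) = 1 + expr_cost a"

datatype com = CAssign nat expr | CSeq com com | CIf expr com com | CWhile expr com

text \<open>\<open>exec c s t s'\<close>: started in store \<open>s\<close>, \<open>c\<close> halts after time \<open>t\<close> in store \<open>s'\<close>.\<close>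

inductive exec :: "com \<Rightarrow> store \<Rightarrow> nat \<Rightarrow> store \<Rightarrow> bool" where
  Assign: "exec (CAssign x e) s (1 + expr_cost e) (s(x := expr_val e s))"
| Seq: "exec c1 s t1 s1 \<Longrightarrow> exec c2 s1 t2 s2 \<Longrightarrow> exec (CSeq c1 c2) s (t1 + t2) s2"
| IfTrue: "expr_val e s \<noteq> NIL \<Longrightarrow> exec c1 s t s' \<Longrightarrow>
    exec (CIf e c1 c2) s (1 + expr_cost e + t) s'"
| IfFalse: "expr_val e s = NIL \<Longrightarrow> exec c2 s t s' \<Longrightarrow>
    exec (CIf e c1 c2) s (1 + expr_cost e + t) s'"
| WhileFalse: "expr_val e s = NIL \<Longrightarrow> exec (CWhile e c) s (1 + expr_cost e) s"
| WhileTrue: "expr_val e s \<noteq> NIL \<Longrightarrow> exec c s t1 s1 \<Longrightarrow> exec (CWhile e c) s1 t2 s2 \<Longrightarrow>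
    exec (CWhile e c) s (1 + expr_cost e + t1 + t2) s2"

lemma exec_deterministic:
  assumes "exec c s t s'" and "exec c s t2 s2"
  shows "t2 = t \<and> s2 = s'"
  using assms
proof (induction arbitrary: t2 s2 rule: exec.induct)
  case Assign
  then show ?case by (auto elim: exec.cases)
next
  case Seq
  from Seq.prems show ?case by cases (use Seq.IH in blast)+
next
  case IfTrue
  from IfTrue.prems show ?case by cases (use IfTrue.hyps IfTrue.IH in blast)+
next
  case IfFalse
  from IfFalse.prems show ?case by cases (use IfFalse.hyps IfFalse.IH in blast)+
next
  case WhileFalse
  from WhileFalse.prems show ?case by cases (use WhileFalse in auto)
next
  case WhileTrue
  from WhileTrue.prems show ?case by cases (use WhileTrue.hyps WhileTrue.IH in blast)+
qed

text \<open>
  Input and output are in variable \<open>0\<close>, all other variables start as \<^const>\<open>NIL\<close>, and any output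
  other than \<^const>\<open>NIL\<close> means ``yes''. The instances of the decision problem are the elements of
  \<open>I\<close>, its yes-instances those that satisfy \<open>Q\<close>.
\<close>

definition decides_within ::
  "com \<Rightarrow> 'i set \<Rightarrow> ('i \<Rightarrow> sexp) \<Rightarrow> ('i \<Rightarrow> bool) \<Rightarrow> ('i \<Rightarrow> real) \<Rightarrow> bool" where
  "decides_within c I enc Q B \<longleftrightarrow>
     (\<forall>i \<in> I. \<exists>t s. exec c ((\<lambda>_. NIL)(0 := enc i)) t s \<and> (s 0 \<noteq> NIL \<longleftrightarrow> Q i) \<and> real t \<le> B i)"

primrec enc_nat :: "nat \<Rightarrow> sexp" where
  "enc_nat 0 = NIL"
| "enc_nat (Suc n) = CONS NIL (enc_nat n)"

definition enc_bool :: "bool \<Rightarrow> sexp" where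
  "enc_bool b = (if b then CONS NIL NIL else NIL)"

definition enc_prod :: "('a \<Rightarrow> sexp) \<Rightarrow> ('b \<Rightarrow> sexp) \<Rightarrow> 'a \<times> 'b \<Rightarrow> sexp" where
  "enc_prod f g p = CONS (f (fst p)) (g (snd p))"

primrec enc_list :: "('a \<Rightarrow> sexp) \<Rightarrow> 'a list \<Rightarrow> sexp" where
  "enc_list f [] = NIL"
| "enc_list f (x # xs) = CONS (f x) (enc_list f xs)"


section \<open>3-SAT and the Exponential Time Hypothesis\<close>

text \<open>
  A literal is a variable with a sign. Clauses have three literals, not necessarily different, so
  that shorter non-empty clauses are covered. An instance is the number \<open>n\<close> of variables with a
  list of clauses over the variables \<open>0, \<dots>, n - 1\<close>. Clauses are not repeated, so the size of an
  instance is polynomial in \<open>n\<close>.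
\<close>

type_synonym literal = "nat \<times> bool"
type_synonym clause = "literal \<times> literal \<times> literal"

definition sat3_instances :: "(nat \<times> clause list) set" where
  "sat3_instances = {(n, cs). distinct cs \<and>
     (\<forall>((u, _), (v, _), (w, _)) \<in> set cs. u < n \<and> v < n \<and> w < n)}"

definition satisfiable :: "nat \<times> clause list \<Rightarrow> bool" where
  "satisfiable = (\<lambda>(n, cs). \<exists>\<alpha> :: nat \<Rightarrow> bool.
     \<forall>((u, a), (v, b), (w, c)) \<in> set cs. \<alpha> u = a \<or> \<alpha> v = b \<or> \<alpha> w = c)"

definition enc_sat3 :: "nat \<times> clause list \<Rightarrow> sexp" where
  "enc_sat3 = (let lit = enc_prod enc_nat enc_bool
     in enc_prod enc_nat (enc_list (enc_prod lit (enc_prod lit lit))))"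

definition ETH :: bool where
  "ETH \<longleftrightarrow> \<not> (\<exists>c (f :: nat \<Rightarrow> real). f \<in> o(\<lambda>n. real n) \<and>
     decides_within c sat3_instances enc_sat3 satisfiable (\<lambda>(n, _). 2 powr f n))"


section \<open>The deletion problems\<close>

text \<open>
  An input graph has vertices \<open>0, \<dots>, n - 1\<close> and is given by \<open>n\<close> and the list of its edges, each of
  them listed once as the pair \<open>(u, v)\<close> with \<open>u < v\<close>.
\<close>

definition input_graph :: "nat \<Rightarrow> (nat \<times> nat) list \<Rightarrow> (nat, nat \<times> nat) pre_digraph" where
  "input_graph n es = \<lparr>verts = {..<n}, arcs = set es \<union> (set es)\<inverse>, tail = fst, head = snd\<rparr>"

definition deletion_instances :: "(nat \<times> (nat \<times> nat) list \<times> nat) set" where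
  "deletion_instances = {(n, es, k). distinct es \<and> (\<forall>(u, v) \<in> set es. u < v \<and> v < n)}"

lemma graph_input_graph:
  assumes "(n, es, k) \<in> deletion_instances"
  shows "graph (input_graph n es)"
proof -
  have *: "u < v \<and> v < n" if "(u, v) \<in> set es" for u v
    using assms that by (auto simp: deletion_instances_def)
  have ends: "arcs_ends (input_graph n es) = set es \<union> (set es)\<inverse>"
    by (simp add: arcs_ends_conv input_graph_def)
  have arcs: "fst e < n \<and> snd e < n \<and> fst e \<noteq> snd e" if "e \<in> set es \<union> (set es)\<inverse>" for e
    using that by (cases e) (auto dest: *)
  show ?thesis
  proof unfold_locales
    show "symmetric (input_graph n es)"
      unfolding symmetric_def ends by (rule symI) blast
    show "finite (verts (input_graph n es))" "finite (arcs (input_graph n es))"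
      by (simp_all add: input_graph_def)
  next
    fix e assume "e \<in> arcs (input_graph n es)"
    then have "e \<in> set es \<union> (set es)\<inverse>" by (simp add: input_graph_def)
    from arcs[OF this]
    show "tail (input_graph n es) e \<in> verts (input_graph n es)"
      "head (input_graph n es) e \<in> verts (input_graph n es)"
      "tail (input_graph n es) e \<noteq> head (input_graph n es) e"
      by (simp_all add: input_graph_def)
  next
    fix e1 e2
    assume "arc_to_ends (input_graph n es) e1 = arc_to_ends (input_graph n es) e2"
    then show "e1 = e2" by (simp add: input_graph_def arc_to_ends_def prod_eq_iff)
  qed
qed

definition enc_deletion :: "nat \<times> (nat \<times> nat) list \<times> nat \<Rightarrow> sexp" where
  "enc_deletion = enc_prod enc_nat (enc_prod (enc_list (enc_prod enc_nat enc_nat)) enc_nat)"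

text \<open>
  Solvability in time \<open>2^o(tw) * n^O(1)\<close>. The asymptotic bounds on \<open>f\<close> and \<open>g\<close> leave finitely many
  values free, and so allow for constant factors and small graphs.
\<close>

definition deletion_solvable_subexp_tw ::
  "(('a,'b) pre_digraph \<Rightarrow> (nat, nat \<times> nat) pre_digraph \<Rightarrow> bool) \<Rightarrow>
   ('a,'b) pre_digraph set \<Rightarrow> bool" where
  "deletion_solvable_subexp_tw le F \<longleftrightarrow>
     (\<exists>c (f :: nat \<Rightarrow> real) (g :: nat \<Rightarrow> real) d.
        f \<in> o(\<lambda>w. real w) \<and> g \<in> O(\<lambda>n. real n ^ d) \<and>
        decides_within c deletion_instances enc_deletion
          (\<lambda>(n, es, k). has_deletion_set le F (input_graph n es) k)
          (\<lambda>(n, es, k). 2 powr f (treewidth (input_graph n es)) * g n))"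

end

theory Submission
  imports Defs "HOL-Real_Asymp.Real_Asymp"
begin

text \<open>
  Split a graph at a vertex \<open>a\<close> into a core \<open>A\<close> and a block \<open>B\<close> that share only \<open>a\<close>. Among all
  such splittings of minor-minimal members of \<open>F\<close>, take one, of \<open>H\<close> say, with \<open>B\<close> smallest, and
  let \<open>b\<close> be any other vertex of \<open>B\<close>. Given an instance \<open>G0\<close> of Vertex Cover, attach a copy of \<open>A\<close>
  to each vertex and put a copy of \<open>B\<close> on each edge, with \<open>a\<close> and \<open>b\<close> at its ends. If both ends of
  an edge \<open>u v\<close> survive a deletion together with the core of \<open>u\<close> and the block of the edge, \<open>H\<close>
  remains as a subgraph. Conversely, delete a vertex cover. What remains of a block hangs on at
  most one vertex and is smaller than \<open>B\<close>, so by the choice of \<open>B\<close> it contains no branch set of a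
  minimal member of \<open>F\<close>; contracting these remainders shows that such a minor would be a minor of
  the core, against the minimality of \<open>H\<close>. The argument is the same for minors and topological
  minors.

  The usual reduction from 3-SAT to Vertex Cover yields graphs in which the \<open>2 n\<close> literal vertices
  separate pieces of bounded size, also after the replacement. The treewidth is thus at most
  \<open>2 n + O(1)\<close> for any number of clauses, and no sparsification is needed.
\<close>

section \<open>Connected sets and minor models\<close>

text \<open>Both containment relations lie between subgraph and minor containment, so it is enough
  to find \<open>H\<close> as a subgraph in one direction and to exclude minors in the other. A
  separation with \<open>A = {a}\<close> always exists, so a pattern without cut vertices needs no
  separate treatment. \<open>B\<close> is minimised over all minimal members of \<open>F\<close> at
  once, because any of them, not just \<open>H\<close>, could show up after the deletion, and every
  other member contains a minimal one as a minor. The output graph may have cubically many vertices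
  in the number \<open>n\<close> of variables, but the reduction time and the solver's polynomial
  factor only add a logarithmic term to the exponent. Solver and reduction have to form one while
  program, so the reduction is programmed explicitly, on unary numbers, and must hand over a clean
  store.\<close>

text \<open>
  Connectedness in terms of cuts, for symmetric \<open>E\<close>; only the arcs inside \<open>X\<close> matter. This form
  is stable under images and unions without any reasoning about paths.
\<close>

definition conn :: "('v \<times> 'v) set \<Rightarrow> 'v set \<Rightarrow> bool" where
  "conn E X \<longleftrightarrow> X \<noteq> {} \<and> (\<forall>A \<subseteq> X. A \<noteq> {} \<longrightarrow> A \<noteq> X \<longrightarrow> (\<exists>x \<in> A. \<exists>y \<in> X - A. (x, y) \<in> E))"

lemma connI:
  assumes "X \<noteq> {}"
    and "\<And>A x y. A \<subseteq> X \<Longrightarrow> x \<in> A \<Longrightarrow> y \<in> X - A \<Longrightarrow> \<exists>x \<in> A. \<exists>y \<in> X - A. (x, y) \<in> E"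
  shows "conn E X"
  unfolding conn_def
proof (intro conjI allI impI)
  fix A assume "A \<subseteq> X" "A \<noteq> {}" "A \<noteq> X"
  then obtain x y where "x \<in> A" "y \<in> X - A" by blast
  with assms(2) \<open>A \<subseteq> X\<close> show "\<exists>x \<in> A. \<exists>y \<in> X - A. (x, y) \<in> E" by blast
qed (fact assms(1))

lemma conn_cut:
  assumes "conn E X" and "x \<in> X" "x \<in> A" and "y \<in> X" "y \<notin> A"
  obtains u v where "u \<in> X" "u \<in> A" "v \<in> X" "v \<notin> A" "(u, v) \<in> E"
proof -
  have "A \<inter> X \<subseteq> X" "A \<inter> X \<noteq> {}" "A \<inter> X \<noteq> X" using assms(2-) by auto
  with assms(1) have "\<exists>u \<in> A \<inter> X. \<exists>v \<in> X - A \<inter> X. (u, v) \<in> E" unfolding conn_def by blast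
  with that show ?thesis by blast
qed

lemma conn_ne: "conn E X \<Longrightarrow> X \<noteq> {}"
  by (simp add: conn_def)

lemma conn_singleton: "conn E {x}"
  by (rule connI) auto

lemma conn_image:
  assumes "conn E X"
    and "\<And>x y. x \<in> X \<Longrightarrow> y \<in> X \<Longrightarrow> (x, y) \<in> E \<Longrightarrow> f x = f y \<or> (f x, f y) \<in> E'"
  shows "conn E' (f ` X)"
proof (rule connI)
  show "f ` X \<noteq> {}" using conn_ne[OF assms(1)] by simp
next
  fix A x y assume "A \<subseteq> f ` X" "x \<in> A" "y \<in> f ` X - A"
  then obtain a b where "a \<in> X" "f a \<in> A" "b \<in> X" "f b \<notin> A" by blast
  then obtain u v where "u \<in> X" "f u \<in> A" "v \<in> X" "f v \<notin> A" "(u, v) \<in> E"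
    using conn_cut[OF assms(1), of a "f -` A" b] by auto
  with assms(2)[of u v] show "\<exists>x \<in> A. \<exists>y \<in> f ` X - A. (x, y) \<in> E'" by force
qed

text \<open>A cut either splits some \<open>S x\<close>, which then supplies the arc, or it is made
  of whole pieces and comes from a cut of \<open>X\<close>.\<close>

lemma conn_UN:
  assumes "conn E X" and "\<And>x. x \<in> X \<Longrightarrow> conn E' (S x)"
    and "\<And>x y. x \<in> X \<Longrightarrow> y \<in> X \<Longrightarrow> (x, y) \<in> E \<Longrightarrow> \<exists>u \<in> S x. \<exists>v \<in> S y. (u, v) \<in> E'"
  shows "conn E' (\<Union>x \<in> X. S x)"
proof (rule connI)
  show "(\<Union>x \<in> X. S x) \<noteq> {}" using conn_ne[OF assms(1)] conn_ne[OF assms(2)] by auto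
next
  fix A p q assume A: "A \<subseteq> (\<Union>x \<in> X. S x)" and "p \<in> A" "q \<in> (\<Union>x \<in> X. S x) - A"
  then obtain a b where a: "a \<in> X" "p \<in> S a" and b: "b \<in> X" "q \<in> S b" "q \<notin> A" by blast
  show "\<exists>x \<in> A. \<exists>y \<in> (\<Union>x \<in> X. S x) - A. (x, y) \<in> E'"
  proof (cases "\<exists>x \<in> X. S x \<inter> A \<noteq> {} \<and> \<not> S x \<subseteq> A")
    case True
    then obtain x r s where x: "x \<in> X" and "r \<in> S x" "r \<in> A" "s \<in> S x" "s \<notin> A" by blast
    then obtain u v where "u \<in> S x" "u \<in> A" "v \<in> S x" "v \<notin> A" "(u, v) \<in> E'"
      using conn_cut[OF assms(2)[OF x]] by metis
    with x show ?thesis by blast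
  next
    case False
    with a b \<open>p \<in> A\<close> have "S a \<subseteq> A" "\<not> S b \<subseteq> A" by blast+
    then obtain x y where xy: "x \<in> X" "S x \<subseteq> A" "y \<in> X" "\<not> S y \<subseteq> A" "(x, y) \<in> E"
      using conn_cut[OF assms(1), of a "{x. S x \<subseteq> A}" b] a b by auto
    then obtain u v where "u \<in> S x" "v \<in> S y" "(u, v) \<in> E'" using assms(3) by blast
    moreover have "S y \<inter> A = {}" using False xy by blast
    ultimately show ?thesis using xy by blast
  qed
qed

text \<open>On whichever side of a cut \<open>c\<close> lies, some \<open>S i\<close> reaches over
  to the other side and is split.\<close>

lemma conn_Union_common:
  assumes "I \<noteq> {}" and "\<And>i. i \<in> I \<Longrightarrow> conn E (S i)" and "\<And>i. i \<in> I \<Longrightarrow> c \<in> S i"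
  shows "conn E (\<Union>i \<in> I. S i)"
proof (rule connI)
  show "(\<Union>i \<in> I. S i) \<noteq> {}" using assms by auto
next
  fix A x y assume A: "A \<subseteq> (\<Union>i \<in> I. S i)" and x: "x \<in> A" and y: "y \<in> (\<Union>i \<in> I. S i) - A"
  obtain i r s where i: "i \<in> I" "r \<in> S i" "r \<in> A" "s \<in> S i" "s \<notin> A"
  proof (cases "c \<in> A")
    case True
    with y assms(3) that show ?thesis by blast
  next
    case False
    with x A assms(3) that show ?thesis by blast
  qed
  then obtain u v where "u \<in> S i" "u \<in> A" "v \<in> S i" "v \<notin> A" "(u, v) \<in> E"
    using conn_cut[OF assms(2)[OF i(1)]] by metis
  with i show "\<exists>x \<in> A. \<exists>y \<in> (\<Union>i \<in> I. S i) - A. (x, y) \<in> E" by blast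
qed

lemma conn_const:
  assumes "conn E X" and "\<And>x y. x \<in> X \<Longrightarrow> y \<in> X \<Longrightarrow> (x, y) \<in> E \<Longrightarrow> f x = f y"
    and "x \<in> X" "y \<in> X"
  shows "f x = f y"
proof (rule ccontr)
  assume "f x \<noteq> f y"
  then obtain u v where "u \<in> X" "f u = f x" "v \<in> X" "f v \<noteq> f x" "(u, v) \<in> E"
    using conn_cut[OF assms(1,3), of "{z. f z = f x}" y] assms(4) by auto
  with assms(2) show False by metis
qed

section \<open>Cuts versus reachability in digraphs\<close>

lemma conn_rtrancl_on:
  "conn E X \<longleftrightarrow> X \<noteq> {} \<and> (\<forall>u \<in> X. \<forall>v \<in> X. (u, v) \<in> rtrancl_on X E)"
proof (intro iffI conjI ballI)
  fix u v assume c: "conn E X" and u: "u \<in> X" and v: "v \<in> X"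
  show "(u, v) \<in> rtrancl_on X E"
  proof (rule ccontr)
    assume nr: "(u, v) \<notin> rtrancl_on X E"
    \<comment> \<open>The vertices reachable from \<open>u\<close> form a cut that no arc can
      leave.\<close>
    obtain x y where "x \<in> {x. (u, x) \<in> rtrancl_on X E}" "y \<in> X"
        "y \<notin> {x. (u, x) \<in> rtrancl_on X E}" "(x, y) \<in> E"
      by (rule conn_cut[OF c u, of "{x. (u, x) \<in> rtrancl_on X E}" v]) (use u v nr in auto)
    then show False by (auto dest: rtrancl_on_into_rtrancl_on)
  qed
next
  assume r: "X \<noteq> {} \<and> (\<forall>u \<in> X. \<forall>v \<in> X. (u, v) \<in> rtrancl_on X E)"
  show "conn E X"
  proof (rule connI)
    fix A a b assume A: "A \<subseteq> X" "a \<in> A" "b \<in> X - A"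
    with r have "(a, b) \<in> rtrancl_on X E" by blast
    then have "b \<in> A \<or> (\<exists>x \<in> A. \<exists>y \<in> X - A. (x, y) \<in> E)"
      by (induction rule: rtrancl_on_induct) (use A(2) in blast)+
    with A show "\<exists>x \<in> A. \<exists>y \<in> X - A. (x, y) \<in> E" by blast
  qed (use r in blast)
qed (simp add: conn_def)

lemma conn_cong:
  assumes "\<And>x y. x \<in> X \<Longrightarrow> y \<in> X \<Longrightarrow> (x, y) \<in> E \<longleftrightarrow> (x, y) \<in> E'"
  shows "conn E X \<longleftrightarrow> conn E' X"
proof -
  have "conn E' X" if c: "conn E X" and "\<And>x y. x \<in> X \<Longrightarrow> y \<in> X \<Longrightarrow> (x, y) \<in> E \<longleftrightarrow> (x, y) \<in> E'" for E E'
    using conn_image[OF c, of id E'] that(2) by simp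
  then show ?thesis using assms by blast
qed

lemma arcs_ends_induce: "arcs_ends (G \<restriction> X) = arcs_ends G \<inter> X \<times> X"
  by (auto simp: arcs_ends_def arc_to_ends_def)

lemma connected_conn:
  assumes "symmetric G"
  shows "Digraph_Component.connected G \<longleftrightarrow> conn (arcs_ends G) (verts G)"
proof -
  have "(arcs_ends G)\<^sup>s = arcs_ends G"
    using assms by (auto simp: symcl_def symmetric_def sym_def)
  then show ?thesis by (simp add: connected_conv conn_rtrancl_on)
qed

lemma symmetric_induce: "symmetric G \<Longrightarrow> symmetric (G \<restriction> X)"
  by (auto simp: symmetric_def arcs_ends_induce sym_def)

text \<open>Branch sets can thus be tested with the arcs of the whole graph, without induced
  subgraphs.\<close>

lemma connected_induce_conn:
  assumes "symmetric G"
  shows "Digraph_Component.connected (G \<restriction> X) \<longleftrightarrow> conn (arcs_ends G) X"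
  using connected_conn[OF symmetric_induce[OF assms]]
    conn_cong[of X "arcs_ends (G \<restriction> X)" "arcs_ends G"]
  by (simp add: arcs_ends_induce)

text \<open>Works on plain vertex and arc sets, so that the abstract gadget graph needs neither an
  arc type nor a digraph record.\<close>

definition minor_model ::
  "'a set \<Rightarrow> ('a \<times> 'a) set \<Rightarrow> 'c set \<Rightarrow> ('c \<times> 'c) set \<Rightarrow> ('a \<Rightarrow> 'c set) \<Rightarrow> bool" where
  "minor_model V E V' E' \<phi> \<longleftrightarrow>
     (\<forall>x \<in> V. \<phi> x \<subseteq> V' \<and> conn E' (\<phi> x)) \<and>
     (\<forall>x \<in> V. \<forall>y \<in> V. x \<noteq> y \<longrightarrow> \<phi> x \<inter> \<phi> y = {}) \<and>
     (\<forall>x y. (x, y) \<in> E \<longrightarrow> (\<exists>u \<in> \<phi> x. \<exists>v \<in> \<phi> y. (u, v) \<in> E'))"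

lemma minor_of_iff_model:
  assumes "symmetric G"
  shows "minor_of H G \<longleftrightarrow> (\<exists>\<phi>. minor_model (verts H) (arcs_ends H) (verts G) (arcs_ends G) \<phi>)"
  unfolding minor_of_def minor_model_def connected_induce_conn[OF assms] by simp

lemma minor_model_trans:
  assumes "minor_model V E V' E' \<phi>" and "minor_model V' E' V'' E'' \<psi>" and "E \<subseteq> V \<times> V"
  shows "minor_model V E V'' E'' (\<lambda>x. \<Union>y \<in> \<phi> x. \<psi> y)"
proof -
  have 1: "\<phi> x \<subseteq> V'" "conn E' (\<phi> x)" if "x \<in> V" for x
    using assms(1) that by (auto simp: minor_model_def)
  have 2: "\<psi> y \<subseteq> V''" "conn E'' (\<psi> y)" if "y \<in> V'" for y
    using assms(2) that by (auto simp: minor_model_def)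
  have 3: "\<exists>u \<in> \<psi> x. \<exists>v \<in> \<psi> y. (u, v) \<in> E''" if "(x, y) \<in> E'" for x y
    using assms(2) that by (auto simp: minor_model_def)
  have c: "conn E'' (\<Union>y \<in> \<phi> x. \<psi> y)" if x: "x \<in> V" for x
    using 1(1)[OF x] by (intro conn_UN[OF 1(2)[OF x]] 2(2) 3) auto
  have d: "(\<Union>z \<in> \<phi> x. \<psi> z) \<inter> (\<Union>z \<in> \<phi> y. \<psi> z) = {}" if "x \<in> V" "y \<in> V" "x \<noteq> y" for x y
  proof -
    have "\<phi> x \<inter> \<phi> y = {}" using assms(1) that by (auto simp: minor_model_def)
    moreover have "\<psi> z \<inter> \<psi> z' = {}" if "z \<in> V'" "z' \<in> V'" "z \<noteq> z'" for z z'
      using assms(2) that by (auto simp: minor_model_def)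
    ultimately show ?thesis using 1(1)[OF \<open>x \<in> V\<close>] 1(1)[OF \<open>y \<in> V\<close>] by blast
  qed
  have e: "\<exists>u \<in> (\<Union>z \<in> \<phi> x. \<psi> z). \<exists>v \<in> (\<Union>z \<in> \<phi> y. \<psi> z). (u, v) \<in> E''" if "(x, y) \<in> E" for x y
    using assms(1) that 3 unfolding minor_model_def by (meson UN_I)
  show ?thesis
    unfolding minor_model_def using 1 2 c d e by blast
qed

lemma minor_model_embedding:
  assumes "inj_on \<iota> V" and "\<iota> ` V \<subseteq> V'" and "\<And>x y. (x, y) \<in> E \<Longrightarrow> (\<iota> x, \<iota> y) \<in> E'"
  shows "minor_model V E V' E' (\<lambda>x. {\<iota> x})"
  using assms unfolding minor_model_def by (auto simp: conn_singleton inj_on_def)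

lemma vwalk_conn:
  assumes "vwalk p G" and "symmetric G"
  shows "conn (arcs_ends G) (set p)"
  using assms(1)
proof induction
  case (Base u)
  then show ?case by (simp add: conn_singleton)
next
  case (Cons u v es)
  have "conn (arcs_ends G) {u, v}"
    by (rule connI) (use Cons.hyps assms(2) in \<open>auto simp: symmetric_def dest: symD\<close>)
  then have "conn (arcs_ends G) (\<Union>i \<in> {{u, v}, set (v # es)}. i)"
    using Cons.IH by (intro conn_Union_common[where c = v]) auto
  then show ?case by (simp add: insert_commute)
qed

text \<open>Each inner vertex of a path joins the branch set of the end that is smaller in a fixed order.\<close>

lemma topological_minor_imp_minor:
  assumes "graph H" and sym: "symmetric G" and "topological_minor_of H G"
  shows "minor_of H G"
proof -
  interpret H: graph H by fact
  let ?E = "arcs_ends H"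
  obtain \<phi> \<sigma> where inj: "inj_on \<phi> (verts H)" and sub: "\<phi> ` verts H \<subseteq> verts G"
    and path': "\<forall>x y. x \<rightarrow>\<^bsub>H\<^esub> y \<longrightarrow>
        vpath (\<sigma> x y) G \<and> hd (\<sigma> x y) = \<phi> x \<and> last (\<sigma> x y) = \<phi> y \<and>
        \<sigma> y x = rev (\<sigma> x y) \<and> set (\<sigma> x y) \<inter> \<phi> ` verts H = {\<phi> x, \<phi> y}"
    and disj': "\<forall>x y x' y'. x \<rightarrow>\<^bsub>H\<^esub> y \<and> x' \<rightarrow>\<^bsub>H\<^esub> y' \<and> {x, y} \<noteq> {x', y'} \<longrightarrow>
        set (\<sigma> x y) \<inter> set (\<sigma> x' y') \<subseteq> \<phi> ` ({x, y} \<inter> {x', y'})"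
    using assms(3) unfolding topological_minor_of_def
    by (elim exE conjE) (rule that, assumption+)
  have path: "vpath (\<sigma> x y) G \<and> hd (\<sigma> x y) = \<phi> x \<and> last (\<sigma> x y) = \<phi> y \<and>
      set (\<sigma> x y) \<inter> \<phi> ` verts H = {\<phi> x, \<phi> y}" if "(x, y) \<in> ?E" for x y
    using path' that by simp
  have disj: "set (\<sigma> x y) \<inter> set (\<sigma> x' y') \<subseteq> \<phi> ` ({x, y} \<inter> {x', y'})"
    if "(x, y) \<in> ?E" "(x', y') \<in> ?E" "{x, y} \<noteq> {x', y'}" for x y x' y'
    using disj' that by simp
  obtain ix :: "'a \<Rightarrow> nat" where ix: "inj_on ix (verts H)"
    using finite_imp_inj_to_nat_seg[OF H.finite_verts] by blast
  have EV: "x \<in> verts H \<and> y \<in> verts H \<and> x \<noteq> y" if "(x, y) \<in> ?E" for x y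
    using that H.adj_in_verts H.adj_not_same by blast
  have Esym: "(y, x) \<in> ?E" if "(x, y) \<in> ?E" for x y
    using that H.graph_symmetric by blast
  \<comment> \<open>\<open>q x y\<close> keeps the start and the inner vertices; the dropped last
    step supplies the arc between the two branch sets.\<close>
  define q where "q x y = butlast (\<sigma> x y)" for x y
  have q: "\<sigma> x y = q x y @ [\<phi> y] \<and> hd (q x y) = \<phi> x \<and> q x y \<noteq> [] \<and> vwalk (q x y) G \<and>
      (last (q x y), \<phi> y) \<in> arcs_ends G \<and> set (q x y) \<inter> \<phi> ` verts H = {\<phi> x}"
    if e: "(x, y) \<in> ?E" for x y
  proof -
    have ne: "\<sigma> x y \<noteq> []" and w: "vwalk (\<sigma> x y) G" and dist: "distinct (\<sigma> x y)"
      using path[OF e] by (auto simp: vpath_def vwalk_def)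
    have \<sigma>: "\<sigma> x y = q x y @ [\<phi> y]"
      using append_butlast_last_id[OF ne] path[OF e] unfolding q_def by simp
    have "\<phi> x \<noteq> \<phi> y" using EV[OF e] inj by (auto dest: inj_onD)
    with path[OF e] \<sigma> have ne': "q x y \<noteq> []" by auto
    have fresh: "\<phi> y \<notin> set (q x y)" using dist \<sigma> by auto
    have w': "vwalk (q x y) G" "(last (q x y), \<phi> y) \<in> arcs_ends G"
      using w ne' unfolding \<sigma> vwalk_def by (auto simp: vwalk_arcs_append)
    have hd: "hd (q x y) = \<phi> x" using path[OF e] \<sigma> ne' by auto
    have "z = \<phi> x" if "z \<in> set (q x y)" "z \<in> \<phi> ` verts H" for z
    proof -
      have "z \<in> set (\<sigma> x y) \<inter> \<phi> ` verts H" using that \<sigma> by simp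
      then have "z \<in> {\<phi> x, \<phi> y}" using path[OF e] by simp
      with that fresh show ?thesis by auto
    qed
    moreover have "\<phi> x \<in> set (q x y)" using hd_in_set[OF ne'] hd by simp
    moreover have "\<phi> x \<in> \<phi> ` verts H" using EV[OF e] by simp
    ultimately have "set (q x y) \<inter> \<phi> ` verts H = {\<phi> x}" by blast
    with \<sigma> hd ne' w' show ?thesis by simp
  qed
  define N where "N x = {y. (x, y) \<in> ?E \<and> ix x < ix y}" for x
  define \<beta> where "\<beta> x = insert (\<phi> x) (\<Union>y \<in> N x. set (q x y))" for x
  have N: "(x, y) \<in> ?E" if "y \<in> N x" for x y using that by (simp add: N_def)
  have hdq: "\<phi> x \<in> set (q x y)" if "(x, y) \<in> ?E" for x y
    using q[OF that] hd_in_set[of "q x y"] by simp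
  have c: "conn (arcs_ends G) (\<beta> x)" for x
  proof -
    have "conn (arcs_ends G) (\<Union>i \<in> insert {\<phi> x} ((\<lambda>y. set (q x y)) ` N x). i)"
    proof (rule conn_Union_common)
      show "conn (arcs_ends G) i" if "i \<in> insert {\<phi> x} ((\<lambda>y. set (q x y)) ` N x)" for i
        using that q N by (auto simp: conn_singleton intro!: vwalk_conn[OF _ sym])
    qed (use N hdq in auto)
    then show ?thesis by (simp add: \<beta>_def)
  qed
  have s: "\<beta> x \<subseteq> verts G" if "x \<in> verts H" for x
    using that sub q N unfolding \<beta>_def vwalk_def by blast
  have int: "\<beta> x \<inter> \<phi> ` verts H = {\<phi> x}" if "x \<in> verts H" for x
    using that q N unfolding \<beta>_def by blast
  have d: "\<beta> x \<inter> \<beta> x' = {}" if xx: "x \<in> verts H" "x' \<in> verts H" "x \<noteq> x'" for x x'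
  proof (rule ccontr)
    assume "\<beta> x \<inter> \<beta> x' \<noteq> {}"
    then obtain z where z: "z \<in> \<beta> x" "z \<in> \<beta> x'" by blast
    have ne: "\<phi> x \<noteq> \<phi> x'" using inj xx by (auto dest: inj_onD)
    have zV: "z \<notin> \<phi> ` verts H"
    proof
      assume "z \<in> \<phi> ` verts H"
      then have "z \<in> {\<phi> x}" "z \<in> {\<phi> x'}"
        using z unfolding int[OF xx(1), symmetric] int[OF xx(2), symmetric] by simp_all
      with ne show False by simp
    qed
    with z obtain y y' where y: "y \<in> N x" "z \<in> set (q x y)" and y': "y' \<in> N x'" "z \<in> set (q x' y')"
      unfolding \<beta>_def using xx(1,2) by auto
    \<comment> \<open>Otherwise \<open>y = x'\<close> and \<open>y' = x\<close>, and
      \<open>ix\<close> would have to increase both from \<open>x\<close> to \<open>x'\<close> and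
      back.\<close>
    have "{x, y} \<noteq> {x', y'}" using y(1) y'(1) xx(3) by (auto simp: N_def doubleton_eq_iff)
    from disj[OF N[OF y(1)] N[OF y'(1)] this] have "z \<in> \<phi> ` ({x, y} \<inter> {x', y'})"
      using q[OF N[OF y(1)]] q[OF N[OF y'(1)]] y y' by auto
    with xx(1) EV[OF N[OF y(1)]] zV show False by auto
  qed
  \<comment> \<open>Only the end with the smaller \<open>ix\<close> owns the path, so both
    directions of the arc are obtained at once.\<close>
  have a1: "\<exists>u \<in> \<beta> x. \<exists>v \<in> \<beta> y. (u, v) \<in> arcs_ends G \<and> (v, u) \<in> arcs_ends G"
    if e: "(x, y) \<in> ?E" and "ix x < ix y" for x y
  proof (rule bexI[of _ "last (q x y)"], rule bexI[of _ "\<phi> y"])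
    show "last (q x y) \<in> \<beta> x"
      using that q[OF e] by (auto simp: \<beta>_def N_def intro!: bexI[of _ y])
  qed (use q[OF e] sym in \<open>auto simp: \<beta>_def symmetric_def dest: symD\<close>)
  have a: "\<exists>u \<in> \<beta> x. \<exists>v \<in> \<beta> y. (u, v) \<in> arcs_ends G" if e: "(x, y) \<in> ?E" for x y
  proof -
    have "ix x \<noteq> ix y" using EV[OF e] ix by (auto dest: inj_onD)
    then have "ix x < ix y \<or> ix y < ix x" by linarith
    then show ?thesis using a1[OF e] a1[OF Esym[OF e]] by blast
  qed
  show ?thesis
    unfolding minor_of_iff_model[OF sym] minor_model_def using s c d a by blast
qed

lemma embedding_imp_topological_minor:
  assumes "graph H" and "symmetric G" and inj: "inj_on \<iota> (verts H)" and sub: "\<iota> ` verts H \<subseteq> verts G"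
    and e: "\<And>x y. (x, y) \<in> arcs_ends H \<Longrightarrow> (\<iota> x, \<iota> y) \<in> arcs_ends G"
  shows "topological_minor_of H G"
proof -
  interpret H: graph H by fact
  have EV: "x \<in> verts H \<and> y \<in> verts H \<and> x \<noteq> y" if "(x, y) \<in> arcs_ends H" for x y
    using that H.adj_in_verts H.adj_not_same by blast
  have "vpath [\<iota> x, \<iota> y] G" if "(x, y) \<in> arcs_ends H" for x y
    using EV[OF that] inj sub e[OF that] by (auto simp: vpath_def vwalk_def dest: inj_onD)
  moreover have "{\<iota> x, \<iota> y} \<inter> {\<iota> x', \<iota> y'} \<subseteq> \<iota> ` ({x, y} \<inter> {x', y'})"
    if "(x, y) \<in> arcs_ends H" "(x', y') \<in> arcs_ends H" for x y x' y'
    using EV[OF that(1)] EV[OF that(2)] inj by (auto dest: inj_onD)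
  ultimately show ?thesis
    unfolding topological_minor_of_def using inj sub EV
    by (intro exI[of _ \<iota>] exI[of _ "\<lambda>x y. [\<iota> x, \<iota> y]"]) auto
qed


section \<open>Replacing the edges of a graph by blocks\<close>

lemma card_le_disjoint_family:
  assumes "finite W" and "\<And>y. y \<in> Y \<Longrightarrow> \<phi> y \<noteq> {} \<and> \<phi> y \<subseteq> W"
    and "\<And>x y. x \<in> Y \<Longrightarrow> y \<in> Y \<Longrightarrow> x \<noteq> y \<Longrightarrow> \<phi> x \<inter> \<phi> y = {}"
  shows "finite Y \<and> card Y \<le> card W"
proof -
  have "\<forall>y \<in> Y. \<exists>z. z \<in> \<phi> y" using assms(2) by blast
  then obtain f where f: "\<And>y. y \<in> Y \<Longrightarrow> f y \<in> \<phi> y" using bchoice by metis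
  have "inj_on f Y" using assms(3) f by (force simp: inj_on_def)
  moreover have "f ` Y \<subseteq> W" using assms(2) f by blast
  ultimately show ?thesis using assms(1) by (meson card_inj_on_le finite_imageD finite_subset)
qed

lemma minor_model_card_le:
  assumes "minor_model V E V' E' \<phi>" and "finite V'"
  shows "finite V \<and> card V \<le> card V'"
  using assms by (intro card_le_disjoint_family[of _ _ \<phi>]) (auto simp: minor_model_def conn_def)

text \<open>\<open>A = {a}\<close> is allowed, with \<open>B = V\<close>, so every pattern with an
  edge has a separation. \<open>B \<noteq> {a}\<close> leaves room for the second attachment vertex
  \<open>b\<close>.\<close>

definition separation ::
  "'a set \<Rightarrow> ('a \<times> 'a) set \<Rightarrow> 'a set \<Rightarrow> 'a set \<Rightarrow> 'a \<Rightarrow> bool" where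
  "separation V E A B a \<longleftrightarrow>
     A \<union> B = V \<and> A \<inter> B = {a} \<and> E \<subseteq> A \<times> A \<union> B \<times> B \<and> B \<noteq> {a}"

definition vertex_cover :: "('v \<times> 'v) set \<Rightarrow> 'v set \<Rightarrow> bool" where
  "vertex_cover E C \<longleftrightarrow> (\<forall>(u, v) \<in> E. u \<in> C \<or> v \<in> C)"

text \<open>
  The graph replacing \<open>(V0, E0)\<close>: \<open>Core v x\<close> is the vertex \<open>x\<close> in the copy of \<open>A\<close> attached to \<open>v\<close>,
  with \<open>Core v a\<close> being \<open>v\<close> itself; \<open>Blk (u, v) x\<close> is the vertex \<open>x\<close> in the copy of \<open>B\<close> in which
  \<open>a\<close> and \<open>b\<close> are identified with \<open>u\<close> and \<open>v\<close>.
\<close>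

datatype ('v, 'a) gadget_vertex = Core 'v 'a | Blk "'v \<times> 'v" 'a

locale gadget =
  fixes V0 :: "'v set" and E0 :: "('v \<times> 'v) set"
    and V :: "'a set" and E :: "('a \<times> 'a) set" and A B :: "'a set" and a b :: 'a
  assumes E0: "\<And>u v. (u, v) \<in> E0 \<Longrightarrow> u \<in> V0 \<and> v \<in> V0 \<and> u \<noteq> v"
    and sep: "separation V E A B a"
    and b: "b \<in> B" "b \<noteq> a"
    and finV: "finite V"
    and symE: "sym E"
begin

lemma AB: "A \<union> B = V" "A \<inter> B = {a}" "E \<subseteq> A \<times> A \<union> B \<times> B" "a \<in> A" "a \<in> B" "b \<notin> A"
  "finite A" "finite B"
  using sep b finV unfolding separation_def by auto

primrec place :: "'v \<times> 'v \<Rightarrow> 'a \<Rightarrow> ('v, 'a) gadget_vertex" where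
  "place (u, v) x = (if x = a then Core u a else if x = b then Core v a else Blk (u, v) x)"

definition GV :: "('v, 'a) gadget_vertex set" where
  "GV = {Core v x | v x. v \<in> V0 \<and> x \<in> A} \<union> {Blk e x | e x. e \<in> E0 \<and> x \<in> B - {a, b}}"

definition GE :: "(('v, 'a) gadget_vertex \<times> ('v, 'a) gadget_vertex) set" where
  "GE = {(Core v x, Core v y) | v x y. v \<in> V0 \<and> x \<in> A \<and> y \<in> A \<and> (x, y) \<in> E} \<union>
        {(place e x, place e y) | e x y. e \<in> E0 \<and> x \<in> B \<and> y \<in> B \<and> (x, y) \<in> E}"

lemma place_in_GV: "e \<in> E0 \<Longrightarrow> x \<in> B \<Longrightarrow> place e x \<in> GV"
  using E0 AB by (cases e) (auto simp: GV_def)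

lemma GE_subset: "GE \<subseteq> GV \<times> GV"
proof -
  have "Core v x \<in> GV" if "v \<in> V0" "x \<in> A" for v x using that by (auto simp: GV_def)
  then show ?thesis using place_in_GV unfolding GE_def by blast
qed

lemma sym_GE: "sym GE"
proof (rule symI)
  fix p q assume "(p, q) \<in> GE"
  then consider v x y where "v \<in> V0" "x \<in> A" "y \<in> A" "(x, y) \<in> E" "p = Core v x" "q = Core v y"
    | e x y where "e \<in> E0" "x \<in> B" "y \<in> B" "(x, y) \<in> E" "p = place e x" "q = place e y"
    unfolding GE_def by blast
  then show "(q, p) \<in> GE"
  proof cases
    case 1
    with symD[OF symE] show ?thesis unfolding GE_def by blast
  next
    case 2
    then have "(place e y, place e x) \<in> GE"
      using symD[OF symE 2(4)] unfolding GE_def by blast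
    with 2 show ?thesis by (simp only:)
  qed
qed

text \<open>Charges each gadget vertex to a vertex of \<open>V0\<close>, so that a deletion set
  yields a cover of at most its size. For a block, either end of the edge would do.\<close>

primrec owner :: "('v, 'a) gadget_vertex \<Rightarrow> 'v" where
  "owner (Core v x) = v"
| "owner (Blk e x) = fst e"

lemma uncovered_edge_embeds:
  assumes e: "(u, v) \<in> E0" and "u \<notin> owner ` S" "v \<notin> owner ` S"
  shows "\<exists>\<iota>. inj_on \<iota> V \<and> \<iota> ` V \<subseteq> GV - S \<and> (\<forall>(x, y) \<in> E. (\<iota> x, \<iota> y) \<in> GE)"
proof -
  define \<iota> where "\<iota> x = (if x \<in> A then Core u x else place (u, v) x)" for x
  have uv: "u \<in> V0" "v \<in> V0" "u \<noteq> v" using E0[OF e] by auto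
  have \<iota>B: "\<iota> x = place (u, v) x" if "x \<in> B" for x
    using that AB(2) by (auto simp: \<iota>_def)
  have "inj_on \<iota> V"
    using uv AB by (auto simp: inj_on_def \<iota>_def split: if_splits)
  moreover have "\<iota> x \<in> GV" if "x \<in> V" for x
  proof (cases "x \<in> A")
    case True
    with uv show ?thesis by (auto simp: \<iota>_def GV_def)
  next
    case False
    with that AB(1) have "x \<in> B" by blast
    with \<iota>B place_in_GV[OF e] show ?thesis by metis
  qed
  moreover have "owner (\<iota> x) \<in> {u, v}" for x
    by (simp add: \<iota>_def)
  then have "\<iota> x \<notin> S" for x using assms(2,3) by (metis image_eqI insertE singletonD)
  moreover have "(\<iota> x, \<iota> y) \<in> GE" if xy: "(x, y) \<in> E" for x y
  proof -
    consider "x \<in> A" "y \<in> A" | "x \<in> B" "y \<in> B" using AB(3) xy by blast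
    then show ?thesis
    proof cases
      case 1
      with xy uv show ?thesis by (auto simp: \<iota>_def GE_def)
    next
      case 2
      with xy e show ?thesis unfolding GE_def \<iota>B[OF 2(1)] \<iota>B[OF 2(2)] by blast
    qed
  qed
  ultimately show ?thesis by (intro exI[of _ \<iota>]) auto
qed

section \<open>Minors that remain after deleting a vertex cover\<close>

context
  fixes C :: "'v set"
  assumes cover: "vertex_cover E0 C"
begin

text \<open>Only the roots of the covered vertices are deleted. The rest of such a core stays, and
  \<open>retract\<close> keeps it in a copy of its own.\<close>

definition R :: "('v, 'a) gadget_vertex set" where
  "R = GV - (\<lambda>v. Core v a) ` C"

text \<open>
  The only end of \<open>e\<close> that may have survived. If none did, then \<open>Core (survivor e) a\<close> is outside
  \<open>R\<close>, and the rest of the block is cut off.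
\<close>

definition survivor :: "'v \<times> 'v \<Rightarrow> 'v" where
  "survivor e = (if fst e \<in> C then snd e else fst e)"

definition rest :: "'v \<times> 'v \<Rightarrow> ('v, 'a) gadget_vertex set" where
  "rest e = Blk e ` (B - {a, b})"

lemma place_R:
  assumes "e \<in> E0" and "x \<in> B" and "place e x \<in> R"
  shows "place e x \<in> rest e \<or> place e x = Core (survivor e) a"
proof (cases e)
  case (Pair u v)
  with cover assms have "u \<in> C \<or> v \<in> C" by (auto simp: vertex_cover_def)
  with Pair assms show ?thesis
    by (auto simp: rest_def R_def survivor_def split: if_splits)
qed

text \<open>\<open>place f\<close> takes values of the form \<open>Blk e x\<close> only for
  \<open>f = e\<close>, so a remainder has arcs only inside the copy of \<open>B\<close> on its own
  edge, of whose ends at most one is left.\<close>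

lemma rest_neighbour:
  assumes "p \<in> rest e" and "(p, q) \<in> GE" and "q \<in> R"
  shows "q \<in> rest e \<or> q = Core (survivor e) a"
proof -
  from assms(1) obtain z where z: "p = Blk e z" "z \<in> B" "z \<noteq> a" "z \<noteq> b" by (auto simp: rest_def)
  from assms(2) consider v x y where "p = Core v x" "q = Core v y"
    | f x y where "f \<in> E0" "x \<in> B" "y \<in> B" "p = place f x" "q = place f y"
    unfolding GE_def by blast
  then show ?thesis
  proof cases
    case 2
    with z have "f = e" by (cases f) (auto split: if_splits)
    with 2 place_R assms(3) show ?thesis by blast
  qed (use z in simp)
qed

text \<open>The surviving end is the only way out of \<open>rest e\<close>, and \<open>X\<close>
  avoids it.\<close>

lemma conn_meets_rest:
  assumes "conn GE X" and "X \<subseteq> R" and "p \<in> X" "p \<in> rest e" and "Core (survivor e) a \<notin> X"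
  shows "X \<subseteq> rest e"
proof
  fix q assume "q \<in> X"
  show "q \<in> rest e"
  proof (rule ccontr)
    assume "q \<notin> rest e"
    then obtain u v where "u \<in> X" "u \<in> rest e" "v \<in> X" "v \<notin> rest e" "(u, v) \<in> GE"
      using conn_cut[OF assms(1,3,4) \<open>q \<in> X\<close>] by metis
    with rest_neighbour[of u e v] assms show False by blast
  qed
qed

text \<open>
  The branch sets inside the remainder of a block, together with the one containing the surviving
  end of the edge, would be one side of a separation smaller than \<open>B\<close>.
\<close>

lemma no_branch_set_in_rest:
  assumes conn': "conn E' V'" and E': "E' \<subseteq> V' \<times> V'" "sym E'" and nontriv: "\<And>x. V' \<noteq> {x}"
    and min: "\<And>A' B' a'. separation V' E' A' B' a' \<Longrightarrow> card B \<le> card B'"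
    and \<phi>: "minor_model V' E' R GE \<phi>" and y0: "y0 \<in> V'"
  shows "\<not> \<phi> y0 \<subseteq> rest e"
proof
  assume y0': "\<phi> y0 \<subseteq> rest e"
  let ?w = "Core (survivor e) a"
  define Y where "Y = {y \<in> V'. \<phi> y \<subseteq> rest e}"
  have \<phi>R: "\<phi> y \<subseteq> R" "conn GE (\<phi> y)" if "y \<in> V'" for y
    using \<phi> that by (auto simp: minor_model_def)
  have disj: "\<phi> x \<inter> \<phi> y = {}" if "x \<in> V'" "y \<in> V'" "x \<noteq> y" for x y
    using \<phi> that by (auto simp: minor_model_def)
  have step: "y' \<in> Y \<or> ?w \<in> \<phi> y'" if y: "y \<in> Y" and e': "(y, y') \<in> E'" for y y'
  proof -
    have y': "y' \<in> V'" using e' E' by blast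
    obtain p q where pq: "p \<in> \<phi> y" "q \<in> \<phi> y'" "(p, q) \<in> GE"
      using \<phi> e' unfolding minor_model_def by blast
    then have "q \<in> rest e \<or> q = ?w"
      using rest_neighbour[of p e q] y \<phi>R(1)[OF y'] unfolding Y_def by blast
    with pq conn_meets_rest[OF \<phi>R(2)[OF y'] \<phi>R(1)[OF y'], of q e] y' show ?thesis
      unfolding Y_def by blast
  qed
  have "finite (rest e)" unfolding rest_def using AB(8) by simp
  then have Y: "finite Y \<and> card Y \<le> card (rest e)"
    by (rule card_le_disjoint_family[of _ _ \<phi>])
      (use conn_ne[OF \<phi>R(2)] disj in \<open>auto simp: Y_def\<close>)
  \<comment> \<open>Neither \<open>a\<close> nor \<open>b\<close> has a copy in the remainder, so it
    holds at most \<open>card B - 2\<close> disjoint branch sets. One further vertex still stays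
    below \<open>card B\<close>.\<close>
  have "card (rest e) \<le> card (B - {a, b})"
    unfolding rest_def using AB(8) by (intro card_image_le) simp
  moreover have "card (B - {a, b}) = card B - 2"
    using AB b by (subst card_Diff_subset) auto
  moreover have "card {a, b} \<le> card B" using AB b by (intro card_mono) auto
  then have "2 \<le> card B" using b by simp
  ultimately have small: "card Y + 1 < card B" using Y by linarith
  have y0Y: "y0 \<in> Y" using y0 y0' by (simp add: Y_def)
  show False
  proof (cases "\<exists>x \<in> V'. ?w \<in> \<phi> x")
    case False
    \<comment> \<open>No branch set holds the surviving end, so connectedness forces all of them
      into the remainder. Then already the trivial separation with block \<open>V'\<close> is too
      small.\<close>
    have "V' \<subseteq> Y"
    proof (rule subsetI, rule ccontr)
      fix z assume "z \<in> V'" "z \<notin> Y"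
      then obtain u v where "u \<in> Y" "v \<in> V'" "v \<notin> Y" "(u, v) \<in> E'"
        using conn_cut[OF conn' y0 y0Y] by metis
      with step False show False by blast
    qed
    then have "V' = Y" unfolding Y_def by blast
    moreover have "separation V' E' {y0} V' y0"
      using y0 E' nontriv unfolding separation_def by blast
    ultimately show False using min[of "{y0}" V' y0] small by simp
  next
    case True
    then obtain x where x: "x \<in> V'" "?w \<in> \<phi> x" by blast
    then have xY: "x \<notin> Y" unfolding Y_def rest_def by auto
    have uniq: "x' = x" if "x' \<in> V'" "?w \<in> \<phi> x'" for x' using that x disj by blast
    have in_Y: "q \<in> insert x Y" if "p \<in> Y" "(p, q) \<in> E'" for p q
      using step[OF that] uniq that E' by blast
    \<comment> \<open>Arcs leave \<open>Y\<close> only towards \<open>x\<close>, the one vertex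
      whose branch set holds the surviving end.\<close>
    have "E' \<subseteq> (V' - Y) \<times> (V' - Y) \<union> insert x Y \<times> insert x Y"
    proof (rule subrelI)
      fix p q assume pq: "(p, q) \<in> E'"
      then have "(q, p) \<in> E'" "p \<in> V'" "q \<in> V'" using E' by (auto dest: symD)
      with in_Y pq show "(p, q) \<in> (V' - Y) \<times> (V' - Y) \<union> insert x Y \<times> insert x Y" by blast
    qed
    then have "separation V' E' (V' - Y) (insert x Y) x"
      unfolding separation_def using x xY y0Y by (auto simp: Y_def)
    from min[OF this] small Y xY show False by simp
  qed
qed

text \<open>The value on a remainder whose edge lost both ends is harmless: a branch set meeting it
  would have to lie inside it, which \<open>no_branch_set_in_rest\<close> excludes.\<close>

primrec retract :: "('v, 'a) gadget_vertex \<Rightarrow> 'v \<times> 'a" where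
  "retract (Core v x) = (v, x)"
| "retract (Blk e x) = (survivor e, a)"

definition copies :: "(('v \<times> 'a) \<times> ('v \<times> 'a)) set" where
  "copies = {((v, x), (v, y)) | v x y. (x, y) \<in> E}"

lemma retract_edge:
  assumes "p \<in> R" "q \<in> R" "(p, q) \<in> GE"
  shows "retract p = retract q \<or> (retract p, retract q) \<in> copies"
proof -
  from assms(3) consider v x y where "p = Core v x" "q = Core v y" "(x, y) \<in> E"
    | f x y where "f \<in> E0" "x \<in> B" "y \<in> B" "p = place f x" "q = place f y"
    unfolding GE_def by blast
  then show ?thesis
  proof cases
    case 2
    with place_R[of f x] place_R[of f y] assms have "retract p = (survivor f, a)"
      "retract q = (survivor f, a)" by (auto simp: rest_def)
    then show ?thesis by simp
  qed (auto simp: copies_def)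
qed

text \<open>Contraction might merge branch sets; \<open>lift\<close> prevents this by finding every
  contracted point in the branch set itself. The images live in disjoint copies of the core, and
  connectedness of the pattern keeps them in a single one, so \<open>snd\<close> stays injective on
  them.\<close>

lemma minor_avoiding_cover:
  assumes conn': "conn E' V'" and E': "E' \<subseteq> V' \<times> V'" "sym E'" "irrefl E'" and nontriv: "\<And>x. V' \<noteq> {x}"
    and min: "\<And>A' B' a'. separation V' E' A' B' a' \<Longrightarrow> card B \<le> card B'"
    and \<phi>: "minor_model V' E' R GE \<phi>"
  shows "\<exists>\<psi>. minor_model V' E' A E \<psi>"
proof -
  have \<phi>R: "\<phi> y \<subseteq> R" "conn GE (\<phi> y)" if "y \<in> V'" for y
    using \<phi> that by (auto simp: minor_model_def)
  have disj: "\<phi> x \<inter> \<phi> y = {}" if "x \<in> V'" "y \<in> V'" "x \<noteq> y" for x y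
    using \<phi> that by (auto simp: minor_model_def)
  \<comment> \<open>A branch set that meets a remainder is not contained in it, so it holds the
    surviving end, to which the remainder is contracted.\<close>
  have lift: "Core (fst (retract p)) (snd (retract p)) \<in> \<phi> y" if "y \<in> V'" "p \<in> \<phi> y" for y p
  proof (cases p)
    case (Blk e x)
    then have "p \<in> rest e" using \<phi>R(1) that unfolding R_def GV_def rest_def by auto
    moreover have "\<not> \<phi> y \<subseteq> rest e"
      by (rule no_branch_set_in_rest[OF conn' E'(1,2) nontriv _ \<phi> that(1)]) (rule min)
    ultimately have "Core (survivor e) a \<in> \<phi> y"
      using conn_meets_rest[OF \<phi>R(2,1)[OF that(1)] that(2)] by blast
    with Blk show ?thesis by simp
  qed (use that in simp)
  have same: "x = y" if "x \<in> V'" "y \<in> V'" "p \<in> \<phi> x" "q \<in> \<phi> y" "retract p = retract q" for x y p q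
    using lift[of x p] lift[of y q] that disj by (metis disjoint_iff)
  have edge: "\<exists>u \<in> retract ` \<phi> x. \<exists>v \<in> retract ` \<phi> y. (u, v) \<in> copies" if e: "(x, y) \<in> E'" for x y
  proof -
    have xy: "x \<in> V'" "y \<in> V'" "x \<noteq> y" using e E' by (auto simp: irrefl_def)
    obtain p q where pq: "p \<in> \<phi> x" "q \<in> \<phi> y" "(p, q) \<in> GE"
      using \<phi> e unfolding minor_model_def by blast
    then have "(retract p, retract q) \<in> copies"
      using retract_edge[of p q] same[of x y p q] \<phi>R(1) xy by blast
    with pq show ?thesis by blast
  qed
  have conn_r: "conn copies (retract ` \<phi> y)" if "y \<in> V'" for y
    using \<phi>R[OF that] retract_edge by (intro conn_image[OF \<phi>R(2)[OF that]]) blast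
  have "conn copies (\<Union>y \<in> V'. retract ` \<phi> y)"
    using conn_r edge by (intro conn_UN[OF conn']) auto
  then have const: "fst z = fst z'"
    if "z \<in> (\<Union>y \<in> V'. retract ` \<phi> y)" "z' \<in> (\<Union>y \<in> V'. retract ` \<phi> y)" for z z'
  proof (rule conn_const[OF _ _ that])
    fix x y :: "'v \<times> 'a" assume "(x, y) \<in> copies"
    then show "fst x = fst y" by (auto simp: copies_def)
  qed
  have "minor_model V' E' A E (\<lambda>y. snd ` retract ` \<phi> y)"
    unfolding minor_model_def
  proof (intro conjI ballI allI impI)
    fix y assume y: "y \<in> V'"
    show "snd ` retract ` \<phi> y \<subseteq> A"
      using lift[OF y] \<phi>R(1)[OF y] unfolding R_def GV_def by fastforce
    show "conn E (snd ` retract ` \<phi> y)"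
    proof (rule conn_image[OF conn_r[OF y]])
      fix p q :: "'v \<times> 'a" assume "(p, q) \<in> copies"
      then show "snd p = snd q \<or> (snd p, snd q) \<in> E" by (auto simp: copies_def)
    qed
  next
    fix x y assume xy: "x \<in> V'" "y \<in> V'" "x \<noteq> y"
    show "snd ` retract ` \<phi> x \<inter> snd ` retract ` \<phi> y = {}"
    proof (rule ccontr)
      assume "snd ` retract ` \<phi> x \<inter> snd ` retract ` \<phi> y \<noteq> {}"
      then obtain p q where pq: "p \<in> \<phi> x" "q \<in> \<phi> y" "snd (retract p) = snd (retract q)"
        by auto
      then have "retract p = retract q"
        using const[of "retract p" "retract q"] xy by (auto simp: prod_eq_iff)
      with same pq xy show False by blast
    qed
  next
    fix x y assume "(x, y) \<in> E'"
    from edge[OF this] show "\<exists>u \<in> snd ` retract ` \<phi> x. \<exists>v \<in> snd ` retract ` \<phi> y. (u, v) \<in> E"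
      by (force simp: copies_def)
  qed
  then show ?thesis by blast
qed

end

end


section \<open>A while program for the reduction\<close>

text \<open>The time is only bounded, so that both branches of a test can share one bound.\<close>

definition runs :: "com \<Rightarrow> store \<Rightarrow> (store \<Rightarrow> bool) \<Rightarrow> nat \<Rightarrow> bool" where
  "runs c s Q \<tau> \<longleftrightarrow> (\<exists>t s'. exec c s t s' \<and> t \<le> \<tau> \<and> Q s')"

lemma runs_mono:
  assumes "runs c s Q \<tau>" and "\<And>s'. Q s' \<Longrightarrow> Q' s'" and "\<tau> \<le> \<tau>'"
  shows "runs c s Q' \<tau>'"
  using assms unfolding runs_def by (meson order_trans)

lemma runs_assign:
  assumes "Q (s(x := expr_val e s))"
  shows "runs (CAssign x e) s Q (1 + expr_cost e)"
  using exec.Assign assms unfolding runs_def by blast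

lemma runs_seq:
  assumes "runs c1 s (\<lambda>s'. runs c2 s' Q \<tau>2) \<tau>1"
  shows "runs (CSeq c1 c2) s Q (\<tau>1 + \<tau>2)"
  using assms unfolding runs_def by (meson add_mono exec.Seq)

lemma runs_assign_seq:
  assumes "runs c (s(x := expr_val e s)) Q \<tau>"
  shows "runs (CSeq (CAssign x e) c) s Q (1 + expr_cost e + \<tau>)"
  by (rule runs_seq, rule runs_assign, rule assms)

lemma runs_if:
  assumes "expr_val e s \<noteq> NIL \<Longrightarrow> runs c1 s Q \<tau>" and "expr_val e s = NIL \<Longrightarrow> runs c2 s Q \<tau>"
  shows "runs (CIf e c1 c2) s Q (1 + expr_cost e + \<tau>)"
proof (cases "expr_val e s = NIL")
  case True
  with assms(2) show ?thesis unfolding runs_def by (meson add_left_mono exec.IfFalse)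
next
  case False
  with assms(1) show ?thesis unfolding runs_def by (meson add_left_mono exec.IfTrue)
qed

text \<open>All loops of the reduction have a known number of rounds. Indexing the invariant by the
  finished rounds gives termination and running time without a separate variant.\<close>

lemma runs_while:
  assumes inv: "I 0 s"
    and test: "\<And>j s. j \<le> L \<Longrightarrow> I j s \<Longrightarrow> expr_val e s \<noteq> NIL \<longleftrightarrow> j < L"
    and body: "\<And>j s. j < L \<Longrightarrow> I j s \<Longrightarrow> runs c s (I (Suc j)) \<tau>"
  shows "runs (CWhile e c) s (I L) (L * (1 + expr_cost e + \<tau>) + (1 + expr_cost e))"
proof -
  have "runs (CWhile e c) s (I L) ((L - j) * (1 + expr_cost e + \<tau>) + (1 + expr_cost e))"
    if "j \<le> L" "I j s" for j s
    using that
  proof (induction "L - j" arbitrary: j s)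
    case 0
    then have j: "j = L" by simp
    then have "expr_val e s = NIL" using test[of j s] 0 by simp
    from exec.WhileFalse[OF this, of c] show ?case using 0(3) j unfolding runs_def by auto
  next
    case (Suc d)
    then have j: "j < L" by simp
    with test[OF Suc.prems] have ne: "expr_val e s \<noteq> NIL" by simp
    obtain t1 s1 where 1: "exec c s t1 s1" "t1 \<le> \<tau>" "I (Suc j) s1"
      using body[OF j Suc.prems(2)] unfolding runs_def by blast
    have "runs (CWhile e c) s1 (I L) ((L - Suc j) * (1 + expr_cost e + \<tau>) + (1 + expr_cost e))"
      using Suc.hyps j 1(3) by (intro Suc.hyps(1)) auto
    then obtain t2 s2 where 2: "exec (CWhile e c) s1 t2 s2" "I L s2"
      "t2 \<le> (L - Suc j) * (1 + expr_cost e + \<tau>) + (1 + expr_cost e)"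
      unfolding runs_def by blast
    have "L - j = Suc (L - Suc j)" using j by simp
    then have "1 + expr_cost e + t1 + t2 \<le> (L - j) * (1 + expr_cost e + \<tau>) + (1 + expr_cost e)"
      using 1(2) 2(3) by simp
    with exec.WhileTrue[OF ne 1(1) 2(1)] 2(2) show ?case unfolding runs_def by blast
  qed
  from this[of 0 s] inv show ?thesis by simp
qed

section \<open>Encoded numbers, lists and edges\<close>

lemma enc_nat_eq_NIL [simp]: "enc_nat n = NIL \<longleftrightarrow> n = 0"
  by (cases n) auto

lemma cdr_enc_nat [simp]: "cdr (enc_nat n) = enc_nat (n - 1)"
  by (cases n) auto

lemma enc_list_eq_NIL [simp]: "enc_list f xs = NIL \<longleftrightarrow> xs = []"
  by (cases xs) auto

lemma enc_list_drop:
  assumes "j < length xs"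
  shows "car (enc_list f (drop j xs)) = f (xs ! j)"
    and "cdr (enc_list f (drop j xs)) = enc_list f (drop (Suc j) xs)"
  using assms by (simp_all add: Cons_nth_drop_Suc[symmetric])

definition add_const :: "nat \<Rightarrow> expr \<Rightarrow> expr" where
  "add_const k e = (ECons ENil ^^ k) e"

lemma expr_val_add_const [simp]:
  "expr_val e s = enc_nat m \<Longrightarrow> expr_val (add_const k e) s = enc_nat (m + k)"
  by (induction k) (simp_all add: add_const_def)

lemma expr_cost_add_const [simp]: "expr_cost (add_const k e) = 2 * k + expr_cost e"
  by (induction k) (simp_all add: add_const_def)

lemma enc_prod_Pair [simp]: "enc_prod f g (x, y) = CONS (f x) (g y)"
  by (simp add: enc_prod_def)

abbreviation enc_edges :: "(nat \<times> nat) list \<Rightarrow> sexp" where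
  "enc_edges \<equiv> enc_list (enc_prod enc_nat enc_nat)"

definition copy_edges :: "(nat \<Rightarrow> nat) \<Rightarrow> (nat \<times> nat) list \<Rightarrow> (nat \<times> nat) list" where
  "copy_edges g es = map (\<lambda>(i, j). (g i, g j)) es"

text \<open>The pattern \<open>es\<close> is part of the program text, so one assignment of constant
  cost prepends a whole copy. \<open>f i\<close> is the expression for the number of the local
  vertex \<open>i\<close>.\<close>

definition emit :: "(nat \<Rightarrow> expr) \<Rightarrow> (nat \<times> nat) list \<Rightarrow> expr \<Rightarrow> expr" where
  "emit f es e = foldr (\<lambda>(i, j). ECons (ECons (f i) (f j))) es e"

lemma expr_val_emit:
  assumes "\<And>i j. (i, j) \<in> set es \<Longrightarrow> expr_val (f i) s = enc_nat (g i) \<and> expr_val (f j) s = enc_nat (g j)"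
    and "expr_val e s = enc_edges ds"
  shows "expr_val (emit f es e) s = enc_edges (copy_edges g es @ ds)"
  using assms(1)
proof (induction es)
  case Nil
  with assms(2) show ?case by (simp add: emit_def copy_edges_def)
next
  case (Cons p es)
  have "expr_val (emit f es e) s = enc_edges (copy_edges g es @ ds)"
    by (rule Cons.IH, rule Cons.prems) simp
  with Cons.prems[of "fst p" "snd p"] show ?case
    by (cases p) (simp add: emit_def copy_edges_def)
qed

section \<open>The map from 3-SAT to deletion instances\<close>

definition lit_vertex :: "literal \<Rightarrow> nat" where
  "lit_vertex l = 2 * fst l + (if snd l then 0 else 1)"

text \<open>Numbers are unary, so doubling takes a loop: \<open>x\<close> starts with the sign bit
  and grows by 2 for each unit removed from register 8.\<close>

definition lit_prog :: "expr \<Rightarrow> nat \<Rightarrow> com" where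
  "lit_prog e x =
     CSeq (CIf (ECdr e) (CAssign x ENil) (CAssign x (ECons ENil ENil)))
    (CSeq (CAssign 8 (ECar e))
          (CWhile (EVar 8) (CSeq (CAssign x (add_const 2 (EVar x))) (CAssign 8 (ECdr (EVar 8))))))"

text \<open>The assumption for all \<open>v\<close> says that \<open>e\<close> does not read
  \<open>x\<close>, which is overwritten before \<open>e\<close> is evaluated a second time.\<close>

lemma runs_lit_prog:
  assumes e: "\<And>v. expr_val e (s(x := v)) = enc_prod enc_nat enc_bool l"
    and x: "x \<noteq> 8" and l: "fst l \<le> n"
  shows "runs (lit_prog e x) s
    (\<lambda>s'. s' x = enc_nat (lit_vertex l) \<and> (\<forall>i. i \<noteq> x \<longrightarrow> i \<noteq> 8 \<longrightarrow> s' i = s i))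
    (2 * expr_cost e + 20 * (n + 1))"
proof -
  let ?b = "if snd l then 0 else 1 :: nat"
  let ?I = "\<lambda>j (s' :: store). s' x = enc_nat (2 * j + ?b) \<and> s' 8 = enc_nat (fst l - j) \<and>
    (\<forall>i. i \<noteq> x \<longrightarrow> i \<noteq> 8 \<longrightarrow> s' i = s i)"
  have e0: "expr_val e s = enc_prod enc_nat enc_bool l" using e[of "s x"] by simp
  have loop: "runs (CWhile (EVar 8) (CSeq (CAssign x (add_const 2 (EVar x))) (CAssign 8 (ECdr (EVar 8)))))
      s' (?I (fst l)) (fst l * (1 + expr_cost (EVar 8) + 9) + (1 + expr_cost (EVar 8)))" if "?I 0 s'" for s'
  proof (rule runs_while[of ?I])
    fix j s1 assume "j < fst l" "?I j s1"
    then show "runs (CSeq (CAssign x (add_const 2 (EVar x))) (CAssign 8 (ECdr (EVar 8)))) s1 (?I (Suc j)) 9"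
      using x by (intro runs_mono[OF runs_assign_seq[OF runs_assign[where Q = "?I (Suc j)"]]]) auto
  qed (use that in auto)
  have "runs (lit_prog e x) s (\<lambda>s'. ?I (fst l) s')
     ((1 + expr_cost (ECdr e) + 4) + ((1 + expr_cost (ECar e)) +
      (fst l * (1 + expr_cost (EVar 8) + 9) + (1 + expr_cost (EVar 8)))))"
    unfolding lit_prog_def
  proof (rule runs_seq, rule runs_mono[where Q = "\<lambda>s'. s' = s(x := enc_nat ?b)"])
    show "runs (CIf (ECdr e) (CAssign x ENil) (CAssign x (ECons ENil ENil))) s
      (\<lambda>s'. s' = s(x := enc_nat ?b)) (1 + expr_cost (ECdr e) + 4)"
      by (rule runs_if; rule runs_mono[OF runs_assign[where Q = "\<lambda>s'. s' = s(x := enc_nat ?b)"]])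
        (auto simp: e0 enc_prod_def enc_bool_def split: if_splits)
  next
    fix s' assume s': "s' = s(x := enc_nat ?b)"
    show "runs (CSeq (CAssign 8 (ECar e)) (CWhile (EVar 8)
         (CSeq (CAssign x (add_const 2 (EVar x))) (CAssign 8 (ECdr (EVar 8)))))) s' (?I (fst l))
      ((1 + expr_cost (ECar e)) + (fst l * (1 + expr_cost (EVar 8) + 9) + (1 + expr_cost (EVar 8))))"
      by (rule runs_assign_seq, rule loop) (use x in \<open>auto simp: s' e enc_prod_def\<close>)
  qed simp
  then show ?thesis
    by (rule runs_mono) (use l in \<open>auto simp: lit_vertex_def\<close>)
qed

fun clause_lit :: "clause \<Rightarrow> nat \<Rightarrow> literal" where
  "clause_lit (l0, l1, l2) t = (if t = 0 then l0 else if t = 1 then l1 else l2)"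

text \<open>Numbers \<open>0, 1, 2\<close> stand for the triangle of a clause, \<open>3, 4, 5\<close> for its literals.\<close>

definition clause_gadget :: "(nat \<times> nat) list" where
  "clause_gadget = [(0, 1), (0, 2), (1, 2), (3, 0), (4, 1), (5, 2)]"

definition clause_vertex :: "nat \<Rightarrow> clause \<Rightarrow> nat \<Rightarrow> nat" where
  "clause_vertex c cl i = (if i < 3 then c + i else lit_vertex (clause_lit cl (i - 3)))"

definition vc_size :: "nat \<times> clause list \<Rightarrow> nat" where
  "vc_size = (\<lambda>(n, cs). 2 * n + 3 * length cs)"

text \<open>The order and the two uses of \<open>rev\<close> mirror a program that prepends: it
  treats the variables first and then the clauses from left to right.\<close>

definition vc_edges :: "nat \<times> clause list \<Rightarrow> (nat \<times> nat) list" where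
  "vc_edges = (\<lambda>(n, cs).
     concat (map (\<lambda>j. copy_edges (clause_vertex (2 * n + 3 * j) (cs ! j)) clause_gadget) (rev [0..<length cs])) @
     concat (map (\<lambda>i. copy_edges ((+) (2 * i)) [(0, 1)]) (rev [0..<n])))"

text \<open>One end of each variable edge and two corners of each triangle are unavoidable; the
  budget allows exactly that.\<close>

definition vc_budget :: "nat \<times> clause list \<Rightarrow> nat" where
  "vc_budget = (\<lambda>(n, cs). n + 2 * length cs)"

text \<open>
  The core with vertices \<open>0, \<dots>, na - 1\<close> is glued at \<open>0\<close>, the block with vertices
  \<open>0, \<dots>, nb - 1\<close> at \<open>0\<close> and \<open>1\<close>.
\<close>

definition core_vertex :: "nat \<Rightarrow> nat \<Rightarrow> nat \<Rightarrow> nat" where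
  "core_vertex v cur i = (if i = 0 then v else cur + (i - 1))"

definition block_vertex :: "nat \<times> nat \<Rightarrow> nat \<Rightarrow> nat \<Rightarrow> nat" where
  "block_vertex e cur i = (if i = 0 then fst e else if i = 1 then snd e else cur + (i - 2))"

text \<open>The old vertices keep the numbers below \<open>N\<close>. Each edge then brings
  \<open>nb - 2\<close> new vertices, since two vertices of a block are its ends, and after these
  each vertex brings \<open>na - 1\<close>, since the root of a core is old.\<close>

definition gadget_edges ::
  "nat \<Rightarrow> nat \<Rightarrow> (nat \<times> nat) list \<Rightarrow> (nat \<times> nat) list \<Rightarrow> nat \<Rightarrow> (nat \<times> nat) list \<Rightarrow> (nat \<times> nat) list" where
  "gadget_edges na nb LA LB N es =
     concat (map (\<lambda>v. copy_edges (core_vertex v (N + length es * (nb - 2) + v * (na - 1))) LA) (rev [0..<N])) @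
     concat (map (\<lambda>j. copy_edges (block_vertex (es ! j) (N + j * (nb - 2))) LB) (rev [0..<length es]))"

definition gadget_size :: "nat \<Rightarrow> nat \<Rightarrow> nat \<Rightarrow> nat \<Rightarrow> nat" where
  "gadget_size na nb N m = N + m * (nb - 2) + N * (na - 1)"

definition reduce ::
  "nat \<Rightarrow> nat \<Rightarrow> (nat \<times> nat) list \<Rightarrow> (nat \<times> nat) list \<Rightarrow> nat \<times> clause list \<Rightarrow> nat \<times> (nat \<times> nat) list \<times> nat" where
  "reduce na nb LA LB i =
     (gadget_size na nb (vc_size i) (length (vc_edges i)),
      gadget_edges na nb LA LB (vc_size i) (vc_edges i), vc_budget i)"

text \<open>
  Registers of the program: \<open>1\<close> is consumed by the loops; \<open>2\<close>, \<open>3\<close>, \<open>4\<close> hold the number of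
  vertices, the edges and the budget of the vertex cover instance; \<open>5\<close> and \<open>6\<close> the next unused
  vertex and the edges of the output, \<open>7\<close> the vertex at which the current core is attached. While
  the clauses are processed, \<open>5\<close>, \<open>6\<close>, \<open>7\<close> hold the three literals. Register \<open>8\<close> is scratch.
\<close>

definition var_loop :: com where
  "var_loop = CWhile (EVar 1)
     (CSeq (CAssign 3 (emit (\<lambda>i. add_const i (EVar 2)) [(0, 1)] (EVar 3)))
     (CSeq (CAssign 2 (add_const 2 (EVar 2)))
           (CAssign 1 (ECdr (EVar 1)))))"

text \<open>\<open>EVar (i + 2)\<close> matches the local vertices 3, 4, 5 of
  \<open>clause_gadget\<close> with the literals in registers 5, 6, 7.\<close>

definition clause_loop :: com where
  "clause_loop = CWhile (EVar 1)
     (CSeq (lit_prog (ECar (ECar (EVar 1))) 5)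
     (CSeq (lit_prog (ECar (ECdr (ECar (EVar 1)))) 6)
     (CSeq (lit_prog (ECdr (ECdr (ECar (EVar 1)))) 7)
     (CSeq (CAssign 3 (emit (\<lambda>i. if i < 3 then add_const i (EVar 2) else EVar (i + 2)) clause_gadget (EVar 3)))
     (CSeq (CAssign 2 (add_const 3 (EVar 2)))
     (CSeq (CAssign 4 (add_const 2 (EVar 4)))
           (CAssign 1 (ECdr (EVar 1)))))))))"

definition block_loop :: "nat \<Rightarrow> (nat \<times> nat) list \<Rightarrow> com" where
  "block_loop nb LB = CWhile (EVar 1)
     (CSeq (CAssign 6 (emit (\<lambda>i. if i = 0 then ECar (ECar (EVar 1)) else
         if i = 1 then ECdr (ECar (EVar 1)) else add_const (i - 2) (EVar 5)) LB (EVar 6)))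
     (CSeq (CAssign 5 (add_const (nb - 2) (EVar 5)))
           (CAssign 1 (ECdr (EVar 1)))))"

definition core_loop :: "nat \<Rightarrow> (nat \<times> nat) list \<Rightarrow> com" where
  "core_loop na LA = CWhile (EVar 1)
     (CSeq (CAssign 6 (emit (\<lambda>i. if i = 0 then EVar 7 else add_const (i - 1) (EVar 5)) LA (EVar 6)))
     (CSeq (CAssign 5 (add_const (na - 1) (EVar 5)))
     (CSeq (CAssign 7 (add_const 1 (EVar 7)))
           (CAssign 1 (ECdr (EVar 1))))))"

text \<open>\<open>decides_within\<close> promises a result of the solver only when all registers
  but 0 are \<open>NIL\<close>, so the used ones are cleared. The loop invariants record that those
  above 8 were never touched.\<close>

definition finish :: com where
  "finish =
     CSeq (CAssign 0 (ECons (EVar 5) (ECons (EVar 6) (EVar 4))))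
    (CSeq (CAssign 1 ENil) (CSeq (CAssign 2 ENil) (CSeq (CAssign 3 ENil) (CSeq (CAssign 4 ENil)
    (CSeq (CAssign 5 ENil) (CSeq (CAssign 6 ENil) (CSeq (CAssign 7 ENil) (CAssign 8 ENil))))))))"

definition build :: "nat \<Rightarrow> nat \<Rightarrow> (nat \<times> nat) list \<Rightarrow> (nat \<times> nat) list \<Rightarrow> com" where
  "build na nb LA LB =
     CSeq (CAssign 1 (EVar 3)) (CSeq (CAssign 5 (EVar 2)) (CSeq (CAssign 6 ENil)
    (CSeq (block_loop nb LB)
    (CSeq (CAssign 1 (EVar 2)) (CSeq (CAssign 7 ENil)
    (CSeq (core_loop na LA) finish))))))"

definition reduction_prog :: "nat \<Rightarrow> nat \<Rightarrow> (nat \<times> nat) list \<Rightarrow> (nat \<times> nat) list \<Rightarrow> com" where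
  "reduction_prog na nb LA LB =
     CSeq (CAssign 1 (ECar (EVar 0)))
    (CSeq var_loop
    (CSeq (CAssign 4 (ECar (EVar 0))) (CSeq (CAssign 1 (ECdr (EVar 0)))
    (CSeq clause_loop (build na nb LA LB)))))"

section \<open>Correctness and running time of the reduction program\<close>

lemma runs_var_loop:
  assumes "s 1 = enc_nat n" "s 2 = NIL" "s 3 = NIL" "s 4 = NIL" "\<forall>i > 8. s i = NIL"
  shows "runs var_loop s
    (\<lambda>s'. s' 2 = enc_nat (2 * n) \<and> s' 3 = enc_edges (vc_edges (n, [])) \<and> s' 0 = s 0 \<and> (\<forall>i > 8. s' i = NIL))
    (n * 50 + 2)"
proof -
  let ?I = "\<lambda>j (s' :: store). s' 1 = enc_nat (n - j) \<and> s' 2 = enc_nat (2 * j) \<and>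
     s' 3 = enc_edges (vc_edges (j, [])) \<and> s' 0 = s 0 \<and> (\<forall>i > 8. s' i = NIL)"
  have "runs var_loop s (?I n) (n * (1 + expr_cost (EVar 1) + 22) + (1 + expr_cost (EVar 1)))"
    unfolding var_loop_def
  proof (rule runs_while[of ?I])
    show "?I 0 s" using assms by (simp add: vc_edges_def)
  next
    fix j s1 assume "j < n" and I: "?I j s1"
    have "expr_val (emit (\<lambda>i. add_const i (EVar 2)) [(0, 1)] (EVar 3)) s1 = enc_edges (vc_edges (Suc j, []))"
      using I by (subst expr_val_emit[where g = "(+) (2 * j)"]) (auto simp: vc_edges_def)
    moreover have "expr_cost (emit (\<lambda>i. add_const i (EVar 2)) [(0, 1)] (EVar 3)) = 7"
      by (simp add: emit_def)
    ultimately show "runs (CSeq (CAssign 3 (emit (\<lambda>i. add_const i (EVar 2)) [(0, 1)] (EVar 3)))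
        (CSeq (CAssign 2 (add_const 2 (EVar 2))) (CAssign 1 (ECdr (EVar 1))))) s1 (?I (Suc j)) 22"
      using I
      by (intro runs_mono[OF runs_assign_seq[OF runs_assign_seq[OF runs_assign[where Q = "?I (Suc j)"]]]]) auto
  qed auto
  then show ?thesis by (rule runs_mono) auto
qed

lemma copy_clause_gadget_cost:
  "expr_cost (emit (\<lambda>i. if i < 3 then add_const i (EVar 2) else EVar (i + 2)) clause_gadget (EVar 3)) \<le> 50"
  by (simp add: emit_def clause_gadget_def)

lemma runs_clause_loop:
  assumes inst: "(n, cs) \<in> sat3_instances"
    and s: "s 1 = enc_list (enc_prod (enc_prod enc_nat enc_bool) (enc_prod (enc_prod enc_nat enc_bool) (enc_prod enc_nat enc_bool))) cs"
      "s 2 = enc_nat (2 * n)" "s 3 = enc_edges (vc_edges (n, []))" "s 4 = enc_nat n" "\<forall>i > 8. s i = NIL"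
  shows "runs clause_loop s
    (\<lambda>s'. s' 2 = enc_nat (vc_size (n, cs)) \<and> s' 3 = enc_edges (vc_edges (n, cs)) \<and>
       s' 4 = enc_nat (vc_budget (n, cs)) \<and> (\<forall>i > 8. s' i = NIL))
    (length cs * (200 * (n + 1)) + 2)"
proof -
  let ?enc = "enc_prod (enc_prod enc_nat enc_bool) (enc_prod (enc_prod enc_nat enc_bool) (enc_prod enc_nat enc_bool))"
  let ?c = "\<lambda>j. copy_edges (clause_vertex (2 * n + 3 * j) (cs ! j)) clause_gadget"
  let ?I = "\<lambda>j (s' :: store). s' 1 = enc_list ?enc (drop j cs) \<and> s' 2 = enc_nat (2 * n + 3 * j) \<and>
     s' 3 = enc_edges (concat (map ?c (rev [0..<j])) @ vc_edges (n, [])) \<and>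
     s' 4 = enc_nat (n + 2 * j) \<and> (\<forall>i > 8. s' i = NIL)"
  let ?emit = "emit (\<lambda>i. if i < 3 then add_const i (EVar 2) else EVar (i + 2)) clause_gadget (EVar 3)"
  \<comment> \<open>Each of the three literals costs \<open>20 * (n + 1)\<close> up to a constant,
    all other work of a round is constant.\<close>
  have "runs clause_loop s (?I (length cs))
      (length cs * (1 + expr_cost (EVar 1) + (60 * (n + 1) + 110)) + (1 + expr_cost (EVar 1)))"
    unfolding clause_loop_def
  proof (rule runs_while[of ?I])
    show "?I 0 s" using s by simp
  next
    fix j s1 assume j: "j < length cs" and I: "?I j s1"
    obtain l0 l1 l2 where cl: "cs ! j = (l0, l1, l2)" by (cases "cs ! j") auto
    then have l: "fst l0 \<le> n" "fst l1 \<le> n" "fst l2 \<le> n"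
      using inst j nth_mem[OF j] by (fastforce simp: sat3_instances_def)+
    have car1: "car (s1 1) = ?enc (l0, l1, l2)" and cdr1: "cdr (s1 1) = enc_list ?enc (drop (Suc j) cs)"
      using I enc_list_drop[OF j, of ?enc] cl by simp_all
    show "runs (CSeq (lit_prog (ECar (ECar (EVar 1))) 5)
     (CSeq (lit_prog (ECar (ECdr (ECar (EVar 1)))) 6)
     (CSeq (lit_prog (ECdr (ECdr (ECar (EVar 1)))) 7)
     (CSeq (CAssign 3 ?emit)
     (CSeq (CAssign 2 (add_const 3 (EVar 2)))
     (CSeq (CAssign 4 (add_const 2 (EVar 4)))
           (CAssign 1 (ECdr (EVar 1)))))))))
      s1 (?I (Suc j)) (60 * (n + 1) + 110)"
    \<comment> \<open>The sum is bracketed in the way in which the rules for sequences and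
      assignments produce it.\<close>
    proof (rule runs_mono[where \<tau> = "(2 * 3 + 20 * (n + 1)) + ((2 * 4 + 20 * (n + 1)) +
        ((2 * 4 + 20 * (n + 1)) + ((1 + expr_cost ?emit) + ((1 + expr_cost (add_const 3 (EVar 2))) +
        ((1 + expr_cost (add_const 2 (EVar 4))) + (1 + expr_cost (ECdr (EVar 1))))))))"],
        rule runs_seq, rule runs_mono[OF runs_lit_prog[where l = l0 and n = n]])
      fix s2 assume s2: "s2 5 = enc_nat (lit_vertex l0) \<and> (\<forall>i. i \<noteq> 5 \<longrightarrow> i \<noteq> 8 \<longrightarrow> s2 i = s1 i)"
      show "runs (CSeq (lit_prog (ECar (ECdr (ECar (EVar 1)))) 6)
           (CSeq (lit_prog (ECdr (ECdr (ECar (EVar 1)))) 7)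
           (CSeq (CAssign 3 ?emit)
           (CSeq (CAssign 2 (add_const 3 (EVar 2)))
           (CSeq (CAssign 4 (add_const 2 (EVar 4)))
             (CAssign 1 (ECdr (EVar 1)))))))) s2 (?I (Suc j))
         ((2 * 4 + 20 * (n + 1)) + ((2 * 4 + 20 * (n + 1)) + ((1 + expr_cost ?emit) +
          ((1 + expr_cost (add_const 3 (EVar 2))) + ((1 + expr_cost (add_const 2 (EVar 4))) +
          (1 + expr_cost (ECdr (EVar 1))))))))"
      proof (rule runs_seq, rule runs_mono[OF runs_lit_prog[where l = l1 and n = n]])
        fix s3 assume s3: "s3 6 = enc_nat (lit_vertex l1) \<and> (\<forall>i. i \<noteq> 6 \<longrightarrow> i \<noteq> 8 \<longrightarrow> s3 i = s2 i)"
        show "runs (CSeq (lit_prog (ECdr (ECdr (ECar (EVar 1)))) 7)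
             (CSeq (CAssign 3 ?emit)
             (CSeq (CAssign 2 (add_const 3 (EVar 2)))
             (CSeq (CAssign 4 (add_const 2 (EVar 4)))
               (CAssign 1 (ECdr (EVar 1))))))) s3 (?I (Suc j))
           ((2 * 4 + 20 * (n + 1)) + ((1 + expr_cost ?emit) +
            ((1 + expr_cost (add_const 3 (EVar 2))) + ((1 + expr_cost (add_const 2 (EVar 4))) +
            (1 + expr_cost (ECdr (EVar 1)))))))"
        proof (rule runs_seq, rule runs_mono[OF runs_lit_prog[where l = l2 and n = n]])
          fix s4 assume s4: "s4 7 = enc_nat (lit_vertex l2) \<and> (\<forall>i. i \<noteq> 7 \<longrightarrow> i \<noteq> 8 \<longrightarrow> s4 i = s3 i)"
          have emit: "expr_val ?emit s4 = enc_edges (?c j @ concat (map ?c (rev [0..<j])) @ vc_edges (n, []))"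
            using s2 s3 s4 I
            by (intro expr_val_emit) (auto simp: clause_gadget_def clause_vertex_def cl)
          have "runs (CSeq (CAssign 3 ?emit)
               (CSeq (CAssign 2 (add_const 3 (EVar 2)))
               (CSeq (CAssign 4 (add_const 2 (EVar 4)))
                 (CAssign 1 (ECdr (EVar 1)))))) s4 (?I (Suc j))
             ((1 + expr_cost ?emit) + ((1 + expr_cost (add_const 3 (EVar 2))) +
             ((1 + expr_cost (add_const 2 (EVar 4))) + (1 + expr_cost (ECdr (EVar 1))))))"
            by (rule runs_assign_seq runs_assign)+ (use s2 s3 s4 I emit cdr1 in \<open>simp add: ac_simps\<close>)
          then show "runs (CSeq (CAssign 3 ?emit)
               (CSeq (CAssign 2 (add_const 3 (EVar 2)))
               (CSeq (CAssign 4 (add_const 2 (EVar 4)))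
                 (CAssign 1 (ECdr (EVar 1)))))) s4 (?I (Suc j))
             ((1 + expr_cost ?emit) + ((1 + expr_cost (add_const 3 (EVar 2))) +
             ((1 + expr_cost (add_const 2 (EVar 4))) + (1 + expr_cost (ECdr (EVar 1))))))" .
        qed (use s2 s3 l car1 in \<open>auto simp: enc_prod_def\<close>)
      qed (use s2 l car1 in \<open>auto simp: enc_prod_def\<close>)
    qed (use l car1 copy_clause_gadget_cost in \<open>auto simp: enc_prod_def\<close>)
  qed auto
  then show ?thesis
    by (rule runs_mono) (auto simp: vc_size_def vc_edges_def vc_budget_def)
qed

text \<open>Bounds one round of \<open>block_loop\<close> including its test. It depends on the
  pattern only, so it is a constant of the reduction; likewise \<open>core_time\<close>.\<close>

definition block_time :: "nat \<Rightarrow> (nat \<times> nat) list \<Rightarrow> nat" where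
  "block_time nb LB = expr_cost (emit (\<lambda>i. if i = 0 then ECar (ECar (EVar 1)) else
     if i = 1 then ECdr (ECar (EVar 1)) else add_const (i - 2) (EVar 5)) LB (EVar 6)) + 2 * nb + 10"

definition core_time :: "nat \<Rightarrow> (nat \<times> nat) list \<Rightarrow> nat" where
  "core_time na LA = expr_cost (emit (\<lambda>i. if i = 0 then EVar 7 else add_const (i - 1) (EVar 5)) LA (EVar 6)) +
     2 * na + 20"

lemma runs_block_loop:
  assumes s: "s 1 = enc_edges es" "s 5 = enc_nat N" "s 6 = NIL" "\<forall>i > 8. s i = NIL"
  shows "runs (block_loop nb LB) s
    (\<lambda>s'. s' 5 = enc_nat (N + length es * (nb - 2)) \<and>
       s' 6 = enc_edges (concat (map (\<lambda>j. copy_edges (block_vertex (es ! j) (N + j * (nb - 2))) LB)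
         (rev [0..<length es]))) \<and> s' 2 = s 2 \<and> s' 4 = s 4 \<and> (\<forall>i > 8. s' i = NIL))
    (length es * block_time nb LB + 2)"
proof -
  let ?c = "\<lambda>j. copy_edges (block_vertex (es ! j) (N + j * (nb - 2))) LB"
  let ?f = "\<lambda>i. if i = 0 then ECar (ECar (EVar 1)) else
         if i = 1 then ECdr (ECar (EVar 1)) else add_const (i - 2) (EVar 5)"
  let ?I = "\<lambda>j (s' :: store). s' 1 = enc_edges (drop j es) \<and> s' 5 = enc_nat (N + j * (nb - 2)) \<and>
     s' 6 = enc_edges (concat (map ?c (rev [0..<j]))) \<and> s' 2 = s 2 \<and> s' 4 = s 4 \<and> (\<forall>i > 8. s' i = NIL)"
  have "runs (block_loop nb LB) s (?I (length es))
      (length es * (1 + expr_cost (EVar 1) + ((1 + expr_cost (emit ?f LB (EVar 6))) +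
        ((1 + expr_cost (add_const (nb - 2) (EVar 5))) + (1 + expr_cost (ECdr (EVar 1)))))) + (1 + expr_cost (EVar 1)))"
    unfolding block_loop_def
  proof (rule runs_while[of ?I])
    show "?I 0 s" using s by simp
  next
    fix j s1 assume j: "j < length es" and I: "?I j s1"
    have car1: "car (s1 1) = enc_prod enc_nat enc_nat (es ! j)" and
      cdr1: "cdr (s1 1) = enc_edges (drop (Suc j) es)"
      using I enc_list_drop[OF j, of "enc_prod enc_nat enc_nat"] by simp_all
    have emit: "expr_val (emit ?f LB (EVar 6)) s1 = enc_edges (?c j @ concat (map ?c (rev [0..<j])))"
      using I car1 by (intro expr_val_emit) (auto simp: block_vertex_def enc_prod_def)
    show "runs (CSeq (CAssign 6 (emit ?f LB (EVar 6)))
       (CSeq (CAssign 5 (add_const (nb - 2) (EVar 5))) (CAssign 1 (ECdr (EVar 1))))) s1 (?I (Suc j))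
      ((1 + expr_cost (emit ?f LB (EVar 6))) +
        ((1 + expr_cost (add_const (nb - 2) (EVar 5))) + (1 + expr_cost (ECdr (EVar 1)))))"
      by (rule runs_assign_seq runs_assign)+ (use I emit cdr1 in \<open>simp add: ac_simps\<close>)
  qed auto
  then show ?thesis
    by (rule runs_mono) (simp, intro add_mono mult_le_mono2, simp_all add: block_time_def)
qed

lemma runs_core_loop:
  assumes s: "s 1 = enc_nat N" "s 5 = enc_nat M" "s 6 = enc_edges ds" "s 7 = NIL" "\<forall>i > 8. s i = NIL"
  shows "runs (core_loop na LA) s
    (\<lambda>s'. s' 5 = enc_nat (M + N * (na - 1)) \<and>
       s' 6 = enc_edges (concat (map (\<lambda>v. copy_edges (core_vertex v (M + v * (na - 1))) LA)
         (rev [0..<N])) @ ds) \<and> s' 4 = s 4 \<and> (\<forall>i > 8. s' i = NIL))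
    (N * core_time na LA + 2)"
proof -
  let ?c = "\<lambda>v. copy_edges (core_vertex v (M + v * (na - 1))) LA"
  let ?f = "\<lambda>i. if i = 0 then EVar 7 else add_const (i - 1) (EVar 5)"
  let ?I = "\<lambda>j (s' :: store). s' 1 = enc_nat (N - j) \<and> s' 5 = enc_nat (M + j * (na - 1)) \<and>
     s' 6 = enc_edges (concat (map ?c (rev [0..<j])) @ ds) \<and> s' 7 = enc_nat j \<and> s' 4 = s 4 \<and>
     (\<forall>i > 8. s' i = NIL)"
  have "runs (core_loop na LA) s (?I N)
      (N * (1 + expr_cost (EVar 1) + ((1 + expr_cost (emit ?f LA (EVar 6))) +
        ((1 + expr_cost (add_const (na - 1) (EVar 5))) + ((1 + expr_cost (add_const 1 (EVar 7))) +
        (1 + expr_cost (ECdr (EVar 1))))))) + (1 + expr_cost (EVar 1)))"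
    unfolding core_loop_def
  proof (rule runs_while[of ?I])
    show "?I 0 s" using s by simp
  next
    fix j s1 assume j: "j < N" and I: "?I j s1"
    have emit: "expr_val (emit ?f LA (EVar 6)) s1 = enc_edges (?c j @ concat (map ?c (rev [0..<j])) @ ds)"
      using I by (intro expr_val_emit) (auto simp: core_vertex_def)
    have suc: "expr_val (add_const 1 (EVar 7)) s2 = enc_nat (Suc j)" if "s2 7 = enc_nat j" for s2
      using that by (subst expr_val_add_const) auto
    show "runs (CSeq (CAssign 6 (emit ?f LA (EVar 6)))
       (CSeq (CAssign 5 (add_const (na - 1) (EVar 5)))
       (CSeq (CAssign 7 (add_const 1 (EVar 7))) (CAssign 1 (ECdr (EVar 1)))))) s1 (?I (Suc j))
      ((1 + expr_cost (emit ?f LA (EVar 6))) +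
        ((1 + expr_cost (add_const (na - 1) (EVar 5))) + ((1 + expr_cost (add_const 1 (EVar 7))) +
        (1 + expr_cost (ECdr (EVar 1))))))"
      by (rule runs_assign_seq runs_assign)+ (use I emit suc in \<open>simp add: ac_simps\<close>)
  qed auto
  then show ?thesis
    by (rule runs_mono) (simp, intro add_mono mult_le_mono2, simp_all add: core_time_def)
qed

lemma runs_finish:
  assumes "s 5 = enc_nat N" "s 6 = enc_edges es" "s 4 = enc_nat k" "\<forall>i > 8. s i = NIL"
  shows "runs finish s (\<lambda>s'. s' = (\<lambda>_. NIL)(0 := enc_deletion (N, es, k))) 22"
proof -
  have final: "s(0 := CONS (s 5) (CONS (s 6) (s 4)), 1 := NIL, 2 := NIL, 3 := NIL, 4 := NIL,
      5 := NIL, 6 := NIL, 7 := NIL, 8 := NIL) = (\<lambda>_. NIL)(0 := enc_deletion (N, es, k))"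
    (is "?s = _")
  proof
    fix i
    show "?s i = ((\<lambda>_. NIL)(0 := enc_deletion (N, es, k))) i"
    proof (cases "i > 8")
      case False
      then have "i = 0 \<or> i = 1 \<or> i = 2 \<or> i = 3 \<or> i = 4 \<or> i = 5 \<or> i = 6 \<or> i = 7 \<or> i = 8"
        by linarith
      with assms show ?thesis by (auto simp: enc_deletion_def)
    qed (use assms in simp)
  qed
  have "runs finish s (\<lambda>s'. s' = (\<lambda>_. NIL)(0 := enc_deletion (N, es, k)))
    ((1 + expr_cost (ECons (EVar 5) (ECons (EVar 6) (EVar 4)))) +
     ((1 + expr_cost ENil) + ((1 + expr_cost ENil) + ((1 + expr_cost ENil) + ((1 + expr_cost ENil) +
     ((1 + expr_cost ENil) + ((1 + expr_cost ENil) + ((1 + expr_cost ENil) + (1 + expr_cost ENil)))))))))"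
    unfolding finish_def
    by (rule runs_assign_seq runs_assign)+ (use final in simp)
  then show ?thesis by (rule runs_mono) auto
qed

lemma runs_build:
  assumes s: "s 3 = enc_edges es" "s 2 = enc_nat N" "s 4 = enc_nat k" "\<forall>i > 8. s i = NIL"
  shows "runs (build na nb LA LB) s (\<lambda>s'. s' = (\<lambda>_. NIL)(0 := enc_deletion
      (gadget_size na nb N (length es), gadget_edges na nb LA LB N es, k)))
    (length es * block_time nb LB + N * core_time na LA + 50)"
proof -
  have "runs (build na nb LA LB) s (\<lambda>s'. s' = (\<lambda>_. NIL)(0 := enc_deletion
      (gadget_size na nb N (length es), gadget_edges na nb LA LB N es, k)))
    ((1 + expr_cost (EVar 3)) + ((1 + expr_cost (EVar 2)) + ((1 + expr_cost ENil) +
     ((length es * block_time nb LB + 2) + ((1 + expr_cost (EVar 2)) + ((1 + expr_cost ENil) +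
     ((N * core_time na LA + 2) + 22)))))))" (is "runs _ _ ?Q _")
    unfolding build_def
  proof (rule runs_assign_seq, rule runs_assign_seq, rule runs_assign_seq, rule runs_seq,
      rule runs_mono[OF runs_block_loop[where es = es and N = N]])
    fix s1 :: store
    assume s1: "s1 5 = enc_nat (N + length es * (nb - 2)) \<and>
       s1 6 = enc_edges (concat (map (\<lambda>j. copy_edges (block_vertex (es ! j) (N + j * (nb - 2))) LB)
         (rev [0..<length es]))) \<and>
       s1 2 = (s(1 := expr_val (EVar 3) s, 5 := expr_val (EVar 2) (s(1 := expr_val (EVar 3) s)),
         6 := expr_val ENil (s(1 := expr_val (EVar 3) s, 5 := expr_val (EVar 2) (s(1 := expr_val (EVar 3) s))))))
         2 \<and>
       s1 4 = (s(1 := expr_val (EVar 3) s, 5 := expr_val (EVar 2) (s(1 := expr_val (EVar 3) s)),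
         6 := expr_val ENil (s(1 := expr_val (EVar 3) s, 5 := expr_val (EVar 2) (s(1 := expr_val (EVar 3) s))))))
         4 \<and> (\<forall>i > 8. s1 i = NIL)"
    then have s1': "s1 2 = enc_nat N" "s1 4 = enc_nat k" using s by simp_all
    show "runs (CSeq (CAssign 1 (EVar 2)) (CSeq (CAssign 7 ENil) (CSeq (core_loop na LA) finish))) s1 ?Q
      ((1 + expr_cost (EVar 2)) + ((1 + expr_cost ENil) + ((N * core_time na LA + 2) + 22)))"
    proof (rule runs_assign_seq, rule runs_assign_seq, rule runs_seq,
        rule runs_mono[OF runs_core_loop[where N = N and M = "N + length es * (nb - 2)" and
          ds = "concat (map (\<lambda>j. copy_edges (block_vertex (es ! j) (N + j * (nb - 2))) LB) (rev [0..<length es]))"]],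
        goal_cases)
      case (6 s2)
      then show ?case
        unfolding gadget_size_def gadget_edges_def by (intro runs_finish) (use s1' in auto)
    qed (use s1 s1' in auto)
  qed (use s in auto)
  then show ?thesis by (rule runs_mono) auto
qed

lemma length_concat_map_const:
  "(\<And>x. x \<in> set xs \<Longrightarrow> length (f x) = c) \<Longrightarrow> length (concat (map f xs)) = length xs * c"
  by (induction xs) auto

lemma length_vc_edges: "length (vc_edges (n, cs)) = n + 6 * length cs"
  by (simp add: vc_edges_def length_concat_map_const copy_edges_def clause_gadget_def)

text \<open>With \<open>X = (n + 1) * (length cs + 1)\<close>, the vertex cover instance has at most
  \<open>6 * X\<close> edges and \<open>3 * X\<close> vertices; 400 absorbs the loops over variables
  and clauses.\<close>

definition reduction_time :: "nat \<Rightarrow> nat \<Rightarrow> (nat \<times> nat) list \<Rightarrow> (nat \<times> nat) list \<Rightarrow> nat" where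
  "reduction_time na nb LA LB = 400 + 6 * block_time nb LB + 3 * core_time na LA"

text \<open>The product of \<open>n\<close> and the number of clauses comes from the unary literals,
  each of which may take about \<open>n\<close> steps to convert.\<close>

lemma runs_reduction_prog:
  assumes inst: "(n, cs) \<in> sat3_instances"
  shows "runs (reduction_prog na nb LA LB) ((\<lambda>_. NIL)(0 := enc_sat3 (n, cs)))
    (\<lambda>s'. s' = (\<lambda>_. NIL)(0 := enc_deletion (reduce na nb LA LB (n, cs))))
    (reduction_time na nb LA LB * ((n + 1) * (length cs + 1)))"
proof -
  let ?s = "(\<lambda>_. NIL)(0 := enc_sat3 (n, cs))"
  let ?Q = "\<lambda>s'. s' = (\<lambda>_. NIL)(0 := enc_deletion (reduce na nb LA LB (n, cs)))"
  let ?enc = "enc_prod (enc_prod enc_nat enc_bool) (enc_prod (enc_prod enc_nat enc_bool) (enc_prod enc_nat enc_bool))"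
  have in0: "enc_sat3 (n, cs) = CONS (enc_nat n) (enc_list ?enc cs)"
    by (simp add: enc_sat3_def Let_def enc_prod_def)
  let ?tb = "length (vc_edges (n, cs)) * block_time nb LB + vc_size (n, cs) * core_time na LA + 50"
  have "runs (reduction_prog na nb LA LB) ?s ?Q
    ((1 + expr_cost (ECar (EVar 0))) + ((n * 50 + 2) + ((1 + expr_cost (ECar (EVar 0))) +
      ((1 + expr_cost (ECdr (EVar 0))) + ((length cs * (200 * (n + 1)) + 2) + ?tb)))))"
    unfolding reduction_prog_def
  proof (rule runs_assign_seq, rule runs_seq, rule runs_mono[OF runs_var_loop[where n = n]], goal_cases)
    case (6 s1)
    then have s1: "s1 0 = CONS (enc_nat n) (enc_list ?enc cs)" by (simp add: in0)
    show ?case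
    proof (rule runs_assign_seq, rule runs_assign_seq, rule runs_seq,
        rule runs_mono[OF runs_clause_loop[OF inst]], goal_cases)
      case (6 s2)
      then show ?case unfolding reduce_def by (intro runs_build) auto
    qed (use s1 6 in auto)
  qed (auto simp: in0)
  note run = this
  have "(1 + expr_cost (ECar (EVar 0))) + ((n * 50 + 2) + ((1 + expr_cost (ECar (EVar 0))) +
      ((1 + expr_cost (ECdr (EVar 0))) + ((length cs * (200 * (n + 1)) + 2) + ?tb))))
    \<le> reduction_time na nb LA LB * ((n + 1) * (length cs + 1))"
  proof -
    let ?X = "(n + 1) * (length cs + 1)"
    have X: "?X = n * length cs + n + length cs + 1" by (simp add: algebra_simps)
    have "(n + 6 * length cs) * block_time nb LB \<le> (6 * ?X) * block_time nb LB"
      by (rule mult_le_mono1) (simp add: X)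
    moreover have "(2 * n + 3 * length cs) * core_time na LA \<le> (3 * ?X) * core_time na LA"
      by (rule mult_le_mono1) (simp add: X)
    moreover have "9 + (n * 50 + 2) + (length cs * (200 * (n + 1)) + 2) + 50 \<le> 400 * ?X"
      by (simp add: X algebra_simps)
    ultimately show ?thesis
      unfolding reduction_time_def length_vc_edges vc_size_def by (simp add: add_mult_distrib mult.assoc mult.commute[of "block_time nb LB"] mult.commute[of "core_time na LA"])
  qed
  from run show ?thesis by (rule runs_mono) (simp, fact)
qed


section \<open>3-SAT and vertex cover\<close>

lemma set_clause_copy:
  "set (copy_edges (clause_vertex c cl) clause_gadget) =
    {(c, c + 1), (c, c + 2), (c + 1, c + 2)} \<union> (\<lambda>t. (lit_vertex (clause_lit cl t), c + t)) ` {..<3}"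
proof -
  have "{..<3 :: nat} = {0, 1, 2}" by auto
  then show ?thesis by (simp add: copy_edges_def clause_gadget_def clause_vertex_def insert_commute)
qed

lemma set_vc_edges:
  "set (vc_edges (n, cs)) = (\<lambda>i. (2 * i, 2 * i + 1)) ` {..<n} \<union>
     (\<Union>j < length cs. set (copy_edges (clause_vertex (2 * n + 3 * j) (cs ! j)) clause_gadget))"
  by (auto simp: vc_edges_def copy_edges_def)

lemma clause_lit_vertex_less:
  assumes "(n, cs) \<in> sat3_instances" and "j < length cs"
  shows "lit_vertex (clause_lit (cs ! j) t) < 2 * n"
proof -
  obtain u a v b w c where cl: "cs ! j = ((u, a), (v, b), (w, c))" by (metis surj_pair)
  have "\<forall>((u, _), (v, _), (w, _)) \<in> set cs. u < n \<and> v < n \<and> w < n"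
    using assms(1) by (simp add: sat3_instances_def)
  then have "u < n \<and> v < n \<and> w < n"
    using nth_mem[OF assms(2)] unfolding cl by fast
  then show ?thesis by (auto simp: cl lit_vertex_def)
qed

lemma vc_edges_ordered:
  assumes "(n, cs) \<in> sat3_instances" and "(u, v) \<in> set (vc_edges (n, cs))"
  shows "u < v \<and> v < vc_size (n, cs)"
  using assms(2) clause_lit_vertex_less[OF assms(1)]
  unfolding set_vc_edges set_clause_copy vc_size_def
  by (fastforce intro: trans_less_add1)

lemma distinct_concat_map:
  assumes "distinct xs" and "\<And>x. x \<in> set xs \<Longrightarrow> distinct (f x)"
    and "\<And>x y. x \<in> set xs \<Longrightarrow> y \<in> set xs \<Longrightarrow> x \<noteq> y \<Longrightarrow> set (f x) \<inter> set (f y) = {}"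
  shows "distinct (concat (map f xs))"
  using assms
proof (induction xs)
  case (Cons x xs)
  have "distinct (concat (map f xs))"
    using Cons.prems by (intro Cons.IH) auto
  moreover have "set (f x) \<inter> set (f y) = {}" if "y \<in> set xs" for y
    using Cons.prems(1) that by (intro Cons.prems(3)) auto
  ultimately show ?case using Cons.prems(2) by auto
qed simp

lemma distinct_vc_edges:
  assumes inst: "(n, cs) \<in> sat3_instances"
  shows "distinct (vc_edges (n, cs))"
proof -
  let ?c = "\<lambda>j. copy_edges (clause_vertex (2 * n + 3 * j) (cs ! j)) clause_gadget"
  let ?v = "\<lambda>i. copy_edges ((+) (2 * i)) [(0, 1)]"
  \<comment> \<open>The second end of an edge identifies its copy: it is a corner of triangle
    \<open>j\<close> for clause \<open>j\<close>, and below \<open>2 * n\<close> for a variable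
    edge.\<close>
  have snd_c: "2 * n \<le> v \<and> (v - 2 * n) div 3 = j" if "(u, v) \<in> set (?c j)" for u v j
  proof -
    from that obtain t where "v = 2 * n + 3 * j + t" "t < 3" unfolding set_clause_copy by auto
    then show ?thesis by simp
  qed
  have "distinct (concat (map ?c (rev [0..<length cs])))"
  proof (rule distinct_concat_map)
    fix j assume "j \<in> set (rev [0..<length cs])"
    then have "lit_vertex (clause_lit (cs ! j) t) < 2 * n" for t
      using clause_lit_vertex_less[OF inst] by simp
    from this[of 0] this[of 1] this[of 2] show "distinct (?c j)"
      by (auto simp: copy_edges_def clause_gadget_def clause_vertex_def)
  next
    fix j j' :: nat assume "j \<noteq> j'"
    then show "set (?c j) \<inter> set (?c j') = {}"
      using snd_c by (fast dest: snd_c)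
  qed simp
  moreover have "distinct (concat (map ?v (rev [0..<n])))"
    by (rule distinct_concat_map) (auto simp: copy_edges_def)
  moreover have "set (concat (map ?c (rev [0..<length cs]))) \<inter> set (concat (map ?v (rev [0..<n]))) = {}"
  proof -
    have "v < 2 * n" if "i < n" "(u, v) \<in> set (?v i)" for i u v
      using that by (auto simp: copy_edges_def)
    with snd_c show ?thesis by (fastforce dest: leD)
  qed
  ultimately show ?thesis by (simp add: vc_edges_def)
qed

section \<open>Covers within the budget and satisfying assignments\<close>

lemma vertex_cover_vc_edges:
  "vertex_cover (set (vc_edges (n, cs))) C \<longleftrightarrow>
     (\<forall>i < n. 2 * i \<in> C \<or> 2 * i + 1 \<in> C) \<and>
     (\<forall>j < length cs. let c = 2 * n + 3 * j in
       (c \<in> C \<or> c + 1 \<in> C) \<and> (c \<in> C \<or> c + 2 \<in> C) \<and> (c + 1 \<in> C \<or> c + 2 \<in> C) \<and>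
       (\<forall>t < 3. lit_vertex (clause_lit (cs ! j) t) \<in> C \<or> c + t \<in> C))"
  unfolding vertex_cover_def set_vc_edges set_clause_copy Let_def by (simp add: ball_Un) blast

lemma satisfiable_iff_clause_lit:
  "satisfiable (n, cs) \<longleftrightarrow>
     (\<exists>\<alpha>. \<forall>j < length cs. \<exists>t < 3. \<alpha> (fst (clause_lit (cs ! j) t)) = snd (clause_lit (cs ! j) t))"
proof -
  have "(\<lambda>((u, a), (v, b), (w, c)). \<alpha> u = a \<or> \<alpha> v = b \<or> \<alpha> w = c) cl \<longleftrightarrow>
    (\<exists>t < 3. \<alpha> (fst (clause_lit cl t)) = snd (clause_lit cl t))" for cl and \<alpha> :: "nat \<Rightarrow> bool"
  proof -
    obtain u a v b w c where cl: "cl = ((u, a), (v, b), (w, c))" by (metis surj_pair)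
    have "(\<exists>t < 3. P t) \<longleftrightarrow> P 0 \<or> P 1 \<or> P (2 :: nat)" for P
      by (auto simp: numeral_3_eq_3 less_Suc_eq numeral_2_eq_2)
    then show ?thesis by (simp add: cl)
  qed
  then show ?thesis by (simp only: satisfiable_def prod.case all_set_conv_all_nth)
qed

text \<open>Take the true literals and, in each triangle, every corner except one whose literal is
  true; the edge from that corner to its literal is covered from outside the triangle.\<close>

lemma satisfiable_imp_cover:
  assumes inst: "(n, cs) \<in> sat3_instances" and "satisfiable (n, cs)"
  shows "\<exists>C \<subseteq> {..<vc_size (n, cs)}. card C \<le> vc_budget (n, cs) \<and> vertex_cover (set (vc_edges (n, cs))) C"
proof -
  obtain \<alpha> where "\<forall>j < length cs. \<exists>t < 3. \<alpha> (fst (clause_lit (cs ! j) t)) = snd (clause_lit (cs ! j) t)"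
    using assms(2) satisfiable_iff_clause_lit by blast
  then obtain t where t: "\<And>j. j < length cs \<Longrightarrow>
      t j < 3 \<and> \<alpha> (fst (clause_lit (cs ! j) (t j))) = snd (clause_lit (cs ! j) (t j))"
    by metis
  define L where "L = (\<lambda>i. 2 * i + (if \<alpha> i then 0 else 1)) ` {..<n}"
  define T where "T j = (+) (2 * n + 3 * j) ` ({..<3} - {t j})" for j
  let ?C = "L \<union> (\<Union>j < length cs. T j)"
  have "card L \<le> n" unfolding L_def using card_image_le[of "{..<n}"] by simp
  moreover have "card (\<Union>j < length cs. T j) \<le> (\<Sum>j < length cs. card (T j))"
    by (rule card_UN_le) simp
  moreover have "card (T j) \<le> 2" if "j < length cs" for j
    unfolding T_def using t[OF that] by (intro order_trans[OF card_image_le]) auto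
  then have "(\<Sum>j < length cs. card (T j)) \<le> (\<Sum>j < length cs. 2)" by (intro sum_mono) simp
  ultimately have "card ?C \<le> vc_budget (n, cs)"
    using card_Un_le[of L "\<Union>j < length cs. T j"] by (simp add: vc_budget_def)
  moreover have "?C \<subseteq> {..<vc_size (n, cs)}"
    by (auto simp: L_def T_def vc_size_def)
  moreover have "vertex_cover (set (vc_edges (n, cs))) ?C"
    unfolding vertex_cover_vc_edges Let_def
  proof (intro conjI allI impI)
    fix i assume "i < n"
    then have "2 * i + (if \<alpha> i then 0 else 1) \<in> L" unfolding L_def by blast
    then show "2 * i \<in> ?C \<or> 2 * i + 1 \<in> ?C" by (auto split: if_splits)
  next
    fix j assume j: "j < length cs"
    have in_C: "2 * n + 3 * j + r \<in> ?C" if "r < 3" "r \<noteq> t j" for r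
      using that j by (auto simp: T_def)
    show "2 * n + 3 * j \<in> ?C \<or> 2 * n + 3 * j + 1 \<in> ?C"
      using in_C[of 0] in_C[of 1] by (cases "t j = 0") auto
    show "2 * n + 3 * j \<in> ?C \<or> 2 * n + 3 * j + 2 \<in> ?C"
      using in_C[of 0] in_C[of 2] by (cases "t j = 0") auto
    show "2 * n + 3 * j + 1 \<in> ?C \<or> 2 * n + 3 * j + 2 \<in> ?C"
      using in_C[of 1] in_C[of 2] by (cases "t j = 1") auto
    fix r :: nat assume r: "r < 3"
    show "lit_vertex (clause_lit (cs ! j) r) \<in> ?C \<or> 2 * n + 3 * j + r \<in> ?C"
    proof (cases "r = t j")
      case True
      let ?l = "clause_lit (cs ! j) r"
      have "fst ?l < n" using clause_lit_vertex_less[OF inst j, of r] by (simp add: lit_vertex_def)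
      moreover have "lit_vertex ?l = 2 * fst ?l + (if \<alpha> (fst ?l) then 0 else 1)"
        using t[OF j] True by (simp add: lit_vertex_def)
      ultimately have "lit_vertex ?l \<in> L" unfolding L_def by blast
      then show ?thesis by blast
    qed (use in_C r in blast)
  qed
  ultimately show ?thesis by blast
qed

text \<open>Each variable edge needs one vertex and each triangle two. These bounds add up to the
  budget, so all are attained. Thus exactly one literal of each variable is in \<open>C\<close>,
  which defines the assignment, and each triangle has a corner outside \<open>C\<close>, whose
  literal must then be in \<open>C\<close>.\<close>

lemma cover_imp_satisfiable:
  assumes inst: "(n, cs) \<in> sat3_instances" and C: "C \<subseteq> {..<vc_size (n, cs)}"
    and card: "card C \<le> vc_budget (n, cs)" and cover: "vertex_cover (set (vc_edges (n, cs))) C"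
  shows "satisfiable (n, cs)"
proof -
  define m where "m = length cs"
  \<comment> \<open>For \<open>q < n\<close> this is the edge of variable \<open>q\<close>,
    otherwise the triangle of clause \<open>q - n\<close>; \<open>grp\<close> below recovers
    \<open>q\<close> from a vertex.\<close>
  define G where "G q = (if q < n then {2 * q, 2 * q + 1} else (+) (2 * n + 3 * (q - n)) ` {0, 1, 2})" for q
  define lb :: "nat \<Rightarrow> nat" where "lb q = (if q < n then 1 else 2)" for q
  note cov = cover[unfolded vertex_cover_vc_edges Let_def, folded m_def]
  have finC: "finite C" using C finite_subset by blast
  have finG: "finite (C \<inter> G q)" for q using finC by simp
  define grp where "grp x = (if x < 2 * n then x div 2 else n + (x - 2 * n) div 3)" for x
  have group: "x \<in> G (grp x)" for x
  proof (cases "x < 2 * n")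
    case True
    then show ?thesis by (auto simp: G_def grp_def)
  next
    case False
    have "(x - 2 * n) mod 3 = 0 \<or> (x - 2 * n) mod 3 = 1 \<or> (x - 2 * n) mod 3 = 2" by linarith
    then have "(x - 2 * n) mod 3 \<in> {0, 1, 2}" by blast
    then have "2 * n + 3 * ((x - 2 * n) div 3) + (x - 2 * n) mod 3 \<in>
        (+) (2 * n + 3 * ((x - 2 * n) div 3)) ` {0, 1, 2}" by (rule imageI)
    moreover have "2 * n + 3 * ((x - 2 * n) div 3) + (x - 2 * n) mod 3 = x" using False by simp
    ultimately show ?thesis using False by (simp add: G_def grp_def)
  qed
  have grp_G: "grp x = q" if "x \<in> G q" for x q
    using that by (auto simp: G_def grp_def split: if_splits)
  have grp_less: "grp x < n + m" if "x < 2 * n + 3 * m" for x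
    using that by (auto simp: grp_def)
  have C_eq: "C = (\<Union>q < n + m. C \<inter> G q)"
  proof (intro equalityI subsetI)
    fix x assume x: "x \<in> C"
    then have "x < 2 * n + 3 * m" using C by (auto simp: vc_size_def m_def)
    with x group grp_less show "x \<in> (\<Union>q < n + m. C \<inter> G q)" by blast
  qed blast
  have disj: "(C \<inter> G q) \<inter> (C \<inter> G q') = {}" if "q \<noteq> q'" for q q'
    using that grp_G by blast
  have "card C = card (\<Union>q < n + m. C \<inter> G q)" by (rule arg_cong[OF C_eq])
  also have "\<dots> = (\<Sum>q < n + m. card (C \<inter> G q))"
    by (rule card_UN_disjoint) (use finG disj in auto)
  finally have "card C = (\<Sum>q < n + m. card (C \<inter> G q))" .
  moreover have "(\<Sum>q < n + m. lb q) = n + 2 * m"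
  proof (induction m)
    case 0
    have "(\<Sum>q < n. lb q) = (\<Sum>q < n. 1)" by (rule sum.cong) (auto simp: lb_def)
    then show ?case by simp
  qed (simp add: lb_def)
  ultimately have le: "(\<Sum>q < n + m. card (C \<inter> G q)) \<le> (\<Sum>q < n + m. lb q)"
    using card by (simp add: vc_budget_def m_def)
  have lower: "lb q \<le> card (C \<inter> G q)" if "q < n + m" for q
  proof (cases "q < n")
    case True
    have "C \<inter> G q \<noteq> {}"
      using conjunct1[OF cov, rule_format, OF True] True by (auto simp: G_def)
    with True finG show ?thesis by (simp add: lb_def Suc_le_eq card_gt_0_iff)
  next
    case False
    let ?c = "2 * n + 3 * (q - n)"
    have "q - n < m" using False that by simp
    from conjunct2[OF cov, rule_format, OF this]
    have c: "(?c \<in> C \<or> ?c + 1 \<in> C) \<and> (?c \<in> C \<or> ?c + 2 \<in> C) \<and> (?c + 1 \<in> C \<or> ?c + 2 \<in> C)" by blast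
    have G: "?c \<in> G q" "?c + 1 \<in> G q" "?c + 2 \<in> G q" using False by (simp_all add: G_def)
    consider "{?c, ?c + 1} \<subseteq> C \<inter> G q" | "{?c, ?c + 2} \<subseteq> C \<inter> G q" | "{?c + 1, ?c + 2} \<subseteq> C \<inter> G q"
      using c G by blast
    then have "2 \<le> card (C \<inter> G q)"
      by cases (drule card_mono[OF finG]; simp)+
    with False show ?thesis by (simp add: lb_def)
  qed
  have upper: "card (C \<inter> G q) \<le> lb q" if q: "q < n + m" for q
  proof (rule ccontr)
    assume "\<not> card (C \<inter> G q) \<le> lb q"
    then have "(\<Sum>q < n + m. lb q) < (\<Sum>q < n + m. card (C \<inter> G q))"
      using lower q by (intro sum_strict_mono_ex1) (auto intro!: bexI[of _ q])
    with le show False by simp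
  qed
  define \<alpha> where "\<alpha> i \<longleftrightarrow> 2 * i \<in> C" for i
  \<comment> \<open>If the vertex of a negative literal is in \<open>C\<close>, no room is left for
    that of the positive one.\<close>
  have lit: "\<alpha> (fst l) = snd l" if "lit_vertex l \<in> C" "fst l < n" for l
  proof (cases "snd l")
    case False
    have "\<not> {2 * fst l, 2 * fst l + 1} \<subseteq> C"
    proof
      assume "{2 * fst l, 2 * fst l + 1} \<subseteq> C"
      then have "C \<inter> G (fst l) = {2 * fst l, 2 * fst l + 1}" using that(2) by (auto simp: G_def)
      with upper[of "fst l"] that(2) show False by (simp add: lb_def)
    qed
    with that False show ?thesis by (simp add: \<alpha>_def lit_vertex_def)
  qed (use that in \<open>simp add: \<alpha>_def lit_vertex_def\<close>)
  have "\<exists>t < 3. \<alpha> (fst (clause_lit (cs ! j) t)) = snd (clause_lit (cs ! j) t)" if j: "j < m" for j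
  proof -
    let ?c = "2 * n + 3 * j"
    have "\<not> {?c, ?c + 1, ?c + 2} \<subseteq> C"
    proof
      assume "{?c, ?c + 1, ?c + 2} \<subseteq> C"
      then have "C \<inter> G (n + j) = {?c, ?c + 1, ?c + 2}" by (auto simp: G_def)
      with upper[of "n + j"] j show False by (simp add: lb_def)
    qed
    then have "?c + 0 \<notin> C \<or> ?c + 1 \<notin> C \<or> ?c + 2 \<notin> C" by simp
    then obtain t where t: "t < 3" "?c + t \<notin> C"
      by (elim disjE) (use that[of 0] that[of 1] that[of 2] in auto)
    let ?l = "clause_lit (cs ! j) t"
    have "lit_vertex ?l \<in> C" using cov j t by blast
    moreover have "fst ?l < n"
      using clause_lit_vertex_less[OF inst, of j t] j by (simp add: lit_vertex_def m_def)
    ultimately show ?thesis using lit t(1) by blast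
  qed
  then show ?thesis unfolding satisfiable_iff_clause_lit m_def by blast
qed

text \<open>Clauses are not repeated and there are \<open>2 * n\<close> literals. This is what makes
  the reduction polynomial in \<open>n\<close> alone.\<close>

lemma length_clauses_le:
  assumes "(n, cs) \<in> sat3_instances"
  shows "length cs \<le> (2 * n) ^ 3"
proof -
  let ?L = "{..<n} \<times> (UNIV :: bool set)"
  have "\<forall>((u, _), (v, _), (w, _)) \<in> set cs. u < n \<and> v < n \<and> w < n"
    using assms by (simp add: sat3_instances_def)
  then have "set cs \<subseteq> ?L \<times> ?L \<times> ?L" by fast
  then have "card (set cs) \<le> card (?L \<times> ?L \<times> ?L)"
    by (intro card_mono) auto
  also have "\<dots> = (2 * n) ^ 3" by (simp add: card_cartesian_product power3_eq_cube)
  finally show ?thesis using assms by (simp add: sat3_instances_def distinct_card)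
qed


section \<open>Numbering the vertices of the constructed graph\<close>

lemma mixed_radix_unique:
  fixes c q r q' r' :: nat
  assumes "q * c + r = q' * c + r'" "r < c" "r' < c"
  shows "q = q' \<and> r = r'"
proof -
  have "(q * c + r) div c = q" "(q' * c + r') div c = q'" using assms(2,3) by simp_all
  with assms(1) have "q = q'" by metis
  with assms(1) show ?thesis by simp
qed

lemma mixed_radix_less:
  fixes c q r m :: nat
  assumes "q < m" "r < c"
  shows "q * c + r < m * c"
proof -
  have "q * c + r < Suc q * c" using assms(2) by simp
  also have "\<dots> \<le> m * c" using assms(1) by (intro mult_le_mono1) simp
  finally show ?thesis .
qed

lemma distinct_copy_edges:
  assumes "distinct es" and "inj g"
  shows "distinct (copy_edges g es)"
  using assms unfolding copy_edges_def
  by (auto simp: distinct_map inj_on_def)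

text \<open>Glued vertices get the smallest local numbers. The conditions \<open>nA x < nA y\<close>
  and \<open>nB x < nB y\<close> pick one arc of each edge, in the increasing direction that the
  input format demands.\<close>

locale coded_gadget = gadget "{..<N}" "set es" V E A B a b
  for N :: nat and es :: "(nat \<times> nat) list"
    and V :: "'a set" and E :: "('a \<times> 'a) set" and A B :: "'a set" and a b :: 'a +
  fixes nA nB :: "'a \<Rightarrow> nat" and na nb :: nat and LA LB :: "(nat \<times> nat) list"
  assumes es: "distinct es" "\<And>u v. (u, v) \<in> set es \<Longrightarrow> u < v"
    and nA: "bij_betw nA A {..<na}" "nA a = 0"
    and nB: "bij_betw nB B {..<nb}" "nB a = 0" "nB b = 1"
    and irr: "irrefl E"
    and LA: "distinct LA" "set LA = {(nA x, nA y) | x y. (x, y) \<in> E \<and> x \<in> A \<and> y \<in> A \<and> nA x < nA y}"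
    and LB: "distinct LB" "set LB = {(nB x, nB y) | x y. (x, y) \<in> E \<and> x \<in> B \<and> y \<in> B \<and> nB x < nB y}"
begin

definition idx :: "nat \<times> nat \<Rightarrow> nat" where
  "idx e = (THE j. j < length es \<and> es ! j = e)"

lemma idx_nth: "j < length es \<Longrightarrow> idx (es ! j) = j"
  unfolding idx_def using es(1) by (auto simp: nth_eq_iff_index_eq)

lemma nth_idx:
  assumes "e \<in> set es"
  shows "idx e < length es" "es ! idx e = e"
proof -
  from assms obtain j where "j < length es" "es ! j = e" by (auto simp: in_set_conv_nth)
  with idx_nth[of j] show "idx e < length es" "es ! idx e = e" by auto
qed

abbreviation "M \<equiv> N + length es * (nb - 2)"
abbreviation "core_base v \<equiv> M + v * (na - 1)"
abbreviation "block_base j \<equiv> N + j * (nb - 2)"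

text \<open>The numbering of \<open>gadget_edges\<close> seen from the abstract graph. It is shown
  to be a bijection onto an initial segment, so the output graph is an isomorphic copy of the
  abstract one.\<close>

primrec code :: "(nat, 'a) gadget_vertex \<Rightarrow> nat" where
  "code (Core v x) = core_vertex v (core_base v) (nA x)"
| "code (Blk e x) = block_vertex e (block_base (idx e)) (nB x)"

lemma nA_simps: "x \<in> A \<Longrightarrow> nA x < na" "x \<in> A \<Longrightarrow> nA x = 0 \<longleftrightarrow> x = a"
  "x \<in> A \<Longrightarrow> y \<in> A \<Longrightarrow> nA x = nA y \<longleftrightarrow> x = y"
proof -
  have inj: "nA x = nA y \<longleftrightarrow> x = y" if "x \<in> A" "y \<in> A" for x y
    by (rule inj_on_eq_iff[OF bij_betw_imp_inj_on[OF nA(1)] that])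
  show "nA x < na" if "x \<in> A" using bij_betwE[OF nA(1)] that by blast
  show "nA x = 0 \<longleftrightarrow> x = a" if "x \<in> A" using inj[OF that AB(4)] nA(2) by simp
  show "nA x = nA y \<longleftrightarrow> x = y" if "x \<in> A" "y \<in> A" using inj that by simp
qed

lemma nB_simps: "x \<in> B \<Longrightarrow> nB x < nb" "x \<in> B \<Longrightarrow> nB x = 0 \<longleftrightarrow> x = a" "x \<in> B \<Longrightarrow> nB x = 1 \<longleftrightarrow> x = b"
  "x \<in> B \<Longrightarrow> y \<in> B \<Longrightarrow> nB x = nB y \<longleftrightarrow> x = y"
proof -
  have inj: "nB x = nB y \<longleftrightarrow> x = y" if "x \<in> B" "y \<in> B" for x y
    by (rule inj_on_eq_iff[OF bij_betw_imp_inj_on[OF nB(1)] that])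
  show "nB x < nb" if "x \<in> B" using bij_betwE[OF nB(1)] that by blast
  show "nB x = 0 \<longleftrightarrow> x = a" if "x \<in> B" using inj[OF that AB(5)] nB(2) by simp
  show "nB x = 1 \<longleftrightarrow> x = b" if "x \<in> B" using inj[OF that b(1)] nB(3) by simp
  show "nB x = nB y \<longleftrightarrow> x = y" if "x \<in> B" "y \<in> B" using inj that by simp
qed

lemma code_root [simp]: "code (Core v a) = v"
  by (simp add: core_vertex_def nA)

lemma code_core: "x \<in> A \<Longrightarrow> x \<noteq> a \<Longrightarrow> code (Core v x) = M + (v * (na - 1) + (nA x - 1))"
  using nA_simps(2)[of x] by (simp add: core_vertex_def)

lemma code_block: "x \<in> B \<Longrightarrow> x \<noteq> a \<Longrightarrow> x \<noteq> b \<Longrightarrow> code (Blk e x) = N + (idx e * (nb - 2) + (nB x - 2))"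
  using nB_simps(2,3)[of x] by (simp add: block_vertex_def)

lemma core_digit: "x \<in> A \<Longrightarrow> x \<noteq> a \<Longrightarrow> nA x - 1 < na - 1"
  using nA_simps(1,2)[of x] by linarith

lemma block_digit:
  assumes "x \<in> B" "x \<noteq> a" "x \<noteq> b"
  shows "2 \<le> nB x" "nB x - 2 < nb - 2"
proof -
  show "2 \<le> nB x" using nB_simps(2,3)[of x] assms by linarith
  then show "nB x - 2 < nb - 2" using nB_simps(1)[of x] assms(1) by linarith
qed

lemma code_place:
  assumes "e \<in> set es" "x \<in> B"
  shows "code (place e x) = block_vertex e (block_base (idx e)) (nB x)"
  using nB by (cases e) (auto simp: block_vertex_def core_vertex_def nA(2))

lemma code_block_less:
  assumes "e \<in> set es" "x \<in> B" "x \<noteq> a" "x \<noteq> b"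
  shows "N + (idx e * (nb - 2) + (nB x - 2)) < M"
  using mixed_radix_less[OF nth_idx(1)[OF assms(1)] block_digit(2)[OF assms(2-)]] by simp

lemma GV_cases:
  assumes "p \<in> GV"
  obtains (root) v where "v < N" "p = Core v a" "code p = v"
  | (core) v x where "v < N" "x \<in> A" "x \<noteq> a" "p = Core v x" "code p = M + (v * (na - 1) + (nA x - 1))"
  | (block) e x where "e \<in> set es" "x \<in> B" "x \<noteq> a" "x \<noteq> b" "p = Blk e x"
      "code p = N + (idx e * (nb - 2) + (nB x - 2))" "code p < M"
proof -
  from assms consider v x where "v < N" "x \<in> A" "p = Core v x"
    | e x where "e \<in> set es" "x \<in> B" "x \<noteq> a" "x \<noteq> b" "p = Blk e x"
    unfolding GV_def by blast
  then show thesis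
  proof cases
    case 1
    then show thesis using root core code_core code_root by (cases "x = a") blast+
  next
    case 2
    then show thesis using block code_block[of x e] code_block_less[of e x] by simp
  qed
qed

lemma inj_code: "inj_on code GV"
proof (rule inj_onI)
  fix p q assume p: "p \<in> GV" and q: "q \<in> GV" and eq: "code p = code q"
  from p show "p = q"
  proof (cases rule: GV_cases)
    case root
    from q show ?thesis by (cases rule: GV_cases) (use root eq in auto)
  next
    case (core v x)
    note p' = this
    from q show ?thesis
    proof (cases rule: GV_cases)
      case (core v' x')
      with p' eq have "v * (na - 1) + (nA x - 1) = v' * (na - 1) + (nA x' - 1)" by linarith
      from mixed_radix_unique[OF this core_digit[OF p'(2,3)] core_digit[OF core(2,3)]]
      have "v = v'" "nA x - 1 = nA x' - 1" by auto
      moreover have "nA x \<noteq> 0" "nA x' \<noteq> 0"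
        using nA_simps(2)[OF p'(2)] nA_simps(2)[OF core(2)] p'(3) core(3) by auto
      ultimately have "v = v'" "nA x = nA x'" by linarith+
      with nA_simps(3)[OF p'(2) core(2)] p'(4) core(4) show ?thesis by simp
    qed (use p' eq in linarith)+
  next
    case (block e x)
    note p' = this
    from q show ?thesis
    proof (cases rule: GV_cases)
      case (block e' x')
      with p' eq have *: "idx e * (nb - 2) + (nB x - 2) = idx e' * (nb - 2) + (nB x' - 2)" by linarith
      note d = block_digit[OF p'(2-4)] and d' = block_digit[OF block(2-4)]
      from mixed_radix_unique[OF * d(2) d'(2)] d(1) d'(1)
      have i: "idx e = idx e'" and "nB x = nB x'" by linarith+
      then have "x = x'" using nB_simps(4)[OF p'(2) block(2)] by blast
      moreover have "e = e'" by (rule trans[OF nth_idx(2)[OF p'(1), symmetric]])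
          (subst i, rule nth_idx(2)[OF block(1)])
      ultimately show ?thesis using p'(5) block(5) by blast
    qed (use p' eq in linarith)+
  qed
qed

abbreviation "gsize \<equiv> gadget_size na nb N (length es)"
abbreviation "gedges \<equiv> gadget_edges na nb LA LB N es"

lemma code_GV: "code ` GV = {..<gsize}"
proof (intro equalityI subsetI)
  fix z assume "z \<in> code ` GV"
  then obtain p where "p \<in> GV" "z = code p" by blast
  from this(1) show "z \<in> {..<gsize}"
  proof (cases rule: GV_cases)
    case (core v x)
    with mixed_radix_less[OF core(1) core_digit[OF core(2,3)]] \<open>z = _\<close> show ?thesis
      by (simp add: gadget_size_def)
  qed (use \<open>z = _\<close> in \<open>auto simp: gadget_size_def\<close>)
next
  fix z assume z: "z \<in> {..<gsize}"
  \<comment> \<open>The range of \<open>z\<close> tells the kind of vertex; quotient and remainder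
    then give the copy and the position in it.\<close>
  consider "z < N" | "N \<le> z" "z < M" | "M \<le> z" by linarith
  then show "z \<in> code ` GV"
  proof cases
    case 1
    then have "Core z a \<in> GV" using AB(4) by (simp add: GV_def)
    then show ?thesis by (metis code_root imageI)
  next
    case 2
    then have "z - N < length es * (nb - 2)" by linarith
    define j r where "j = (z - N) div (nb - 2)" and "r = (z - N) mod (nb - 2)"
    have pos: "0 < nb - 2" using \<open>z - N < _\<close> by (cases "nb - 2") auto
    have j: "j < length es" unfolding j_def using \<open>z - N < _\<close> by (rule less_mult_imp_div_less)
    have r: "r + 2 < nb" unfolding r_def using mod_less_divisor[OF pos, of "z - N"] by linarith
    then have "r + 2 \<in> nB ` B" using nB(1) by (simp add: bij_betw_def)
    then obtain x where x: "x \<in> B" "nB x = r + 2" by auto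
    then have "x \<noteq> a" "x \<noteq> b" using nB(2,3) by auto
    with x nth_mem[OF j] have "Blk (es ! j) x \<in> GV" unfolding GV_def by blast
    moreover have "code (Blk (es ! j) x) = N + (j * (nb - 2) + r)"
      using code_block[OF x(1) \<open>x \<noteq> a\<close> \<open>x \<noteq> b\<close>, of "es ! j"] idx_nth[OF j] x(2)
      by (simp only: add_diff_cancel_right')
    then have "code (Blk (es ! j) x) = z"
      using 2 div_mult_mod_eq[of "z - N" "nb - 2"] unfolding j_def r_def by linarith
    ultimately show ?thesis by (rule rev_image_eqI[OF _ sym])
  next
    case 3
    then have "z - M < N * (na - 1)" using z by (simp add: gadget_size_def) 
    define v r where "v = (z - M) div (na - 1)" and "r = (z - M) mod (na - 1)"
    have pos: "0 < na - 1" using \<open>z - M < _\<close> by (cases "na - 1") auto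
    have v: "v < N" unfolding v_def using \<open>z - M < _\<close> by (rule less_mult_imp_div_less)
    have r: "r + 1 < na" unfolding r_def using mod_less_divisor[OF pos, of "z - M"] by linarith
    then have "r + 1 \<in> nA ` A" using nA(1) by (simp add: bij_betw_def)
    then obtain x where x: "x \<in> A" "nA x = r + 1" by auto
    then have "x \<noteq> a" using nA(2) by auto
    with x v have "Core v x \<in> GV" unfolding GV_def by blast
    moreover have "code (Core v x) = M + (v * (na - 1) + r)"
      using code_core[OF x(1) \<open>x \<noteq> a\<close>, of v] x(2) by (simp only: add_diff_cancel_right')
    then have "code (Core v x) = z"
      using 3 div_mult_mod_eq[of "z - M" "na - 1"] unfolding v_def r_def by linarith
    ultimately show ?thesis by (rule rev_image_eqI[OF _ sym])
  qed
qed

section \<open>Edges of the numbered graph\<close>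

lemma set_gedges:
  "set gedges = {(code (Core v x), code (Core v y)) | v x y.
       v < N \<and> (x, y) \<in> E \<and> x \<in> A \<and> y \<in> A \<and> nA x < nA y} \<union>
     {(code (place e x), code (place e y)) | e x y.
       e \<in> set es \<and> (x, y) \<in> E \<and> x \<in> B \<and> y \<in> B \<and> nB x < nB y}" (is "_ = ?L \<union> ?R")
proof -
  have "(\<Union>v < N. set (copy_edges (core_vertex v (core_base v)) LA)) = ?L"
  proof -
    have "set (copy_edges (core_vertex v (core_base v)) LA) =
      {(code (Core v x), code (Core v y)) | x y. (x, y) \<in> E \<and> x \<in> A \<and> y \<in> A \<and> nA x < nA y}" for v
      unfolding copy_edges_def set_map LA(2) by force
    then have "(\<Union>v < N. set (copy_edges (core_vertex v (core_base v)) LA)) =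
      (\<Union>v < N. {(code (Core v x), code (Core v y)) | x y. (x, y) \<in> E \<and> x \<in> A \<and> y \<in> A \<and> nA x < nA y})"
      by (rule SUP_cong[OF refl])
    also have "\<dots> = ?L" by blast
    finally show ?thesis .
  qed
  moreover have "(\<Union>j < length es. set (copy_edges (block_vertex (es ! j) (block_base j)) LB)) =
    (\<Union>e \<in> set es. set (copy_edges (block_vertex e (block_base (idx e))) LB))"
  proof -
    have "(\<Union>e \<in> set es. set (copy_edges (block_vertex e (block_base (idx e))) LB)) =
      (\<Union>j \<in> {..<length es}. set (copy_edges (block_vertex (es ! j) (block_base (idx (es ! j)))) LB))"
    proof -
      have "set es = (!) es ` {..<length es}" by (auto simp: set_conv_nth)
      then show ?thesis by (simp only: image_image)
    qed
    then show ?thesis using idx_nth by simp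
  qed
  moreover have "(\<Union>e \<in> set es. set (copy_edges (block_vertex e (block_base (idx e))) LB)) = ?R"
  proof -
    have "set (copy_edges (block_vertex e (block_base (idx e))) LB) =
      {(code (place e x), code (place e y)) | x y. (x, y) \<in> E \<and> x \<in> B \<and> y \<in> B \<and> nB x < nB y}"
      if e: "e \<in> set es" for e
      unfolding copy_edges_def set_map LB(2) using code_place[OF e] by force
    then have "(\<Union>e \<in> set es. set (copy_edges (block_vertex e (block_base (idx e))) LB)) =
      (\<Union>e \<in> set es. {(code (place e x), code (place e y)) | x y. (x, y) \<in> E \<and> x \<in> B \<and> y \<in> B \<and> nB x < nB y})"
      by (rule SUP_cong[OF refl])
    also have "\<dots> = ?R" by blast
    finally show ?thesis .
  qed
  ultimately show ?thesis
    unfolding gadget_edges_def set_append set_concat set_map set_rev set_upt image_image atLeast0LessThan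
    by simp
qed

text \<open>The ends of an arc have different local numbers, so exactly one of its two directions is
  emitted; the converse restores the other.\<close>

lemma gedges_GE: "set gedges \<union> (set gedges)\<inverse> = map_prod code code ` GE"
proof (intro equalityI subrelI)
  have sub: "(m, k) \<in> map_prod code code ` GE" if "(m, k) \<in> set gedges" for m k
  proof -
    from that[unfolded set_gedges] obtain p q where "(p, q) \<in> GE" "m = code p" "k = code q"
      unfolding GE_def by blast
    then show ?thesis by force
  qed
  fix m k assume "(m, k) \<in> set gedges \<union> (set gedges)\<inverse>"
  then have "(m, k) \<in> map_prod code code ` GE \<or> (k, m) \<in> map_prod code code ` GE" using sub by blast
  then show "(m, k) \<in> map_prod code code ` GE" using sym_GE by (force dest: symD)
next
  fix m k assume "(m, k) \<in> map_prod code code ` GE"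
  then obtain p q where pq: "(p, q) \<in> GE" "m = code p" "k = code q" by auto
  have sE: "(y, x) \<in> E" "x \<noteq> y" if "(x, y) \<in> E" for x y
    using that symE irr by (auto dest: symD simp: irrefl_def)
  from pq(1) consider v x y where "v < N" "x \<in> A" "y \<in> A" "(x, y) \<in> E" "p = Core v x" "q = Core v y"
    | e x y where "e \<in> set es" "x \<in> B" "y \<in> B" "(x, y) \<in> E" "p = place e x" "q = place e y"
    unfolding GE_def by blast
  then show "(m, k) \<in> set gedges \<union> (set gedges)\<inverse>"
  proof cases
    case 1
    then have "nA x < nA y \<or> nA y < nA x" using sE nA_simps(3) by (meson linorder_neqE_nat)
    then have "(code p, code q) \<in> set gedges \<or> (code q, code p) \<in> set gedges"
      unfolding set_gedges using 1 sE(1)[OF 1(4)] by blast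
    then show ?thesis using pq by blast
  next
    case 2
    then have "nB x < nB y \<or> nB y < nB x" using sE nB_simps(4) by (meson linorder_neqE_nat)
    then have "(code p, code q) \<in> set gedges \<or> (code q, code p) \<in> set gedges"
      unfolding set_gedges using 2 sE(1)[OF 2(4)] by blast
    then show ?thesis using pq by blast
  qed
qed

text \<open>Glued vertices come first both in the local and in the global numbering. Hence emitted
  pairs stay increasing and each copy is injective.\<close>

lemma core_vertex_mono: "v < cur \<Longrightarrow> i < j \<Longrightarrow> core_vertex v cur i < core_vertex v cur j"
  by (auto simp: core_vertex_def)

lemma block_vertex_mono:
  "fst e < snd e \<Longrightarrow> snd e < cur \<Longrightarrow> i < j \<Longrightarrow> block_vertex e cur i < block_vertex e cur j"
  by (auto simp: block_vertex_def)

lemma es_bounds: "e \<in> set es \<Longrightarrow> fst e < snd e \<and> snd e < N"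
  using es(2)[of "fst e" "snd e"] E0[of "fst e" "snd e"] by simp

lemma gedges_ordered:
  assumes "(m, k) \<in> set gedges"
  shows "m < k \<and> k < gsize"
proof
  have "(m, k) \<in> map_prod code code ` GE" using assms gedges_GE by blast
  then have "k \<in> code ` GV" using GE_subset by auto
  then show "k < gsize" using code_GV by simp
  from assms[unfolded set_gedges] consider
    v x y where "v < N" "m = code (Core v x)" "k = code (Core v y)" "nA x < nA y"
    | e x y where "e \<in> set es" "x \<in> B" "y \<in> B" "m = code (place e x)" "k = code (place e y)" "nB x < nB y"
    by blast
  then show "m < k"
  proof cases
    case 1
    then show ?thesis by (auto intro!: core_vertex_mono)
  next
    case 2
    then show ?thesis
      using es_bounds[OF 2(1)] by (auto simp: code_place intro!: block_vertex_mono)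
  qed
qed

lemma distinct_gedges: "distinct gedges"
proof -
  let ?cA = "\<lambda>v. copy_edges (core_vertex v (core_base v)) LA"
  let ?cB = "\<lambda>j. copy_edges (block_vertex (es ! j) (block_base j)) LB"
  have LA_range: "i < j \<and> j < na" if "(i, j) \<in> set LA" for i j
    using that nA_simps(1) unfolding LA(2) by auto
  have LB_range: "i < j \<and> j < nb" if "(i, j) \<in> set LB" for i j
    using that nB_simps(1) unfolding LB(2) by auto
  have A_snd: "\<exists>r. k = M + (v * (na - 1) + r) \<and> r < na - 1" if "(m, k) \<in> set (?cA v)" for m k v
  proof -
    from that obtain i j where "(i, j) \<in> set LA" "k = core_vertex v (core_base v) j"
      unfolding copy_edges_def by auto
    with LA_range[of i j] show ?thesis
      by (intro exI[of _ "j - 1"]) (auto simp: core_vertex_def)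
  qed
  \<comment> \<open>A pair of a block ends in a new vertex of that block, unless it joins the images
    of \<open>a\<close> and \<open>b\<close>; then it is the replaced edge itself.\<close>
  have B_snd: "(k < N \<and> (m, k) = es ! l) \<or> (\<exists>r. k = N + (l * (nb - 2) + r) \<and> r < nb - 2)"
    if mk: "(m, k) \<in> set (?cB l)" and l: "l < length es" for m k l
  proof -
    from mk obtain i j where ij: "(i, j) \<in> set LB" "m = block_vertex (es ! l) (block_base l) i"
      "k = block_vertex (es ! l) (block_base l) j"
      unfolding copy_edges_def by auto
    show ?thesis
    proof (cases "j = 1")
      case True
      with ij LB_range[of i j] es_bounds[of "es ! l"] l show ?thesis by (simp add: block_vertex_def)
    next
      case False
      with ij LB_range[of i j] have "k = N + (l * (nb - 2) + (j - 2)) \<and> j - 2 < nb - 2"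
        by (auto simp: block_vertex_def)
      then show ?thesis by blast
    qed
  qed
  have "distinct (concat (map ?cA (rev [0..<N])))"
  proof (rule distinct_concat_map)
    fix v assume "v \<in> set (rev [0..<N])"
    then have "inj (core_vertex v (core_base v))"
      by (intro strict_mono_on_imp_inj_on) (auto simp: strict_mono_on_def intro!: core_vertex_mono)
    with LA(1) show "distinct (?cA v)" by (rule distinct_copy_edges)
  next
    fix v v' :: nat assume ne: "v \<noteq> v'"
    have False if 1: "(m, k) \<in> set (?cA v)" and 2: "(m, k) \<in> set (?cA v')" for m k
    proof -
      from A_snd[OF 1] A_snd[OF 2] obtain r r' where
        "v * (na - 1) + r = v' * (na - 1) + r'" "r < na - 1" "r' < na - 1" by auto
      from mixed_radix_unique[OF this] ne show False by simp
    qed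
    then show "set (?cA v) \<inter> set (?cA v') = {}" by auto
  qed simp
  moreover have "distinct (concat (map ?cB (rev [0..<length es])))"
  proof (rule distinct_concat_map)
    fix j assume "j \<in> set (rev [0..<length es])"
    then have "inj (block_vertex (es ! j) (block_base j))"
      using es_bounds[of "es ! j"]
      by (intro strict_mono_on_imp_inj_on) (auto simp: strict_mono_on_def intro!: block_vertex_mono)
    with LB(1) show "distinct (?cB j)" by (rule distinct_copy_edges)
  next
    fix l l' assume l: "l \<in> set (rev [0..<length es])" "l' \<in> set (rev [0..<length es])" and ne: "l \<noteq> l'"
    have False if 1: "(m, k) \<in> set (?cB l)" and 2: "(m, k) \<in> set (?cB l')" for m k
    proof -
      have l': "l < length es" "l' < length es" using l by auto
      have "es ! l \<noteq> es ! l'" using l' ne es(1) by (simp add: nth_eq_iff_index_eq)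
      with B_snd[OF 1 l'(1)] B_snd[OF 2 l'(2)] obtain r r' where
        "l * (nb - 2) + r = l' * (nb - 2) + r'" "r < nb - 2" "r' < nb - 2" by auto
      from mixed_radix_unique[OF this] ne show False by simp
    qed
    then show "set (?cB l) \<inter> set (?cB l') = {}" by auto
  qed simp
  moreover have "set (concat (map ?cA (rev [0..<N]))) \<inter> set (concat (map ?cB (rev [0..<length es]))) = {}"
  proof -
    have "M \<le> k" if "(m, k) \<in> set (?cA v)" for m k v using A_snd[OF that] by auto
    moreover have "k < M" if "(m, k) \<in> set (?cB l)" "l < length es" for m k l
      using B_snd[OF that] mixed_radix_less[OF that(2)] by auto
    ultimately show ?thesis by (fastforce dest: leD)
  qed
  ultimately show ?thesis by (simp add: gadget_edges_def)
qed

lemma gadget_instance: "(gsize, gedges, k) \<in> deletion_instances"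
proof -
  have "\<forall>(u, v) \<in> set gedges. u < v \<and> v < gsize"
    by (intro ballI, clarify) (rule gedges_ordered)
  with distinct_gedges show ?thesis unfolding deletion_instances_def by blast
qed

lemma input_graph_gadget:
  "graph (input_graph gsize gedges)" "verts (input_graph gsize gedges) = code ` GV"
  "arcs_ends (input_graph gsize gedges) = map_prod code code ` GE"
proof -
  show "graph (input_graph gsize gedges)" by (rule graph_input_graph[OF gadget_instance])
  show "verts (input_graph gsize gedges) = code ` GV" unfolding code_GV by (simp add: input_graph_def)
  have ends: "arcs_ends (input_graph n ds) = set ds \<union> (set ds)\<inverse>" for n ds
    by (simp add: arcs_ends_conv input_graph_def)
  show "arcs_ends (input_graph gsize gedges) = map_prod code code ` GE"
    by (simp only: ends gedges_GE)
qed

end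


section \<open>Treewidth of the constructed graph\<close>

definition star :: "nat \<Rightarrow> (nat, nat \<times> nat) pre_digraph" where
  "star K = input_graph K (map (\<lambda>i. (0, i)) [1..<K])"

lemma star_simps:
  "graph (star K)" "verts (star K) = {..<K}"
  "(u, v) \<in> arcs_ends (star K) \<longleftrightarrow> u < K \<and> v < K \<and> u \<noteq> v \<and> (u = 0 \<or> v = 0)"
proof -
  have "(K, map (\<lambda>i. (0, i)) [1..<K], 0) \<in> deletion_instances"
    by (auto simp: deletion_instances_def distinct_map inj_on_def)
  from graph_input_graph[OF this] show "graph (star K)" by (simp add: star_def)
  show "verts (star K) = {..<K}" by (simp add: star_def input_graph_def)
  have ends: "arcs_ends (input_graph n ds) = set ds \<union> (set ds)\<inverse>" for n ds
    by (simp add: arcs_ends_conv input_graph_def)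
  show "(u, v) \<in> arcs_ends (star K) \<longleftrightarrow> u < K \<and> v < K \<and> u \<noteq> v \<and> (u = 0 \<or> v = 0)"
    unfolding star_def ends by auto
qed

lemma symmetric_star: "symmetric (star K)"
  unfolding symmetric_def by (rule symI) (auto simp: star_simps(3))

lemma undirected_tree_star:
  assumes "0 < K"
  shows "undirected_tree (star K)" "conn (arcs_ends (star K)) {..<K}"
proof -
  show conn: "conn (arcs_ends (star K)) {..<K}"
  proof (rule connI)
    fix A x y assume A: "A \<subseteq> {..<K}" "x \<in> A" "y \<in> {..<K} - A"
    then have xy: "x < K" "y < K" "y \<notin> A" by auto
    show "\<exists>x \<in> A. \<exists>y \<in> {..<K} - A. (x, y) \<in> arcs_ends (star K)"
    proof (cases "0 \<in> A")
      case True
      then have "y \<noteq> 0" using xy(3) by metis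
      then have "(0, y) \<in> arcs_ends (star K)" using xy assms by (simp add: star_simps(3))
      then show ?thesis using True A(3) by (rule_tac bexI[of _ 0], rule_tac bexI[of _ y])
    next
      case False
      then have "x \<noteq> 0" using A(2) by metis
      then have "(x, 0) \<in> arcs_ends (star K)" using xy assms by (simp add: star_simps(3))
      moreover have "0 \<in> {..<K} - A" using False assms by simp
      ultimately show ?thesis using A(2) by (rule_tac bexI[of _ x], rule_tac bexI[of _ 0])
    qed
  next
    show "{..<K} \<noteq> {}" using assms by (simp add: lessThan_empty_iff)
  qed
  have "False" if p: "vpath p (star K)" "3 \<le> length p" and e: "(last p, hd p) \<in> arcs_ends (star K)" for p
  proof -
    obtain x y z r where xyz: "p = x # y # z # r"
      using p(2) by (auto simp: numeral_3_eq_3 Suc_le_length_iff)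
    then have d: "distinct (x # y # z # r)" and a: "(x, y) \<in> arcs_ends (star K)" "(y, z) \<in> arcs_ends (star K)"
      and rest: "set (vwalk_arcs (z # r)) \<subseteq> arcs_ends (star K)"
      using p(1) by (auto simp: vpath_def vwalk_def)
    \<comment> \<open>Of two consecutive arcs of a star the middle vertex is the centre, so a path
      on three vertices can neither be prolonged nor closed.\<close>
    have y: "y = 0" "x \<noteq> 0" "z \<noteq> 0" using a d by (auto simp: star_simps(3))
    show False
    proof (cases r)
      case Nil
      with e xyz y show False by (simp add: star_simps(3))
    next
      case (Cons w r')
      with rest y d show False by (auto simp: star_simps(3))
    qed
  qed
  then show "undirected_tree (star K)"
    using conn star_simps(1) connected_conn[OF symmetric_star] star_simps(2)
    unfolding undirected_tree_def by auto
qed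

text \<open>A star suffices as decomposition tree: \<open>L\<close> goes into all bags, each other class into one.\<close>

lemma treewidth_le:
  fixes G :: "('a, 'b) pre_digraph" and cls :: "'a \<Rightarrow> nat" and K l s :: nat
  assumes ends: "\<And>u v. (u, v) \<in> arcs_ends G \<Longrightarrow> u \<in> verts G \<and> v \<in> verts G"
    and L: "L \<subseteq> verts G" "card L \<le> l" and K: "0 < K"
    and cls: "\<And>v. v \<in> verts G - L \<Longrightarrow> cls v < K"
    and same: "\<And>u v. (u, v) \<in> arcs_ends G \<Longrightarrow> u \<notin> L \<Longrightarrow> v \<notin> L \<Longrightarrow> cls u = cls v"
    and small: "\<And>t. card {v \<in> verts G - L. cls v = t} \<le> s"
  shows "treewidth G \<le> l + s"
proof -
  define X where "X t = L \<union> {v \<in> verts G - L. cls v = t}" for t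
  have "tree_decomposition G (star K) X"
    unfolding tree_decomposition_def
  proof (intro conjI ballI allI impI)
    show "undirected_tree (star K)" using undirected_tree_star K by blast
    show "X t \<subseteq> verts G" for t using L by (auto simp: X_def)
    show "\<exists>t \<in> verts (star K). v \<in> X t" if "v \<in> verts G" for v
      using that cls[of v] K by (cases "v \<in> L") (auto simp: X_def star_simps(2))
    show "\<exists>t \<in> verts (star K). u \<in> X t \<and> v \<in> X t" if uv: "(u, v) \<in> arcs_ends G" for u v
    proof (cases "u \<in> L")
      case True
      then show ?thesis
        using ends[OF uv] cls[of v] K by (cases "v \<in> L") (auto simp: X_def star_simps(2))
    next
      case False
      then show ?thesis
        using ends[OF uv] cls[of u] same[OF uv] by (intro bexI[of _ "cls u"]) (auto simp: X_def star_simps(2))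
    qed
    show "Digraph_Component.connected (star K \<restriction> {t \<in> verts (star K). v \<in> X t})" if "v \<in> verts G" for v
      unfolding connected_induce_conn[OF symmetric_star]
    proof (cases "v \<in> L")
      case True
      then have "{t \<in> verts (star K). v \<in> X t} = {..<K}" by (auto simp: X_def star_simps(2))
      with undirected_tree_star(2)[OF K] show "conn (arcs_ends (star K)) {t \<in> verts (star K). v \<in> X t}" by simp
    next
      case False
      then have "{t \<in> verts (star K). v \<in> X t} = {cls v}"
        using that cls[of v] by (auto simp: X_def star_simps(2))
      then show "conn (arcs_ends (star K)) {t \<in> verts (star K). v \<in> X t}" by (simp add: conn_singleton)
    qed
  qed
  moreover have "card (X t) \<le> (l + s) + 1" for t
    using card_Un_le[of L "{v \<in> verts G - L. cls v = t}"] L(2) small[of t] unfolding X_def by linarith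
  ultimately show ?thesis unfolding treewidth_def by (intro Least_le) blast
qed

context coded_gadget
begin

text \<open>With \<open>L\<close> in every bag, a core follows the group of its vertex and a block
  that of an end outside \<open>L\<close>, if there is one. A group thus collects at most
  \<open>p\<close> cores and \<open>r\<close> blocks, each with at most \<open>card V\<close>
  vertices.\<close>

lemma treewidth_gadget:
  fixes grp :: "nat \<Rightarrow> nat" and l p r K :: nat
  assumes L: "L \<subseteq> {..<N}" "card L \<le> l" and K: "0 < K"
    and grp: "\<And>v. v < N \<Longrightarrow> grp v < K"
    and same: "\<And>u v. (u, v) \<in> set es \<Longrightarrow> u \<notin> L \<Longrightarrow> v \<notin> L \<Longrightarrow> grp u = grp v"
    and p: "\<And>t. card {v. v < N \<and> grp v = t} \<le> p"
    and r: "\<And>t. card {e \<in> set es. (if snd e \<in> L then grp (fst e) else grp (snd e)) = t} \<le> r"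
  shows "treewidth (input_graph gsize gedges) \<le> l + (p + r) * card V"
proof -
  let ?G = "input_graph gsize gedges"
  define egrp where "egrp e = (if snd e \<in> L then grp (fst e) else grp (snd e))" for e
  define cls :: "(nat, 'a) gadget_vertex \<Rightarrow> nat" where
    "cls z = (case z of Core v x \<Rightarrow> grp v | Blk e x \<Rightarrow> egrp e)" for z
  let ?inv = "inv_into GV code"
  have inv: "?inv (code z) = z" if "z \<in> GV" for z using that inj_code by (rule inv_into_f_f[rotated])
  have verts: "verts ?G = code ` GV" and ends: "arcs_ends ?G = map_prod code code ` GE"
    using input_graph_gadget by simp_all
  \<comment> \<open>For an end of \<open>e\<close> outside \<open>L\<close> this holds by the choice
    of \<open>egrp\<close>, or by \<open>same\<close> if both ends are outside.\<close>
  have place_cls: "cls (place e x) = egrp e" if "e \<in> set es" "x \<in> B" "code (place e x) \<notin> L" for e x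
  proof (cases e)
    case (Pair u v)
    with that same[of u v] b(2) show ?thesis
      by (cases "x = a"; cases "x = b") (simp_all add: cls_def egrp_def core_vertex_def nA(2) split: if_splits)
  qed
  show ?thesis
  proof (rule treewidth_le[where L = L and K = K and cls = "\<lambda>z. cls (?inv z)"])
    show "u \<in> verts ?G \<and> v \<in> verts ?G" if "(u, v) \<in> arcs_ends ?G" for u v
      using that GE_subset unfolding verts ends by auto
    have "v \<in> code ` GV" if "v < N" for v
      using that code_GV by (auto simp: gadget_size_def)
    then show "L \<subseteq> verts ?G" using L(1) unfolding verts by blast
    show "cls (?inv z) < K" if "z \<in> verts ?G - L" for z
    proof -
      from that obtain q where q: "q \<in> GV" "z = code q" unfolding verts by blast
      from q(1) show ?thesis
      proof (cases rule: GV_cases)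
        case (block e x)
        then show ?thesis using inv[OF q(1)] q(2) es_bounds[OF block(1)] grp
          by (simp add: cls_def egrp_def)
      qed (use inv[OF q(1)] q(2) grp in \<open>simp_all add: cls_def\<close>)
    qed
    show "cls (?inv u) = cls (?inv v)" if uv: "(u, v) \<in> arcs_ends ?G" "u \<notin> L" "v \<notin> L" for u v
    proof -
      from uv(1) obtain y z where yz: "(y, z) \<in> GE" "u = code y" "v = code z" unfolding ends by auto
      then have "?inv u = y" "?inv v = z" using GE_subset inv by auto
      moreover from yz(1) consider v' x x' where "y = Core v' x" "z = Core v' x'"
        | e x x' where "e \<in> set es" "x \<in> B" "x' \<in> B" "y = place e x" "z = place e x'"
        unfolding GE_def by blast
      then have "cls y = cls z"
      proof cases
        case 1
        then show ?thesis by (simp add: cls_def)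
      next
        case 2
        with place_cls uv(2,3) yz(2,3) show ?thesis by metis
      qed
      ultimately show ?thesis by simp
    qed
    show "card {z \<in> verts ?G - L. cls (?inv z) = t} \<le> (p + r) * card V" for t
    proof -
      let ?v = "{v. v < N \<and> grp v = t}" and ?e = "{e \<in> set es. egrp e = t}"
      let ?W = "(\<lambda>(v, x). Core v x) ` (?v \<times> A) \<union> (\<lambda>(e, x). Blk e x) ` (?e \<times> B)"
      have fin: "finite (?v \<times> A)" "finite (?e \<times> B)" using AB by auto
      have "{z \<in> verts ?G - L. cls (?inv z) = t} \<subseteq> code ` ?W"
      proof
        fix z assume z: "z \<in> {z \<in> verts ?G - L. cls (?inv z) = t}"
        then obtain q where q: "q \<in> GV" "z = code q" unfolding verts by blast
        with z inv have "cls q = t" by simp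
        with q(1) have "q \<in> ?W" unfolding GV_def cls_def by force
        with q(2) show "z \<in> code ` ?W" by blast
      qed
      then have "card {z \<in> verts ?G - L. cls (?inv z) = t} \<le> card ?W"
        using fin by (intro surj_card_le) auto
      also have "\<dots> \<le> card (?v \<times> A) + card (?e \<times> B)"
        using fin by (intro order_trans[OF card_Un_le] add_mono card_image_le)
      also have "\<dots> \<le> p * card V + r * card V"
        unfolding card_cartesian_product
        using p[of t] r[of t] AB finV unfolding egrp_def
        by (intro add_mono mult_mono card_mono) auto
      finally show ?thesis by (simp add: add_mult_distrib)
    qed
  qed (use L K in auto)
qed

end

section \<open>Groups of bounded size in the vertex cover instance\<close>

lemma vc_group_size:
  "card {v. v < vc_size (n, cs) \<and> (if v < 2 * n then v else 2 * n + (v - 2 * n) div 3) = t} \<le> 3"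
proof (cases "t < 2 * n")
  case True
  have "{v. v < vc_size (n, cs) \<and> (if v < 2 * n then v else 2 * n + (v - 2 * n) div 3) = t} \<subseteq> {t}"
    using True by (auto split: if_splits)
  from card_mono[OF _ this] show ?thesis by simp
next
  case False
  let ?c = "2 * n + 3 * (t - 2 * n)"
  have "{v. v < vc_size (n, cs) \<and> (if v < 2 * n then v else 2 * n + (v - 2 * n) div 3) = t} \<subseteq>
      {?c, ?c + 1, ?c + 2}"
  proof
    fix v assume "v \<in> {v. v < vc_size (n, cs) \<and> (if v < 2 * n then v else 2 * n + (v - 2 * n) div 3) = t}"
    then have "2 * n \<le> v" "(v - 2 * n) div 3 = t - 2 * n" using False by (auto split: if_splits)
    moreover have "(v - 2 * n) mod 3 = 0 \<or> (v - 2 * n) mod 3 = 1 \<or> (v - 2 * n) mod 3 = 2" by linarith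
    moreover have "v - 2 * n = 3 * ((v - 2 * n) div 3) + (v - 2 * n) mod 3" by simp
    ultimately show "v \<in> {?c, ?c + 1, ?c + 2}" by auto
  qed
  from card_mono[OF _ this] show ?thesis
    using card_insert_le_m1[of 3] by (simp add: card_insert_if split: if_splits)
qed

text \<open>Every edge of a clause gadget ends at a corner, so its six edges form the group of that
  triangle. A variable edge has both ends in the separator and is counted with its first
  end.\<close>

lemma vc_edge_group_size:
  assumes inst: "(n, cs) \<in> sat3_instances"
  defines "grp \<equiv> \<lambda>v. if v < 2 * n then v else 2 * n + (v - 2 * n) div 3"
  shows "card {e \<in> set (vc_edges (n, cs)).
    (if snd e \<in> {..<2 * n} then grp (fst e) else grp (snd e)) = t} \<le> 6" (is "card ?S \<le> 6")
proof -
  let ?c = "\<lambda>j. copy_edges (clause_vertex (2 * n + 3 * j) (cs ! j)) clause_gadget"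
  have clause: "2 * n \<le> v \<and> (v - 2 * n) div 3 = j" if "(u, v) \<in> set (?c j)" for u v j
  proof -
    from that obtain s where "v = 2 * n + 3 * j + s" "s < 3" unfolding set_clause_copy by auto
    then show ?thesis by simp
  qed
  have cases: "(\<exists>i < n. u = 2 * i \<and> v = 2 * i + 1) \<or> (\<exists>j. (u, v) \<in> set (?c j))"
    if "(u, v) \<in> set (vc_edges (n, cs))" for u v
    using that unfolding set_vc_edges by auto
  show ?thesis
  proof (cases "t < 2 * n")
    case True
    have "?S \<subseteq> {(t, t + 1)}"
    proof
      fix e assume e: "e \<in> ?S"
      obtain u v where uv: "e = (u, v)" by (cases e)
      from e uv cases[of u v] clause[of u v] True show "e \<in> {(t, t + 1)}"
        by (auto simp: grp_def split: if_splits)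
    qed
    from card_mono[OF _ this] show ?thesis by simp
  next
    case False
    have "?S \<subseteq> set (?c (t - 2 * n))"
    proof
      fix e assume e: "e \<in> ?S"
      obtain u v where uv: "e = (u, v)" by (cases e)
      from e uv cases[of u v] consider i where "i < n" "u = 2 * i" "v = 2 * i + 1"
        | j where "(u, v) \<in> set (?c j)" by auto
      then show "e \<in> set (?c (t - 2 * n))"
      proof cases
        case 1
        with e uv False show ?thesis by (auto simp: grp_def)
      next
        case 2
        with clause[OF 2] e uv show ?thesis by (auto simp: grp_def)
      qed
    qed
    then have "card ?S \<le> card (set (?c (t - 2 * n)))" by (intro card_mono) auto
    also have "\<dots> \<le> length (?c (t - 2 * n))" by (rule card_length)
    finally show ?thesis by (simp add: copy_edges_def clause_gadget_def)
  qed
qed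

lemma (in coded_gadget) treewidth_vc_gadget:
  assumes inst: "(n, cs) \<in> sat3_instances" and "N = vc_size (n, cs)" and "es = vc_edges (n, cs)"
  shows "treewidth (input_graph gsize gedges) \<le> 2 * n + 9 * card V"
proof -
  let ?grp = "\<lambda>v. if v < 2 * n then v else 2 * n + (v - 2 * n) div 3"
  have "treewidth (input_graph gsize gedges) \<le> 2 * n + (3 + 6) * card V"
  \<comment> \<open>\<open>N + 1\<close> keeps the number of bags positive when the instance has no
    vertices.\<close>
  proof (rule treewidth_gadget[where L = "{..<2 * n}" and K = "N + 1" and grp = ?grp])
    show "{..<2 * n} \<subseteq> {..<N}" using assms(2) by (auto simp: vc_size_def)
    show "card {v. v < N \<and> ?grp v = t} \<le> 3" for t
      using vc_group_size assms(2) by simp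
    show "card {e \<in> set es. (if snd e \<in> {..<2 * n} then ?grp (fst e) else ?grp (snd e)) = t} \<le> 6" for t
      using vc_edge_group_size[OF inst] assms(3) by simp
    show "?grp v < N + 1" if "v < N" for v
      using that by (auto split: if_splits) 
    show "?grp u = ?grp v" if "(u, v) \<in> set es" "u \<notin> {..<2 * n}" "v \<notin> {..<2 * n}" for u v
    proof -
      have "\<exists>j s s'. u = 2 * n + 3 * j + s \<and> v = 2 * n + 3 * j + s' \<and> s < 3 \<and> s' < 3"
      proof -
        from that(1)[unfolded assms(3) set_vc_edges] that(2) obtain j where j: "j < length cs"
          "(u, v) \<in> set (copy_edges (clause_vertex (2 * n + 3 * j) (cs ! j)) clause_gadget)" by auto
        with that(2) clause_lit_vertex_less[OF inst j(1)] consider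
          "u = 2 * n + 3 * j + 0" "v = 2 * n + 3 * j + 1" | "u = 2 * n + 3 * j + 0" "v = 2 * n + 3 * j + 2"
          | "u = 2 * n + 3 * j + 1" "v = 2 * n + 3 * j + 2"
          unfolding set_clause_copy by auto
        then show ?thesis
        proof cases
          case 1
          then show ?thesis by (intro exI[of _ j] exI[of _ 0] exI[of _ 1]) simp
        next
          case 2
          then show ?thesis by (intro exI[of _ j] exI[of _ 0] exI[of _ 2]) simp
        next
          case 3
          then show ?thesis by (intro exI[of _ j] exI[of _ 1] exI[of _ 2]) simp
        qed
      qed
      then show ?thesis by auto
    qed
  qed auto
  then show ?thesis by simp
qed


section \<open>Choice of the gadget\<close>

abbreviation gmodel :: "('a, 'b) pre_digraph \<Rightarrow> 'c set \<Rightarrow> ('c \<times> 'c) set \<Rightarrow> ('a \<Rightarrow> 'c set) \<Rightarrow> bool" where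
  "gmodel H \<equiv> minor_model (verts H) (arcs_ends H)"

text \<open>Comparing numbers of vertices is enough, since the contradiction arises from a minor
  inside the core, which has fewer vertices than \<open>H\<close>.\<close>

definition minimal_in :: "('a, 'b) pre_digraph set \<Rightarrow> ('a, 'b) pre_digraph \<Rightarrow> bool" where
  "minimal_in F H \<longleftrightarrow> H \<in> F \<and>
     (\<forall>H' \<in> F. (\<exists>\<phi>. gmodel H' (verts H) (arcs_ends H) \<phi>) \<longrightarrow> card (verts H) \<le> card (verts H'))"

lemma connected_collectionD:
  assumes "connected_collection F" and "H \<in> F"
  shows "graph H" "finite (verts H)" "conn (arcs_ends H) (verts H)" "arcs_ends H \<subseteq> verts H \<times> verts H"
    "sym (arcs_ends H)" "irrefl (arcs_ends H)" "verts H \<noteq> {x}"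
proof -
  show g: "graph H" using assms by (auto simp: connected_collection_def)
  interpret graph H by fact
  show "finite (verts H)" by simp
  show sym: "sym (arcs_ends H)" using sym_arcs by (simp add: symmetric_def)
  show sub: "arcs_ends H \<subseteq> verts H \<times> verts H" using adj_in_verts by auto
  show irr: "irrefl (arcs_ends H)" unfolding irrefl_def using adj_not_same by blast
  show "conn (arcs_ends H) (verts H)"
    using assms connected_conn[OF sym_arcs] by (auto simp: connected_collection_def)
  have "arcs_ends H \<noteq> {}" using assms by (auto simp: connected_collection_def arcs_ends_def)
  then obtain u v where "(u, v) \<in> arcs_ends H" by auto
  with sub irr have "u \<in> verts H" "v \<in> verts H" "u \<noteq> v" by (auto simp: irrefl_def)
  then show "verts H \<noteq> {x}" by auto
qed

text \<open>Descent: a member that is not minimal has a smaller one as a minor, and minors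
  compose.\<close>

lemma minimal_minor:
  assumes F: "connected_collection F" and "H \<in> F" and "gmodel H V' E' \<phi>"
  shows "\<exists>H' \<psi>. minimal_in F H' \<and> gmodel H' V' E' \<psi>"
  using assms(2,3)
proof (induction "card (verts H)" arbitrary: H \<phi> rule: less_induct)
  case less
  show ?case
  proof (cases "minimal_in F H")
    case False
    then obtain H' \<psi> where H': "H' \<in> F" "gmodel H' (verts H) (arcs_ends H) \<psi>"
      "card (verts H') < card (verts H)"
      using less.prems(1) unfolding minimal_in_def by (auto simp: not_le)
    from less.hyps[OF H'(3,1) minor_model_trans[OF H'(2) less.prems(2)]]
    show ?thesis using connected_collectionD(4)[OF F H'(1)] by blast
  qed (use less.prems in blast)
qed

text \<open>The minimum ranges over the separations of all minimal members, as the bound on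
  \<open>card B\<close> is later applied to whichever of them might survive.\<close>

lemma smallest_separation:
  assumes F: "connected_collection F"
  obtains H A B a where "minimal_in F H" "separation (verts H) (arcs_ends H) A B a"
    "\<And>H' A' B' a'. minimal_in F H' \<Longrightarrow> separation (verts H') (arcs_ends H') A' B' a' \<Longrightarrow> card B \<le> card B'"
proof -
  let ?P = "\<lambda>(H, A, B, a). minimal_in F H \<and> separation (verts H) (arcs_ends H) A B a"
  obtain H0 where H0: "H0 \<in> F" using F by (auto simp: connected_collection_def)
  have "gmodel H0 (verts H0) (arcs_ends H0) (\<lambda>x. {id x})"
    by (rule minor_model_embedding) auto
  then obtain H where H: "minimal_in F H" using minimal_minor[OF F H0] by blast
  then have HF: "H \<in> F" by (simp add: minimal_in_def)
  obtain a where a: "a \<in> verts H" using conn_ne[OF connected_collectionD(3)[OF F HF]] by blast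
  \<comment> \<open>The trivial separation shows that there is something to minimise over.\<close>
  have "separation (verts H) (arcs_ends H) {a} (verts H) a"
    using a connected_collectionD(4)[OF F HF] connected_collectionD(7)[OF F HF]
    unfolding separation_def by blast
  with H have "?P (H, {a}, verts H, a)" by simp
  from ex_has_least_nat[of ?P, OF this, of "\<lambda>(H, A, B, a). card B"]
  obtain q where "?P q" "\<And>q'. ?P q' \<Longrightarrow> (\<lambda>(H, A, B, a). card B) q \<le> (\<lambda>(H, A, B, a). card B) q'"
    by blast
  then show thesis by (cases q) (use that in force)
qed

section \<open>Numberings with prescribed first vertices\<close>

lemma bij_betw_insert_Suc:
  assumes "bij_betw g X {..<n}" and "z \<notin> X"
  shows "bij_betw (\<lambda>x. if x = z then 0 else Suc (g x)) (insert z X) {..<Suc n}"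
proof -
  have inj: "inj_on g X" and img: "g ` X = {..<n}" using assms(1) by (auto simp: bij_betw_def)
  have "inj_on (\<lambda>x. if x = z then 0 else Suc (g x)) (insert z X)"
    using inj assms(2) by (auto simp: inj_on_def)
  moreover have *: "(\<lambda>x. if x = z then 0 else Suc (g x)) ` X = Suc ` g ` X"
    unfolding image_image using assms(2) by (intro image_cong) auto
  have "(\<lambda>x. if x = z then 0 else Suc (g x)) ` insert z X = {..<Suc n}"
    unfolding image_insert * img lessThan_Suc_eq_insert_0 by simp
  ultimately show ?thesis by (simp add: bij_betw_def)
qed

lemma numbering1:
  assumes "finite X" "a \<in> X"
  obtains f where "bij_betw f X {..<card X}" "f a = (0 :: nat)"
proof -
  have "finite (X - {a})" using assms(1) by simp
  from ex_bij_betw_finite_nat[OF this] obtain g where "bij_betw g (X - {a}) {..<card (X - {a})}"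
    by (auto simp: atLeast0LessThan)
  from bij_betw_insert_Suc[OF this, of a] have
    "bij_betw (\<lambda>x. if x = a then 0 else Suc (g x)) X {..<card X}"
    using assms by (simp add: insert_absorb card_Suc_Diff1 del: card_Diff_insert card_Diff_singleton_if card_Diff_singleton)
  with that show thesis by simp
qed

lemma numbering2:
  assumes "finite X" "a \<in> X" "b \<in> X" "b \<noteq> a"
  obtains f where "bij_betw f X {..<card X}" "f a = (0 :: nat)" "f b = 1"
proof -
  have "finite (X - {a})" "b \<in> X - {a}" using assms by auto
  then obtain g where g: "bij_betw g (X - {a}) {..<card (X - {a})}" "g b = (0 :: nat)"
    by (rule numbering1)
  from bij_betw_insert_Suc[OF g(1), of a] have
    "bij_betw (\<lambda>x. if x = a then 0 else Suc (g x)) X {..<card X}"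
    using assms by (simp add: insert_absorb card_Suc_Diff1 del: card_Diff_insert card_Diff_singleton_if card_Diff_singleton)
  with that[of "\<lambda>x. if x = a then 0 else Suc (g x)"] g(2) assms(4) show thesis by simp
qed

lemma edge_list:
  fixes f :: "'a \<Rightarrow> nat"
  assumes "finite X"
  obtains L where "distinct L" "set L = {(f x, f y) | x y. (x, y) \<in> E \<and> x \<in> X \<and> y \<in> X \<and> f x < f y}"
proof -
  have "{(f x, f y) | x y. (x, y) \<in> E \<and> x \<in> X \<and> y \<in> X \<and> f x < f y} \<subseteq> f ` X \<times> f ` X" by auto
  then have "finite {(f x, f y) | x y. (x, y) \<in> E \<and> x \<in> X \<and> y \<in> X \<and> f x < f y}"
    using assms finite_subset by blast
  from finite_distinct_list[OF this] that show thesis by blast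
qed


section \<open>Correctness of the reduction\<close>

context coded_gadget
begin

lemma deletion_set_imp_cover:
  assumes H: "graph H" "verts H = V" "arcs_ends H = E" "H \<in> F"
    and emb: "\<And>G \<iota>. symmetric G \<Longrightarrow> inj_on \<iota> (verts H) \<Longrightarrow> \<iota> ` verts H \<subseteq> verts G \<Longrightarrow>
      (\<And>x y. (x, y) \<in> arcs_ends H \<Longrightarrow> (\<iota> x, \<iota> y) \<in> arcs_ends G) \<Longrightarrow> le H G"
    and del: "has_deletion_set le F (input_graph gsize gedges) k"
  shows "\<exists>C \<subseteq> {..<N}. card C \<le> k \<and> vertex_cover (set es) C"
proof -
  let ?G = "input_graph gsize gedges"
  obtain S where S: "S \<subseteq> verts ?G" "card S \<le> k" "\<not> le H (?G \<restriction> (verts ?G - S))"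
    using del H(4) unfolding has_deletion_set_def by blast
  define S' where "S' = {p \<in> GV. code p \<in> S}"
  have inj: "inj_on code S'" using inj_code by (rule inj_on_subset) (auto simp: S'_def)
  have img: "code ` S' = S" using S(1) unfolding S'_def input_graph_gadget(2) by auto
  have sym: "symmetric (?G \<restriction> (verts ?G - S))"
    using symmetric_induce input_graph_gadget(1)
    by (auto simp: graph_def pseudo_graph_def sym_digraph_def sym_digraph_axioms_def)
  have "finite S" using S(1) finite_subset by (auto simp: input_graph_def)
  then have fin: "finite S'" using img inj by (metis finite_imageD)
  have "card (owner ` S') \<le> card S'" using fin by (rule card_image_le)
  also have "card S' = card S" using card_image[OF inj] img by simp
  finally have "card (owner ` S') \<le> k" using S(2) by simp
  moreover have "owner ` S' \<subseteq> {..<N}"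
    using E0 by (fastforce simp: S'_def GV_def)
  moreover have "vertex_cover (set es) (owner ` S')"
    unfolding vertex_cover_def
  proof (clarify, rule ccontr)
    fix u v assume e: "(u, v) \<in> set es" and v: "v \<notin> owner ` S'" and u: "u \<notin> owner ` S'"
    obtain \<iota> where \<iota>: "inj_on \<iota> V" "\<iota> ` V \<subseteq> GV - S'" "\<forall>(x, y) \<in> E. (\<iota> x, \<iota> y) \<in> GE"
      using uncovered_edge_embeds[OF e u v] by blast
    have sub: "code (\<iota> x) \<in> verts ?G - S" if "x \<in> V" for x
    proof -
      have "\<iota> x \<in> GV" "\<iota> x \<notin> S'" using \<iota>(2) that by auto
      then show ?thesis unfolding input_graph_gadget(2) S'_def by simp
    qed
    have "le H (?G \<restriction> (verts ?G - S))"
    proof (rule emb[OF sym])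
      have "inj_on code (\<iota> ` V)" using inj_code by (rule inj_on_subset) (use \<iota>(2) in blast)
      with \<iota>(1) show "inj_on (code \<circ> \<iota>) (verts H)" unfolding H(2) by (rule comp_inj_on)
      show "(code \<circ> \<iota>) ` verts H \<subseteq> verts (?G \<restriction> (verts ?G - S))" using sub H(2) by auto
      fix x y assume xy: "(x, y) \<in> arcs_ends H"
      then have "(\<iota> x, \<iota> y) \<in> GE" using \<iota>(3) H(3) by blast
      then have "(code (\<iota> x), code (\<iota> y)) \<in> arcs_ends ?G" unfolding input_graph_gadget(3) by force
      moreover have "x \<in> V" "y \<in> V" using xy H(3) AB by auto
      ultimately show "((code \<circ> \<iota>) x, (code \<circ> \<iota>) y) \<in> arcs_ends (?G \<restriction> (verts ?G - S))"
        using sub by (simp add: arcs_ends_induce)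
    qed
    with S(3) show False by contradiction
  qed
  ultimately show ?thesis by blast
qed

lemma cover_imp_deletion_set:
  assumes F: "connected_collection F" and H: "minimal_in F H" "verts H = V" "arcs_ends H = E"
    and min: "\<And>H' A' B' a'. minimal_in F H' \<Longrightarrow> separation (verts H') (arcs_ends H') A' B' a' \<Longrightarrow> card B \<le> card B'"
    and minor: "\<And>H G. graph H \<Longrightarrow> symmetric G \<Longrightarrow> le H G \<Longrightarrow> minor_of H G"
    and C: "C \<subseteq> {..<N}" "card C \<le> k" "vertex_cover (set es) C"
  shows "has_deletion_set le F (input_graph gsize gedges) k"
proof -
  let ?G = "input_graph gsize gedges"
  note R_def = R_def[OF C(3)]
  have sub: "C \<subseteq> verts ?G" using C(1) by (auto simp: input_graph_def gadget_size_def)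
  have symG: "symmetric ?G"
    using input_graph_gadget(1)
    by (auto simp: graph_def pseudo_graph_def sym_digraph_def sym_digraph_axioms_def)
  have "\<not> le H' (?G \<restriction> (verts ?G - C))" if H': "H' \<in> F" for H'
  proof
    assume "le H' (?G \<restriction> (verts ?G - C))"
    then have "minor_of H' (?G \<restriction> (verts ?G - C))"
      using minor connected_collectionD(1)[OF F H'] symmetric_induce[OF symG] by blast
    then obtain \<phi> where "gmodel H' (verts ?G - C) (arcs_ends ?G \<inter> (verts ?G - C) \<times> (verts ?G - C)) \<phi>"
      using minor_of_iff_model[OF symmetric_induce[OF symG]] by (auto simp: arcs_ends_induce)
    then obtain K \<psi> where K: "minimal_in F K"
      "gmodel K (verts ?G - C) (arcs_ends ?G \<inter> (verts ?G - C) \<times> (verts ?G - C)) \<psi>"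
      using minimal_minor[OF F H'] by blast
    then have KF: "K \<in> F" by (simp add: minimal_in_def)
    note K' = connected_collectionD[OF F KF]
    let ?inv = "inv_into GV code"
    have inv: "?inv (code p) = p" if "p \<in> GV" for p
      using that inj_code by (rule inv_into_f_f[rotated])
    have img: "verts ?G - C \<subseteq> code ` GV" using input_graph_gadget(2) by blast
    \<comment> \<open>Undoing the numbering embeds what is left of the output graph into
      \<open>R C\<close>, and the model moves along by composition.\<close>
    have "minor_model (verts ?G - C) (arcs_ends ?G \<inter> (verts ?G - C) \<times> (verts ?G - C)) (R C) GE (\<lambda>z. {?inv z})"
    proof (rule minor_model_embedding)
      show "inj_on ?inv (verts ?G - C)" using img by (rule inj_on_inv_into)
      show "?inv ` (verts ?G - C) \<subseteq> R C"
      proof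
        fix p assume "p \<in> ?inv ` (verts ?G - C)"
        then obtain q where q: "q \<in> GV" "code q \<notin> C" "p = q" using img inv by auto
        then show "p \<in> R C" unfolding R_def by (auto simp: core_vertex_def nA(2))
      qed
      fix x y assume "(x, y) \<in> arcs_ends ?G \<inter> (verts ?G - C) \<times> (verts ?G - C)"
      then obtain p q where "(p, q) \<in> GE" "x = code p" "y = code q"
        unfolding input_graph_gadget(3) by auto
      then show "(?inv x, ?inv y) \<in> GE" using GE_subset inv by auto
    qed
    from minor_model_trans[OF K(2) this K'(4)] obtain \<psi>' where "gmodel K (R C) GE \<psi>'" by blast
    have "\<exists>\<chi>. gmodel K A E \<chi>"
      by (rule minor_avoiding_cover[OF C(3) K'(3-7) _ \<open>gmodel K (R C) GE \<psi>'\<close>]) (rule min[OF K(1)])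
    then obtain \<chi> where \<chi>: "gmodel K A E \<chi>" by blast
    \<comment> \<open>Through the core, \<open>K\<close> is also a minor of \<open>H\<close>, so
      minimality of \<open>H\<close> gives \<open>card V \<le> card (verts K) \<le> card A\<close>;
      but \<open>A\<close> misses \<open>b\<close>.\<close>
    have le: "card (verts K) \<le> card A" using minor_model_card_le[OF \<chi> AB(7)] by blast
    have "A \<subseteq> V" using AB by blast
    with \<chi> have "gmodel K V E \<chi>" unfolding minor_model_def by blast
    then have "card V \<le> card (verts K)" using H KF unfolding minimal_in_def by blast
    moreover have "A \<subset> V" using AB b by blast
    then have "card A < card V" using finV by (simp add: psubset_card_mono)
    ultimately show False using le by simp
  qed
  then show ?thesis unfolding has_deletion_set_def using sub C(2) by blast
qed

end


section \<open>Asymptotics\<close>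

lemma bigo_power_bound:
  fixes g :: "nat \<Rightarrow> real"
  assumes "g \<in> O(\<lambda>n. real n ^ d)"
  obtains C where "0 \<le> C" "\<And>n. g n \<le> C * (real n + 1) ^ d"
proof -
  obtain c where "0 < c" "eventually (\<lambda>n. norm (g n) \<le> c * norm (real n ^ d)) at_top"
    using assms by (rule landau_o.bigE)
  then obtain n0 where n0: "\<And>n. n \<ge> n0 \<Longrightarrow> \<bar>g n\<bar> \<le> c * real n ^ d"
    by (auto simp: eventually_at_top_linorder)
  \<comment> \<open>The sum takes care of the finitely many exceptions, and
    \<open>real n + 1\<close> keeps the bound from vanishing at 0.\<close>
  define C where "C = c + (\<Sum>n < n0. \<bar>g n\<bar>)"
  have "0 \<le> C" using \<open>0 < c\<close> by (simp add: C_def sum_nonneg)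
  moreover have "g n \<le> C * (real n + 1) ^ d" for n
  proof (cases "n < n0")
    case True
    then have "\<bar>g n\<bar> \<le> (\<Sum>n < n0. \<bar>g n\<bar>)" by (intro member_le_sum) auto
    then have "g n \<le> C * 1" using \<open>0 < c\<close> by (simp add: C_def)
    also have "\<dots> \<le> C * (real n + 1) ^ d"
      using \<open>0 \<le> C\<close> by (intro mult_left_mono one_le_power) auto
    finally show ?thesis .
  next
    case False
    then have "g n \<le> c * real n ^ d" using n0[of n] by simp
    also have "\<dots> \<le> C * (real n + 1) ^ d"
      using \<open>0 < c\<close> by (intro mult_mono power_mono) (auto simp: C_def sum_nonneg)
    finally show ?thesis .
  qed
  ultimately show thesis by (rule that)
qed

text \<open>\<open>f\<close> need not be monotone and the treewidth is known only up to an upper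
  bound, so \<open>f\<close> is replaced by its maximum below that bound. The inserted 0 makes the
  exponent nonnegative.\<close>

lemma Max_smallo:
  fixes f :: "nat \<Rightarrow> real"
  assumes "f \<in> o(\<lambda>w. real w)"
  shows "(\<lambda>n. Max (insert 0 (f ` {..2 * n + s}))) \<in> o(\<lambda>n. real n)"
proof (rule landau_o.smallI)
  fix \<epsilon> :: real assume \<epsilon>: "0 < \<epsilon>"
  \<comment> \<open>The factor 4 covers \<open>w \<le> 2 * n + s \<le> 4 * n\<close>, valid once
    \<open>s \<le> n\<close>.\<close>
  then have "eventually (\<lambda>w. norm (f w) \<le> \<epsilon> / 4 * norm (real w)) at_top"
    by (intro landau_o.smallD[OF assms]) simp
  then obtain w0 where w0: "\<And>w. w \<ge> w0 \<Longrightarrow> \<bar>f w\<bar> \<le> \<epsilon> / 4 * real w"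
    by (auto simp: eventually_at_top_linorder)
  define m where "m = (\<Sum>w < w0. \<bar>f w\<bar>)"
  have "eventually (\<lambda>n. m / \<epsilon> \<le> real n) at_top" "eventually (\<lambda>n. real s \<le> real n) at_top"
    by real_asymp+
  then show "eventually (\<lambda>n. norm (Max (insert 0 (f ` {..2 * n + s}))) \<le> \<epsilon> * norm (real n)) at_top"
  proof eventually_elim
    case (elim n)
    have "f w \<le> \<epsilon> * real n" if w: "w \<le> 2 * n + s" for w
    proof (cases "w < w0")
      case True
      then have "\<bar>f w\<bar> \<le> m" unfolding m_def by (intro member_le_sum) auto
      moreover have "m \<le> \<epsilon> * real n" using elim(1) \<epsilon> by (simp add: field_simps)
      ultimately show ?thesis by simp
    next
      case False
      then have "f w \<le> \<epsilon> / 4 * real w" using w0[of w] by simp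
      also have "\<dots> \<le> \<epsilon> / 4 * (4 * real n)"
        using w elim(2) \<epsilon> by (intro mult_left_mono) linarith+
      finally show ?thesis by simp
    qed
    then have "Max (insert 0 (f ` {..2 * n + s})) \<le> \<epsilon> * real n"
      using \<epsilon> by (intro Max.boundedI) auto
    moreover have "0 \<le> Max (insert 0 (f ` {..2 * n + s}))" by (intro Max_ge) auto
    ultimately show ?case by simp
  qed
qed

text \<open>Moves polynomial factors of the running time into the exponent of 2.\<close>

lemma log_polynomial_smallo:
  fixes C :: real
  assumes "0 < C"
  shows "(\<lambda>n. log 2 (C * (real n + 1) ^ D)) \<in> o(\<lambda>n. real n)"
proof -
  have "log 2 (C * (real n + 1) ^ D) = log 2 C + real D / ln 2 * ln (real n + 1)" for n
  proof -
    have "log 2 (C * (real n + 1) ^ D) = log 2 C + log 2 ((real n + 1) ^ D)"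
      using assms by (subst log_mult) auto
    also have "log 2 ((real n + 1) ^ D) = real D * log 2 (real n + 1)"
      by (rule log_nat_power) simp
    finally show ?thesis by (simp add: log_def)
  qed
  moreover have "(\<lambda>n. ln (real n + 1)) \<in> o(\<lambda>n. real n)" by real_asymp
  then have "(\<lambda>n. real D / ln 2 * ln (real n + 1)) \<in> o(\<lambda>n. real n)"
    by (cases "D = 0") auto
  moreover have "(\<lambda>n. log 2 C) \<in> o(\<lambda>n. real n)" by real_asymp
  ultimately show ?thesis by (simp add: sum_in_smallo)
qed

lemma gadget_size_bound:
  assumes inst: "(n, cs) \<in> sat3_instances"
  shows "gadget_size na nb (vc_size (n, cs)) (length (vc_edges (n, cs))) \<le> 72 * (na + nb + 1) * (n + 1) ^ 3"
proof -
  \<comment> \<open>The 72 is 9 times this 8: both vertices and edges of the vertex cover instance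
    number at most \<open>9 * (n + length cs)\<close>.\<close>
  have "n + length cs \<le> 8 * (n + 1) ^ 3"
    using length_clauses_le[OF inst] by (simp add: power3_eq_cube algebra_simps)
  then have "9 * (n + length cs) * (na + nb + 1) \<le> 9 * (8 * (n + 1) ^ 3) * (na + nb + 1)"
    by (intro mult_le_mono) auto
  moreover have "gadget_size na nb (vc_size (n, cs)) (length (vc_edges (n, cs))) \<le>
      9 * (n + length cs) + 9 * (n + length cs) * nb + 9 * (n + length cs) * na"
    unfolding gadget_size_def vc_size_def length_vc_edges prod.case by (intro add_mono mult_le_mono) auto
  ultimately show ?thesis by (simp add: algebra_simps)
qed

text \<open>\<open>emb\<close> and \<open>minor\<close> place \<open>le\<close> between subgraph and
  minor containment; each serves one direction of the equivalence. Running the solver after the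
  reduction decides 3-SAT within \<open>2 powr h n\<close>, where \<open>h\<close> is sublinear as
  the treewidth is at most \<open>2 * n + s\<close>.\<close>

lemma ETH_reduction:
  fixes F :: "('a, 'b) pre_digraph set"
    and le :: "('a, 'b) pre_digraph \<Rightarrow> (nat, nat \<times> nat) pre_digraph \<Rightarrow> bool"
  assumes F: "connected_collection F" and "ETH"
    and emb: "\<And>H G \<iota>. graph H \<Longrightarrow> symmetric G \<Longrightarrow> inj_on \<iota> (verts H) \<Longrightarrow> \<iota> ` verts H \<subseteq> verts G \<Longrightarrow>
      (\<And>x y. (x, y) \<in> arcs_ends H \<Longrightarrow> (\<iota> x, \<iota> y) \<in> arcs_ends G) \<Longrightarrow> le H G"
    and minor: "\<And>H G. graph H \<Longrightarrow> symmetric G \<Longrightarrow> le H G \<Longrightarrow> minor_of H G"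
  shows "\<not> deletion_solvable_subexp_tw le F"
proof
  assume "deletion_solvable_subexp_tw le F"
  then obtain c f g d where f: "f \<in> o(\<lambda>w. real w)" and g: "g \<in> O(\<lambda>n. real n ^ d)"
    and dec: "decides_within c deletion_instances enc_deletion
          (\<lambda>(n, es, k). has_deletion_set le F (input_graph n es) k)
          (\<lambda>(n, es, k). 2 powr f (treewidth (input_graph n es)) * g n)"
    unfolding deletion_solvable_subexp_tw_def by blast
  obtain H A B a where H: "minimal_in F H" and sep: "separation (verts H) (arcs_ends H) A B a"
    and min: "\<And>H' A' B' a'. minimal_in F H' \<Longrightarrow> separation (verts H') (arcs_ends H') A' B' a' \<Longrightarrow> card B \<le> card B'"
    using smallest_separation[OF F] by blast
  have HF: "H \<in> F" using H by (simp add: minimal_in_def)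
  note H' = connected_collectionD[OF F HF]
  have "finite (A \<union> B)" "a \<in> A \<inter> B" using sep H'(2) by (auto simp: separation_def)
  then have aAB: "a \<in> A" "a \<in> B" "finite A" "finite B" by simp_all
  obtain b where b: "b \<in> B" "b \<noteq> a" using sep aAB(2) unfolding separation_def by blast
  obtain nA where nA: "bij_betw nA A {..<card A}" "nA a = (0 :: nat)"
    by (rule numbering1[OF aAB(3,1)])
  obtain nB where nB: "bij_betw nB B {..<card B}" "nB a = (0 :: nat)" "nB b = 1"
    by (rule numbering2[OF aAB(4,2) b])
  obtain LA where LA: "distinct LA"
    "set LA = {(nA x, nA y) | x y. (x, y) \<in> arcs_ends H \<and> x \<in> A \<and> y \<in> A \<and> nA x < nA y}"
    by (rule edge_list[OF aAB(3)])
  obtain LB where LB: "distinct LB"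
    "set LB = {(nB x, nB y) | x y. (x, y) \<in> arcs_ends H \<and> x \<in> B \<and> y \<in> B \<and> nB x < nB y}"
    by (rule edge_list[OF aAB(4)])
  let ?red = "reduce (card A) (card B) LA LB"
  let ?prog = "reduction_prog (card A) (card B) LA LB"
  define s where "s = 9 * card (verts H)"
  have coded: "coded_gadget (vc_size (n, cs)) (vc_edges (n, cs)) (verts H) (arcs_ends H) A B a b
      nA nB (card A) (card B) LA LB" if inst: "(n, cs) \<in> sat3_instances" for n cs
  proof -
    have lt: "u < v" and ends: "u \<in> {..<vc_size (n, cs)} \<and> v \<in> {..<vc_size (n, cs)} \<and> u \<noteq> v"
      if "(u, v) \<in> set (vc_edges (n, cs))" for u v
      using vc_edges_ordered[OF inst that] by auto
    show ?thesis
      by unfold_locales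
        (erule ends lt | rule sep b H'(2) H'(5) H'(6) nA nB LA LB distinct_vc_edges[OF inst])+
  qed
  have reduce: "?red (n, cs) \<in> deletion_instances \<and>
      (case ?red (n, cs) of (N, es, k) \<Rightarrow> (has_deletion_set le F (input_graph N es) k \<longleftrightarrow> satisfiable (n, cs)) \<and>
         treewidth (input_graph N es) \<le> 2 * n + s)" if inst: "(n, cs) \<in> sat3_instances" for n cs
  proof -
    interpret coded_gadget "vc_size (n, cs)" "vc_edges (n, cs)" "verts H" "arcs_ends H" A B a b
      nA nB "card A" "card B" LA LB by (rule coded[OF inst])
    have "has_deletion_set le F (input_graph gsize gedges) (vc_budget (n, cs)) \<longleftrightarrow> satisfiable (n, cs)"
    proof
      assume "has_deletion_set le F (input_graph gsize gedges) (vc_budget (n, cs))"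
      then have "\<exists>C \<subseteq> {..<vc_size (n, cs)}. card C \<le> vc_budget (n, cs) \<and> vertex_cover (set (vc_edges (n, cs))) C"
        by (rule deletion_set_imp_cover[OF H'(1) refl refl HF, rotated]) (rule emb[OF H'(1)])
      then show "satisfiable (n, cs)" using cover_imp_satisfiable[OF inst] by blast
    next
      assume "satisfiable (n, cs)"
      from satisfiable_imp_cover[OF inst this] obtain C where
        C: "C \<subseteq> {..<vc_size (n, cs)}" "card C \<le> vc_budget (n, cs)" "vertex_cover (set (vc_edges (n, cs))) C"
        by blast
      show "has_deletion_set le F (input_graph gsize gedges) (vc_budget (n, cs))"
        by (rule cover_imp_deletion_set[OF F H refl refl _ _ C]) (rule min minor; assumption)+
    qed
    then show ?thesis
      using gadget_instance treewidth_vc_gadget[OF inst refl refl] by (simp add: reduce_def s_def)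
  qed
  obtain C1 where C1: "0 \<le> C1" "\<And>n. g n \<le> C1 * (real n + 1) ^ d"
    using bigo_power_bound[OF g] by blast
  define Kt where "Kt = real (reduction_time (card A) (card B) LA LB)"
  define Kn where "Kn = real (72 * (card A + card B + 1))"
  define K where "K = 8 * Kt + C1 * (Kn + 1) ^ d + 1"
  \<comment> \<open>The reduction takes time of order \<open>(n + 1) ^ 4\<close>, a linear factor
    for cubically many clauses. The output has cubically many vertices, so the solver's factor has
    degree \<open>3 * d\<close>; the sum serves both.\<close>
  define D where "D = 4 + 3 * d"
  define fm where "fm n = Max (insert 0 (f ` {..2 * n + s}))" for n
  define h where "h n = fm n + log 2 (K * (real n + 1) ^ D)" for n
  have "0 \<le> Kt" "0 \<le> Kn" by (simp_all add: Kt_def Kn_def)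
  then have K: "0 < K" unfolding K_def using C1(1) by (intro add_nonneg_pos) auto
  have "h \<in> o(\<lambda>n. real n)"
    unfolding h_def fm_def by (intro sum_in_smallo Max_smallo[OF f] log_polynomial_smallo[OF K])
  moreover have "decides_within (CSeq ?prog c) sat3_instances enc_sat3 satisfiable (\<lambda>(n, _). 2 powr h n)"
    unfolding decides_within_def
  proof (intro ballI)
    fix i assume "i \<in> sat3_instances"
    then obtain n cs where i: "i = (n, cs)" and inst: "(n, cs) \<in> sat3_instances" by (cases i) auto
    obtain N es k where red: "?red (n, cs) = (N, es, k)" by (metis surj_pair)
    have red': "(N, es, k) \<in> deletion_instances" "has_deletion_set le F (input_graph N es) k \<longleftrightarrow> satisfiable (n, cs)"
      "treewidth (input_graph N es) \<le> 2 * n + s"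
      using reduce[OF inst] unfolding red by auto
    obtain t1 where t1: "exec ?prog ((\<lambda>_. NIL)(0 := enc_sat3 (n, cs))) t1 ((\<lambda>_. NIL)(0 := enc_deletion (N, es, k)))"
      "t1 \<le> reduction_time (card A) (card B) LA LB * ((n + 1) * (length cs + 1))"
      using runs_reduction_prog[OF inst, of "card A" "card B" LA LB] unfolding runs_def red by blast
    obtain t2 s2 where t2: "exec c ((\<lambda>_. NIL)(0 := enc_deletion (N, es, k))) t2 s2"
      "s2 0 \<noteq> NIL \<longleftrightarrow> has_deletion_set le F (input_graph N es) k"
      "real t2 \<le> 2 powr f (treewidth (input_graph N es)) * g N"
      using dec red'(1) unfolding decides_within_def by fastforce
    let ?x = "real n + 1"
    have x: "1 \<le> ?x" by simp
    have fm: "0 \<le> fm n" "f (treewidth (input_graph N es)) \<le> fm n"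
      using red'(3) unfolding fm_def by (auto intro!: Max_ge simp del: Max_insert)
    have "length cs + 1 \<le> 8 * (n + 1) ^ 3"
      using length_clauses_le[OF inst] by (simp add: power3_eq_cube algebra_simps)
    then have "(n + 1) * (length cs + 1) \<le> (n + 1) * (8 * (n + 1) ^ 3)" by (rule mult_le_mono2)
    also have "\<dots> = 8 * (n + 1) ^ 4"
    proof -
      have "y * (8 * y ^ 3) = 8 * y ^ 4" for y :: nat by (simp add: power4_eq_xxxx power3_eq_cube)
      then show ?thesis .
    qed
    finally have "t1 \<le> reduction_time (card A) (card B) LA LB * (8 * (n + 1) ^ 4)"
      using t1(2) by (meson mult_le_mono2 order_trans)
    then have "real t1 \<le> real (reduction_time (card A) (card B) LA LB * (8 * (n + 1) ^ 4))"
      by (rule of_nat_mono)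
    also have "\<dots> = 8 * Kt * ?x ^ 4" by (simp add: Kt_def add.commute)
    also have "\<dots> \<le> 8 * Kt * ?x ^ D"
      using \<open>0 \<le> Kt\<close> x by (intro mult_left_mono power_increasing) (auto simp: D_def)
    finally have b1: "real t1 \<le> 8 * Kt * ?x ^ D" .
    have "N \<le> 72 * (card A + card B + 1) * (n + 1) ^ 3"
      using gadget_size_bound[OF inst, of "card A" "card B"] red by (simp add: reduce_def)
    then have "real N \<le> real (72 * (card A + card B + 1) * (n + 1) ^ 3)" by (rule of_nat_mono)
    then have "real N \<le> Kn * ?x ^ 3" by (simp add: Kn_def add.commute)
    moreover have "1 \<le> ?x ^ 3" using x by (rule one_le_power)
    ultimately have "real N + 1 \<le> (Kn + 1) * ?x ^ 3" unfolding distrib_right by linarith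
    then have "C1 * (real N + 1) ^ d \<le> C1 * ((Kn + 1) * ?x ^ 3) ^ d"
      using C1(1) by (intro mult_left_mono power_mono) auto
    also have "\<dots> = C1 * (Kn + 1) ^ d * ?x ^ (3 * d)" by (simp add: power_mult_distrib power_mult)
    also have "\<dots> \<le> C1 * (Kn + 1) ^ d * ?x ^ D"
      using C1(1) \<open>0 \<le> Kn\<close> x by (intro mult_left_mono power_increasing) (auto simp: D_def)
    finally have gN: "g N \<le> C1 * (Kn + 1) ^ d * ?x ^ D" using C1(2)[of N] by simp
    have nonneg: "0 \<le> C1 * (Kn + 1) ^ d * ?x ^ D" using C1(1) \<open>0 \<le> Kn\<close> by simp
    have "2 powr f (treewidth (input_graph N es)) * g N \<le>
        2 powr f (treewidth (input_graph N es)) * (C1 * (Kn + 1) ^ d * ?x ^ D)"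
      using gN by (intro mult_left_mono) auto
    also have "\<dots> \<le> 2 powr fm n * (C1 * (Kn + 1) ^ d * ?x ^ D)"
      using fm(2) nonneg by (intro mult_right_mono) auto
    finally have b2: "real t2 \<le> 2 powr fm n * (C1 * (Kn + 1) ^ d * ?x ^ D)" using t2(3) by simp
    \<comment> \<open>This lets the time of the reduction be absorbed by the bound of the
      solver.\<close>
    have "1 \<le> 2 powr fm n" using fm(1) by (intro ge_one_powr_ge_zero) auto
    then have "1 * (8 * Kt * ?x ^ D) \<le> 2 powr fm n * (8 * Kt * ?x ^ D)"
      using \<open>0 \<le> Kt\<close> by (intro mult_right_mono) auto
    with b1 b2 have "real (t1 + t2) \<le> 2 powr fm n * ((8 * Kt + C1 * (Kn + 1) ^ d) * ?x ^ D)"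
      by (simp add: algebra_simps)
    also have "\<dots> \<le> 2 powr fm n * (K * ?x ^ D)"
      by (intro mult_left_mono mult_right_mono) (auto simp: K_def)
    also have "\<dots> = 2 powr h n"
    proof -
      have "0 < K * ?x ^ D" using K by simp
      then show ?thesis by (simp add: h_def powr_add)
    qed
    finally have "real (t1 + t2) \<le> 2 powr h n" .
    then show "\<exists>t s. exec (CSeq ?prog c) ((\<lambda>_. NIL)(0 := enc_sat3 i)) t s \<and> (s 0 \<noteq> NIL \<longleftrightarrow> satisfiable i) \<and>
        real t \<le> (case i of (n, _) \<Rightarrow> 2 powr h n)"
      using exec.Seq[OF t1(1) t2(1)] t2(2) red'(2) unfolding i prod.case
      by (intro exI[of _ "t1 + t2"] exI[of _ s2]) blast
  qed
  ultimately show False using \<open>ETH\<close> unfolding ETH_def by blast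
qed

theorem theorem9:
  fixes F :: "('a,'b) pre_digraph set"
  assumes "connected_collection F"
    and "ETH"
  shows "\<not> deletion_solvable_subexp_tw topological_minor_of F \<and>
         \<not> deletion_solvable_subexp_tw minor_of F"
proof
  show "\<not> deletion_solvable_subexp_tw topological_minor_of F"
  proof (rule ETH_reduction[OF assms])
    fix H :: "('a, 'b) pre_digraph" and G :: "(nat, nat \<times> nat) pre_digraph" and \<iota>
    assume e: "graph H" "symmetric G" "inj_on \<iota> (verts H)" "\<iota> ` verts H \<subseteq> verts G"
      "\<And>x y. (x, y) \<in> arcs_ends H \<Longrightarrow> (\<iota> x, \<iota> y) \<in> arcs_ends G"
    show "topological_minor_of H G"
      by (rule embedding_imp_topological_minor[OF e(1-4)]) (rule e(5))
  qed (rule topological_minor_imp_minor)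
  show "\<not> deletion_solvable_subexp_tw minor_of F"
  proof (rule ETH_reduction[OF assms])
    fix H :: "('a, 'b) pre_digraph" and G :: "(nat, nat \<times> nat) pre_digraph" and \<iota>
    assume e: "graph H" "symmetric G" "inj_on \<iota> (verts H)" "\<iota> ` verts H \<subseteq> verts G"
      "\<And>x y. (x, y) \<in> arcs_ends H \<Longrightarrow> (\<iota> x, \<iota> y) \<in> arcs_ends G"
    have "topological_minor_of H G"
      by (rule embedding_imp_topological_minor[OF e(1-4)]) (rule e(5))
    with e(1,2) show "minor_of H G" by (rule topological_minor_imp_minor)
  qed
qed

end
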